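(* Let $k$ be an algebraically closed field of characteristic $p>0$, $K=\mathrm{Frac}\,W(k)$, and let $(V,\Phi)$ be an isocrystal of dimension $d$ over $k$ with Newton vector $\nu=(\nu(1)^{s_1},\ldots,\nu(l)^{s_l})$, where $\nu(1)\geq\cdots\geq\nu(l)$ and $\nu(i)=r_i/s_i$ with $r_i,s_i$ coprime integers, $s_i>0$. Fix a Hodge vector $\mu=(\mu_1\geq\cdots\geq\mu_d)\in\mathbb{Q}^d$. Let $\lambda=(\bar\lambda_1^{d_1},\ldots,\bar\lambda_r^{d_r})\in\mathbb{Q}^d$ with $\bar\lambda_1>\cdots>\bar\lambda_r$ and $d_i\geq 1$ for all $i$. Then $\lambda$ is the Harder–Narasimhan vector of $(V,\Phi,\mathcal{F})$ for some filtration $\mathcal{F}$ of $V$ (over $K$) of type $\mu$ if and only if there exist partitions into non-empty disjoint subsets $\{1,\ldots,l\}=I_1\cup\cdots\cup I_r$ and $\{1,\ldots,d\}=J_1\cup\cdots\cup J_r$ such that, for all $i=1,\ldots,r$, putting $\underline{\nu}_i\in\mathbb{Q}^{d_i}$ for the decreasing tuple consisting of the entries $\nu(k)$ repeated $s_k$ times, $k\in I_i$, and $\underline{\mu}_i\in\mathbb{Q}^{d_i}$ for the decreasing rearrangement of the entries $\mu_k$, $k\in J_i$ (with multiplicities): (1) $|J_i|=d_i$; (2) $d_i=\sum_{k\in I_i}s_k$; (3) $\underline{\mu}_i\geq\underline{\nu}_i$; (4) $\bar\lambda_i\cdot d_i=|\underline{\mu}_i|-|\underline{\nu}_i|$.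
   Context: An isocrystal $(V,\Phi)$ over $k$ is a finite-dimensional $K$-vector space $V$ with a $\sigma$-linear bijection $\Phi$, $\sigma$ the Frobenius of $K$. By Dieudonné–Manin, $V=\bigoplus_{i=1}^l V_i$ with $V_i$ simple of slope $\nu(i)=r_i/s_i$ and $\dim V_i=s_i$; the Newton vector lists the slopes with multiplicity in decreasing order, the exponent $x^{s}$ meaning $x$ repeated $s$ times. For a subisocrystal $U$ let $t_N(U)$ be the sum of the slopes of $U$ with multiplicity. For $v\in\mathbb{Q}^n$ put $|v|=\sum_j v_j$. A filtration of type $\mu$ is a decreasing, exhaustive, separated $\mathbb{Q}$-indexed filtration $\mathcal{F}^\bullet$ of $V$ by $K$-subspaces with $\dim \mathrm{gr}^x_{\mathcal{F}}V=\#\{j:\mu_j=x\}$ for all $x\in\mathbb{Q}$. For a nonzero subisocrystal $U$ (or a subquotient with the induced filtration) put $\deg_{\mathcal{F}}(U)=\sum_x x\dim\mathrm{gr}^x_{\mathcal{F}}(U)$ and $\mathrm{slope}_{\mathcal{F}}(U)=(\deg_{\mathcal{F}}(U)-t_N(U))/\dim U$. $(V,\Phi,\mathcal{F})$ is semistable if $\mathrm{slope}_{\mathcal{F}}(U)\leq\mathrm{slope}_{\mathcal{F}}(V)$ for all nonzero subisocrystals $U$. The Harder–Narasimhan filtration is the unique filtration $0=W^0\subset\cdots\subset W^r=V$ by subisocrystals such that each $\mathrm{gr}^i=W^i/W^{i-1}$ with induced filtration is semistable and the slopes $\mathrm{slope}(\mathrm{gr}^i)$ strictly decrease; the HN-vector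 is $(\mathrm{slope}(\mathrm{gr}^1)^{\dim \mathrm{gr}^1},\ldots,\mathrm{slope}(\mathrm{gr}^r)^{\dim\mathrm{gr}^r})$. Order on $\mathbb{Q}^n$: for $a,b\in\mathbb{Q}^n$, $a\geq b$ means $\sum_{j\leq k}a_j-\frac{k|a|}{n}\geq\sum_{j\leq k}b_j-\frac{k|b|}{n}$ for all $k=1,\ldots,n-1$. *)

theory Defs
  imports
    "HOL-Library.Multiset"
    "HOL-Library.Disjoint_Sets"
    "HOL-Computational_Algebra.Computational_Algebra"
begin

text \<open>
  For a perfect field \<open>k\<close> of characteristic \<open>p\<close>, the ring of Witt vectors \<open>W(k)\<close> is, up to unique
  isomorphism, the \<open>p\<close>-adically complete and separated domain of characteristic 0 with a surjection
  onto \<open>k\<close> whose kernel is generated by \<open>p\<close> (Serre, Local Fields, II.5). The locale says that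
  \<open>'K\<close> is the fraction field of \<open>W = W(k)\<close>, with \<open>k\<close> the type \<open>'k\<close> and \<open>red\<close> the reduction map
  (its values outside \<open>W\<close> are irrelevant).
\<close>

locale frac_witt =
  fixes p :: nat
    and W :: "'K::field_char_0 set"
    and red :: "'K \<Rightarrow> 'k::alg_closed_field"
  assumes char_k: "CHAR('k) = p" and p_pos: "p > 0"
    and W_one: "1 \<in> W"
    and W_diff: "\<And>a b. a \<in> W \<Longrightarrow> b \<in> W \<Longrightarrow> a - b \<in> W"
    and W_mult: "\<And>a b. a \<in> W \<Longrightarrow> b \<in> W \<Longrightarrow> a * b \<in> W"
    and red_one: "red 1 = 1"
    and red_add: "\<And>a b. a \<in> W \<Longrightarrow> b \<in> W \<Longrightarrow> red (a + b) = red a + red b"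
    and red_mult: "\<And>a b. a \<in> W \<Longrightarrow> b \<in> W \<Longrightarrow> red (a * b) = red a * red b"
    and red_surj: "red ` W = UNIV"
    and red_kernel: "\<And>a. a \<in> W \<Longrightarrow> red a = 0 \<longleftrightarrow> (\<exists>b\<in>W. a = of_nat p * b)"
    and separated: "\<And>a. (\<And>n. \<exists>b\<in>W. a = of_nat p ^ n * b) \<Longrightarrow> a = 0"
    and complete: "\<And>a :: nat \<Rightarrow> 'K. (\<And>n. a n \<in> W) \<Longrightarrow>
           (\<And>n. \<exists>b\<in>W. a (Suc n) - a n = of_nat p ^ n * b) \<Longrightarrow>
           \<exists>c\<in>W. \<forall>n. \<exists>b\<in>W. c - a n = of_nat p ^ n * b"
    and fractions: "\<And>x. \<exists>a\<in>W. \<exists>b\<in>W. b \<noteq> 0 \<and> x = a / b"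

text \<open>
  The Frobenius of \<open>K\<close> is the only field automorphism that maps \<open>W(k)\<close> to itself and lifts
  \<open>x \<mapsto> x\<^sup>p\<close> on \<open>k\<close>.
\<close>

locale witt_frobenius = frac_witt p W red
  for p :: nat and W :: "'K::field_char_0 set" and red :: "'K \<Rightarrow> 'k::alg_closed_field" +
  fixes \<sigma> :: "'K \<Rightarrow> 'K"
  assumes frob_bij: "bij \<sigma>"
    and frob_one: "\<sigma> 1 = 1"
    and frob_add: "\<And>a b. \<sigma> (a + b) = \<sigma> a + \<sigma> b"
    and frob_mult: "\<And>a b. \<sigma> (a * b) = \<sigma> a * \<sigma> b"
    and frob_W: "\<And>a. a \<in> W \<Longrightarrow> \<sigma> a \<in> W"
    and frob_lift: "\<And>a. a \<in> W \<Longrightarrow> red (\<sigma> a) = red a ^ p"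

locale isocrystal = witt_frobenius p W red \<sigma> + vector_space scale
  for p :: nat and W :: "'K::field_char_0 set" and red :: "'K \<Rightarrow> 'k::alg_closed_field"
    and \<sigma> :: "'K \<Rightarrow> 'K"
    and scale :: "'K \<Rightarrow> 'v::ab_group_add \<Rightarrow> 'v" (infixr \<open>*s\<close> 75) +
  fixes \<Phi> :: "'v \<Rightarrow> 'v"
  assumes finite_dim: "\<exists>B. finite B \<and> span B = UNIV"
    and Phi_add: "\<And>x y. \<Phi> (x + y) = \<Phi> x + \<Phi> y"
    and Phi_semilinear: "\<And>c x. \<Phi> (c *s x) = \<sigma> c *s \<Phi> x"
    and Phi_bij: "bij \<Phi>"
begin

definition subisocrystal :: "'v set \<Rightarrow> bool"
  where "subisocrystal U \<longleftrightarrow> subspace U \<and> \<Phi> ` U = U"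

text \<open>
  A subquotient \<open>A/B\<close> is given by the pair of subisocrystals \<open>B \<subseteq> A\<close>, and its subisocrystals are
  the \<open>U/B\<close> with \<open>B \<subseteq> U \<subseteq> A\<close>. All the notions below are those of the isocrystal \<open>A/B\<close>,
  with equations read modulo \<open>B\<close>; a subisocrystal \<open>U\<close> of \<open>V\<close> is the case \<open>A = U\<close>, \<open>B = {0}\<close>.
\<close>

definition simple :: "'v set \<Rightarrow> 'v set \<Rightarrow> bool"
  where "simple A B \<longleftrightarrow> subisocrystal A \<and> subisocrystal B \<and> B \<subset> A \<and>
    (\<forall>U. subisocrystal U \<and> B \<subseteq> U \<and> U \<subseteq> A \<longrightarrow> U = B \<or> U = A)"

text \<open>
  The simple isocrystal of slope \<open>r/s\<close> in the Dieudonne--Manin classification, with \<open>r\<close> and \<open>s > 0\<close>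
  coprime, has a basis \<open>e\<^sub>0, \<dots>, e\<^sub>s\<^sub>-\<^sub>1\<close> (here: of \<open>A/B\<close>) such that \<open>\<Phi> e\<^sub>i = e\<^sub>i\<^sub>+\<^sub>1\<close> for
  \<open>i < s - 1\<close> and \<open>\<Phi> e\<^sub>s\<^sub>-\<^sub>1 = p\<^sup>r e\<^sub>0\<close>.
\<close>

definition simple_of_slope :: "'v set \<Rightarrow> 'v set \<Rightarrow> int \<Rightarrow> nat \<Rightarrow> bool"
  where "simple_of_slope A B r s \<longleftrightarrow> simple A B \<and> s > 0 \<and> coprime r (int s) \<and>
    (\<exists>e :: nat \<Rightarrow> 'v.
       span (B \<union> e ` {..<s}) = A \<and>
       (\<forall>c. (\<Sum>i<s. c i *s e i) \<in> B \<longrightarrow> (\<forall>i<s. c i = 0)) \<and>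
       (\<forall>i. Suc i < s \<longrightarrow> \<Phi> (e i) - e (Suc i) \<in> B) \<and>
       \<Phi> (e (s - 1)) - (of_nat p powi r) *s e 0 \<in> B)"

text \<open>\<open>A/B\<close> is the direct sum of simple isocrystals of slopes \<open>r i / s i\<close>, for \<open>i = 1, \<dots>, l\<close>.\<close>

definition has_newton_slopes ::
    "'v set \<Rightarrow> 'v set \<Rightarrow> nat \<Rightarrow> (nat \<Rightarrow> int) \<Rightarrow> (nat \<Rightarrow> nat) \<Rightarrow> bool"
  where "has_newton_slopes A B l r s \<longleftrightarrow>
    (\<exists>U :: nat \<Rightarrow> 'v set.
       (\<forall>i\<in>{1..l}. simple_of_slope (U i) B (r i) (s i)) \<and>
       span (B \<union> (\<Union>i\<in>{1..l}. U i)) = A \<and>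
       (\<forall>u. (\<forall>i\<in>{1..l}. u i \<in> U i) \<and> (\<Sum>i=1..l. u i) \<in> B \<longrightarrow> (\<forall>i\<in>{1..l}. u i \<in> B)))"

definition t_N :: "'v set \<Rightarrow> 'v set \<Rightarrow> rat"
  where "t_N A B = (THE t. \<exists>l r s. has_newton_slopes A B l r s \<and>
           t = (\<Sum>i=1..l. of_nat (s i) * (of_int (r i) / of_nat (s i))))"

definition filtration :: "(rat \<Rightarrow> 'v set) \<Rightarrow> bool"
  where "filtration F \<longleftrightarrow> (\<forall>x. subspace (F x)) \<and> antimono F \<and>
           (\<Union>x. F x) = UNIV \<and> (\<Inter>x. F x) = {0}"

text \<open>
  The filtration induced on \<open>A/B\<close> is \<open>x \<mapsto> (F x \<inter> A + B) / B\<close>; \<open>induced F A B x\<close> is the preimage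
  of its \<open>x\<close>-th step in \<open>A\<close>.
\<close>

definition induced :: "(rat \<Rightarrow> 'v set) \<Rightarrow> 'v set \<Rightarrow> 'v set \<Rightarrow> rat \<Rightarrow> 'v set"
  where "induced F A B x = {a + b | a b. a \<in> F x \<inter> A \<and> b \<in> B}"

text \<open>The dimension of \<open>gr\<^sup>x (A/B)\<close>, the \<open>x\<close>-th step modulo the union of the steps \<open>y > x\<close>.\<close>

definition gr_dim :: "(rat \<Rightarrow> 'v set) \<Rightarrow> 'v set \<Rightarrow> 'v set \<Rightarrow> rat \<Rightarrow> nat"
  where "gr_dim F A B x = dim (induced F A B x) - dim (\<Union>y\<in>{x<..}. induced F A B y)"

definition filtration_of_type :: "(rat \<Rightarrow> 'v set) \<Rightarrow> nat \<Rightarrow> (nat \<Rightarrow> rat) \<Rightarrow> bool"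
  where "filtration_of_type F d \<mu> \<longleftrightarrow> filtration F \<and>
           (\<forall>x. gr_dim F UNIV {0} x = card {j\<in>{1..d}. \<mu> j = x})"

definition deg :: "(rat \<Rightarrow> 'v set) \<Rightarrow> 'v set \<Rightarrow> 'v set \<Rightarrow> rat"
  where "deg F A B = (\<Sum>x | gr_dim F A B x \<noteq> 0. x * of_nat (gr_dim F A B x))"

definition slope :: "(rat \<Rightarrow> 'v set) \<Rightarrow> 'v set \<Rightarrow> 'v set \<Rightarrow> rat"
  where "slope F A B = (deg F A B - t_N A B) / of_nat (dim A - dim B)"

definition semistable :: "(rat \<Rightarrow> 'v set) \<Rightarrow> 'v set \<Rightarrow> 'v set \<Rightarrow> bool"
  where "semistable F A B \<longleftrightarrow>
    (\<forall>U. subisocrystal U \<and> B \<subset> U \<and> U \<subseteq> A \<longrightarrow> slope F U B \<le> slope F A B)"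

definition is_HN_filtration :: "(rat \<Rightarrow> 'v set) \<Rightarrow> nat \<Rightarrow> (nat \<Rightarrow> 'v set) \<Rightarrow> bool"
  where "is_HN_filtration F n H \<longleftrightarrow>
    H 0 = {0} \<and> H n = UNIV \<and>
    (\<forall>i\<le>n. subisocrystal (H i)) \<and>
    (\<forall>i\<in>{1..n}. H (i - 1) \<subset> H i \<and> semistable F (H i) (H (i - 1))) \<and>
    strict_antimono_on {1..n} (\<lambda>i. slope F (H i) (H (i - 1)))"

definition is_HN_vector :: "(rat \<Rightarrow> 'v set) \<Rightarrow> rat list \<Rightarrow> bool"
  where "is_HN_vector F v \<longleftrightarrow>
    (\<exists>n H. is_HN_filtration F n H \<and>
       v = concat (map (\<lambda>i. replicate (dim (H i) - dim (H (i - 1))) (slope F (H i) (H (i - 1))))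
                       [1..<Suc n]))"

end

definition dominates :: "rat list \<Rightarrow> rat list \<Rightarrow> bool"
  where "dominates a b \<longleftrightarrow> length a = length b \<and>
    (\<forall>k\<in>{1..<length a}.
       sum_list (take k a) - of_nat k * sum_list a / of_nat (length a) \<ge>
       sum_list (take k b) - of_nat k * sum_list b / of_nat (length b))"

definition decreasing_tuple :: "rat multiset \<Rightarrow> rat list"
  where "decreasing_tuple M = rev (sorted_list_of_multiset M)"

definition newton_part :: "(nat \<Rightarrow> int) \<Rightarrow> (nat \<Rightarrow> nat) \<Rightarrow> nat set \<Rightarrow> rat list"
  where "newton_part r s I =
    decreasing_tuple (\<Sum>k\<in>I. replicate_mset (s k) (of_int (r k) / of_nat (s k)))"

definition hodge_part :: "(nat \<Rightarrow> rat) \<Rightarrow> nat set \<Rightarrow> rat list"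
  where "hodge_part \<mu> J = decreasing_tuple (image_mset \<mu> (mset_set J))"

definition is_partition :: "nat set \<Rightarrow> nat \<Rightarrow> (nat \<Rightarrow> nat set) \<Rightarrow> bool"
  where "is_partition S n I \<longleftrightarrow>
    (\<forall>i\<in>{1..n}. I i \<noteq> {}) \<and> disjoint_family_on I {1..n} \<and> (\<Union>i\<in>{1..n}. I i) = S"

end

(*
  For the existence direction choose on each prescribed layer a vector v that lies in no proper
  subisocrystal: its coordinates in an eigenbasis of a power of Phi are taken linearly independent
  over the fixed field of that power of the Frobenius, which is possible because k is infinite and
  the fixed field has finite residue field. The flag spanned by v, Phi v, Phi^2 v, ... is then in
  general position to every subisocrystal U, so the degree of U is the sum of the dim U smallest
  Hodge weights, which domination compares with t_N(U). Conversely, a chain of subisocrystals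
  distributes the simple summands over its layers by semisimplicity, and testing semistability of a
  layer on the part of small slopes gives domination at the breaks of the Newton polygon, which is
  enough. That t_N is well defined follows by comparing two eigenbases: the Frobenius preserves the
  valuation, so it has no eigenvalues of nonzero valuation.
*)

theory Submission
  imports Defs
begin

subsection \<open>Lists, multisets and polygons\<close>

text \<open>Domination is met in its tail form: the sums of the last \<open>e\<close> entries of
  both tuples differ by at most \<open>e\<close> times the mean difference. Tails appear because a
  subobject of dimension \<open>e\<close> in a layer carries \<open>e\<close> of its Hodge weights
  and \<open>e\<close> of its Newton slopes, so tail sums bound its degree and \<open>t_N\<close>
  from below. Each direction needs one of these bounds to be attained. A flag in general position
  attains the first for all subisocrystals at once, since a step of dimension \<open>m\<close> meets
  \<open>U\<close> in dimension \<open>max 0 (m - codim U)\<close>; the summands of slope at most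
  \<open>c\<close> attain the second. The fixed field enters because a suitable power of the
  semilinear map is diagonal with powers of \<open>p\<close> as entries, and the Frobenius fixes
  these. Comparing coefficients, an eigenvector with such an eigenvalue has coordinates in the fixed
  field. As the residues of that field form a finite set, \<open>k\<close> has room for any finite
  number of independent residues. No quotient space is formed: statements are made for pairs
  \<open>B \<subseteq> A\<close> modulo \<open>B\<close>, and second isomorphism theorems replace
  maps between quotients.\<close>

lemma sum_list_drop_le_sum_mset:
  fixes xs :: "rat list"
  assumes "sorted_wrt (\<ge>) xs" "M \<subseteq># mset xs"
  shows "sum_list (drop (length xs - size M) xs) \<le> sum_mset M"
  using assms
proof (induction xs arbitrary: M)
  case (Cons x ys)
  show ?case
  proof (cases "size M = length (x # ys)")
    case True
    then have "M = mset (x # ys)"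
      using Cons.prems(2) by (metis mset_subset_size nless_le size_mset subset_mset.nless_le)
    then show ?thesis by (metis diff_self_eq_0 drop0 order_refl size_mset sum_mset_sum_list)
  next
    case False
    then have lt: "size M \<le> length ys"
      using Cons.prems(2) size_mset_mono[OF Cons.prems(2)] by (simp add: le_Suc_eq)
    then have eq: "drop (length (x # ys) - size M) (x # ys) = drop (length ys - size M) ys"
      by (simp add: Suc_diff_le)
    show ?thesis
    proof (cases "M \<subseteq># mset ys")
      case True
      then show ?thesis using Cons eq by simp
    next
      case nsub: False
      then have "x \<in># M"
        using Cons.prems(2)
        by (metis add_mset_remove_trivial diff_single_trivial mset.simps(2) subset_eq_diff_conv add_mset_add_single)
      then obtain M' where M: "M = add_mset x M'" by (metis mset_add)
      have sub: "M' \<subseteq># mset ys" using Cons.prems(2) M by simp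
      have "M' \<noteq> mset ys" using lt M by auto
      then obtain y where y: "y \<in># mset ys - M'"
        by (metis multiset_nonemptyE subset_mset.add_diff_inverse sub add.right_neutral)
      then have "add_mset y M' \<subseteq># mset ys"
        by (metis insert_subset_eq_iff sub mset_subset_eq_insertD subset_mset.add_diff_inverse
            add_mset_add_single mset_subset_eq_mono_add mset_subset_eq_single union_commute
            subset_mset.order_refl)
      then have "sum_list (drop (length ys - size (add_mset y M')) ys) \<le> sum_mset (add_mset y M')"
        using Cons.IH[of "add_mset y M'"] Cons.prems(1) by simp
      moreover have "y \<le> x" using Cons.prems(1) y by (auto dest: in_diffD)
      ultimately show ?thesis using eq M by simp
    qed
  qed
qed simp

text \<open>Turns a splitting of the multiset of Hodge weights into a splitting of the index set;
  equal weights are handed out arbitrarily, one block at a time from the last.\<close>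

lemma partition_by_image_mset:
  assumes "finite S" "image_mset f (mset_set S) = (\<Sum>i=1..n. M i)"
  shows "\<exists>J :: nat \<Rightarrow> 'a set. disjoint_family_on J {1..n} \<and> (\<Union>i\<in>{1..n}. J i) = S \<and>
           (\<forall>i\<in>{1..n}. image_mset f (mset_set (J i)) = M i)"
  using assms
proof (induction n arbitrary: S)
  case 0
  then show ?case by (auto simp: disjoint_family_on_def mset_set_empty_iff)
next
  case (Suc n)
  have "image_mset f (mset_set S) = (\<Sum>i=1..n. M i) + M (Suc n)" using Suc.prems by simp
  then obtain P Q where PQ: "mset_set S = P + Q" "(\<Sum>i=1..n. M i) = image_mset f P"
    "M (Suc n) = image_mset f Q"
    by (metis image_mset_eq_plusD)
  \<comment> \<open>\<open>P\<close> and \<open>Q\<close> divide up a multiset without repetitions,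
    so both are sets, and disjoint.\<close>
  have cnt: "count P x + count Q x = (if x \<in> S then 1 else 0)" for x
    using PQ(1) Suc.prems(1) by (metis count_mset_set(1) count_mset_set(3) count_union)
  have P: "P = mset_set (set_mset P)"
  proof (rule multiset_eqI)
    fix x show "count P x = count (mset_set (set_mset P)) x"
      using cnt[of x] by (auto simp: count_mset_set' count_eq_zero_iff split: if_splits)
        (metis One_nat_def add_gr_0 count_greater_zero_iff le_add1 le_antisym less_Suc_eq_le
          not_gr_zero Suc_leI)+
  qed
  have Q: "Q = mset_set (set_mset Q)"
  proof (rule multiset_eqI)
    fix x show "count Q x = count (mset_set (set_mset Q)) x"
      using cnt[of x] by (auto simp: count_mset_set' count_eq_zero_iff split: if_splits)
        (metis One_nat_def add_gr_0 count_greater_zero_iff le_add2 le_antisym less_Suc_eq_le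
          not_gr_zero Suc_leI)+
  qed
  have un: "set_mset P \<union> set_mset Q = S" using PQ(1) Suc.prems(1)
    by (metis finite_set_mset_mset_set set_mset_union)
  have dis: "set_mset P \<inter> set_mset Q = {}"
  proof -
    have False if "x \<in># P" "x \<in># Q" for x
      using cnt[of x] that by (auto simp flip: count_greater_zero_iff split: if_splits)
    then show ?thesis by auto
  qed
  obtain J where J: "disjoint_family_on J {1..n}" "(\<Union>i\<in>{1..n}. J i) = set_mset P"
    "\<forall>i\<in>{1..n}. image_mset f (mset_set (J i)) = M i"
    using Suc.IH[of "set_mset P"] PQ(2) P by auto
  define J' where "J' = J(Suc n := set_mset Q)"
  have J'1: "J' (Suc n) = set_mset Q" and J'2: "\<And>i. i \<in> {1..n} \<Longrightarrow> J' i = J i"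
    by (auto simp: J'_def)
  have "{1..Suc n} = insert (Suc n) {1..n}" by auto
  then have "(\<Union>i\<in>{1..Suc n}. J' i) = set_mset Q \<union> (\<Union>i\<in>{1..n}. J' i)"
    by (simp only: UN_insert J'1)
  moreover have "(\<Union>i\<in>{1..n}. J' i) = (\<Union>i\<in>{1..n}. J i)" by (intro SUP_cong refl J'2)
  ultimately have "(\<Union>i\<in>{1..Suc n}. J' i) = set_mset Q \<union> set_mset P" using J(2) by simp
  then have "(\<Union>i\<in>{1..Suc n}. J' i) = S" using un by (simp only: Un_commute)
  moreover have "disjoint_family_on J' {1..Suc n}"
    unfolding disjoint_family_on_def
  proof (intro ballI impI)
    fix a b assume ab: "a \<in> {1..Suc n}" "b \<in> {1..Suc n}" "a \<noteq> b"
    have *: "J i \<subseteq> set_mset P" if "i \<in> {1..n}" for i using J(2) that by auto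
    consider "a \<in> {1..n}" "b \<in> {1..n}" | "a = Suc n" "b \<in> {1..n}" | "b = Suc n" "a \<in> {1..n}"
      using ab by fastforce
    then show "J' a \<inter> J' b = {}"
    proof cases
      case 1 then show ?thesis using J(1) ab(3) by (auto simp: J'_def disjoint_family_on_def)
    next
      case 2 then show ?thesis using *[of b] dis by (auto simp: J'_def)
    next
      case 3 then show ?thesis using *[of a] dis by (auto simp: J'_def)
    qed
  qed
  moreover have "\<forall>i\<in>{1..Suc n}. image_mset f (mset_set (J' i)) = M i"
    using J(3) PQ(3) Q by (auto simp: J'_def le_Suc_eq)
  ultimately show ?case by blast
qed

text \<open>Strict decrease makes the runs maximal, so the first entry and the number of its
  occurrences recover the first pair.\<close>

lemma concat_replicate_inject:
  fixes xs ys :: "(nat \<times> 'a::linorder) list"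
  assumes "\<forall>z\<in>set xs \<union> set ys. fst z > 0"
    and "sorted_wrt (\<lambda>a b. snd a > snd b) xs" "sorted_wrt (\<lambda>a b. snd a > snd b) ys"
    and "concat (map (\<lambda>z. replicate (fst z) (snd z)) xs) = concat (map (\<lambda>z. replicate (fst z) (snd z)) ys)"
  shows "xs = ys"
  using assms
proof (induction xs arbitrary: ys)
  case Nil
  show ?case
  proof (cases ys)
    case (Cons y ys')
    then show ?thesis using Nil by (cases "fst y") auto
  qed simp
next
  case (Cons x xs)
  let ?c = "\<lambda>zs. concat (map (\<lambda>z. replicate (fst z) (snd z)) zs)"
  obtain y ys' where ys: "ys = y # ys'"
    using Cons.prems by (cases ys) (auto simp: gr0_conv_Suc)
  have x: "fst x > 0" and y: "fst y > 0" using Cons.prems(1) ys by auto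
  have "hd (?c (x # xs)) = snd x" "hd (?c (y # ys')) = snd y"
    using x y by (auto simp: hd_append gr0_conv_Suc)
  then have snd: "snd x = snd y" using Cons.prems(4) ys by metis
  have f: "filter (\<lambda>a. a = snd z) (?c (z # zs)) = replicate (fst z) (snd z)"
    if "sorted_wrt (\<lambda>a b. snd a > snd b) (z # zs)" for z :: "nat \<times> 'a" and zs
  proof -
    have "filter (\<lambda>a. a = snd z) (?c zs) = []"
      using that by (auto simp: filter_empty_conv)
    then show ?thesis by simp
  qed
  have "fst x = fst y"
    using f[OF Cons.prems(2)] f[OF Cons.prems(3)[unfolded ys]] Cons.prems(4) ys snd
    by (metis length_replicate)
  then have xy: "x = y" using snd by (simp add: prod_eq_iff)
  then have "?c xs = ?c ys'" using Cons.prems(4) ys by simp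
  then have "xs = ys'" using Cons.IH[of ys'] Cons.prems ys by simp
  then show ?case using xy ys by simp
qed

text \<open>The form needed to read layer dimensions and slopes off a Harder-Narasimhan vector,
  which is a bare list.\<close>

lemma concat_replicate_upt_inject:
  fixes g g' :: "nat \<Rightarrow> 'a::linorder"
  assumes "concat (map (\<lambda>i. replicate (f i) (g i)) [1..<Suc n]) =
           concat (map (\<lambda>i. replicate (f' i) (g' i)) [1..<Suc n'])"
    and "\<And>i. i \<in> {1..n} \<Longrightarrow> f i > 0" "\<And>i. i \<in> {1..n'} \<Longrightarrow> f' i > 0"
    and "strict_antimono_on {1..n} g" "strict_antimono_on {1..n'} g'"
  shows "n = n'" and "\<And>i. i \<in> {1..n} \<Longrightarrow> f i = f' i \<and> g i = g' i"
proof -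
  let ?p = "\<lambda>f g n. map (\<lambda>i. (f i, g i)) [1..<Suc n]"
  have s: "sorted_wrt (\<lambda>a b. snd a > snd b) (map (\<lambda>i. (h i :: nat, k i :: 'a)) [1..<Suc m])"
    if "strict_antimono_on {1..m} k" for h k m
    using that unfolding sorted_wrt_map
    by (intro sorted_wrt_mono_rel[OF _ sorted_wrt_upt]) (auto simp: monotone_on_def)
  have eq: "?p f g n = ?p f' g' n'"
    by (rule concat_replicate_inject) (use assms s in \<open>auto simp: comp_def\<close>)
  then have "length (?p f g n) = length (?p f' g' n')" by metis
  then show n: "n = n'" by (simp del: upt_Suc)
  fix i assume "i \<in> {1..n}"
  then show "f i = f' i \<and> g i = g' i" using eq n by auto
qed

lemma decreasing_tuple:
  "mset (decreasing_tuple M) = M" "sorted_wrt (\<ge>) (decreasing_tuple M)"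
  "length (decreasing_tuple M) = size M" "sum_list (decreasing_tuple M) = sum_mset M"
proof -
  show m: "mset (decreasing_tuple M) = M" by (simp add: decreasing_tuple_def)
  show "sorted_wrt (\<ge>) (decreasing_tuple M)"
    by (simp add: decreasing_tuple_def sorted_wrt_rev)
  show "length (decreasing_tuple M) = size M" "sum_list (decreasing_tuple M) = sum_mset M"
    by (metis m size_mset, metis m sum_mset_sum_list)
qed

text \<open>At a break the tail is cut out by a threshold on the values. A tail of the Newton tuple
  is then the slope multiset of a sum of simple summands, which need not be so for a cut inside a
  run of equal slopes.\<close>

lemma filter_sorted_eq_drop:
  fixes xs :: "rat list"
  assumes "sorted_wrt (\<ge>) xs" "0 < k" "k < length xs" "xs ! k < xs ! (k - 1)"
  shows "filter (\<lambda>x. x \<le> xs ! k) xs = drop k xs"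
proof -
  have "filter (\<lambda>x. x \<le> xs ! k) (take k xs) = []"
  proof -
    have "\<not> xs ! i \<le> xs ! k" if "i < k" for i
    proof (cases "i = k - 1")
      case True
      then show ?thesis using assms(4) by simp
    next
      case False
      then have "i < k - 1" using that by simp
      then have "xs ! (k - 1) \<le> xs ! i"
        using sorted_wrt_nth_less[OF assms(1), of i "k - 1"] assms(3) by simp
      then show ?thesis using assms(4) by simp
    qed
    then show ?thesis using assms(3) by (auto simp: filter_empty_conv in_set_conv_nth)
  qed
  moreover have "filter (\<lambda>x. x \<le> xs ! k) (drop k xs) = drop k xs"
  proof (rule filter_True, rule ballI)
    fix x assume "x \<in> set (drop k xs)"
    then obtain i where i: "i < length xs - k" "x = xs ! (k + i)"
      by (auto simp: in_set_conv_nth)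
    show "x \<le> xs ! k"
    proof (cases "i = 0")
      case True then show ?thesis using i by simp
    next
      case False
      then show ?thesis using i sorted_wrt_nth_less[OF assms(1), of k "k + i"] by simp
    qed
  qed
  ultimately show ?thesis by (metis append_take_drop_id filter_append append_Nil)
qed

text \<open>
  At the first minimum of the difference of the two polygons, the polygon of \<open>b\<close> has a break;
  so it suffices to compare the polygons at the breaks of \<open>b\<close>.
\<close>

lemma dominatesI_breaks:
  assumes a: "sorted_wrt (\<ge>) a" and len: "length a = length b"
    and break: "\<And>k. 0 < k \<Longrightarrow> k < length b \<Longrightarrow> b ! k < b ! (k - 1) \<Longrightarrow>
      sum_list (drop k a) - sum_list (drop k b)
        \<le> of_nat (length a - k) * ((sum_list a - sum_list b) / of_nat (length a))"
  shows "dominates a b"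
proof (rule ccontr)
  define N where "N = length a"
  define c where "c = (sum_list a - sum_list b) / of_nat N"
  \<comment> \<open>The gap between the two polygons minus its chord: it vanishes at both ends, and
    domination says that it is nowhere negative.\<close>
  define f where "f k = sum_list (take k a) - sum_list (take k b) - of_nat k * c" for k
  assume "\<not> dominates a b"
  then obtain k1 where k1: "1 \<le> k1" "k1 < N" "f k1 < 0"
    using len unfolding dominates_def f_def c_def N_def
    by (auto simp: not_le algebra_simps diff_divide_distrib)
  define m where "m = Min (f ` {..N})"
  have m_le: "m \<le> f k" if "k \<le> N" for k unfolding m_def using that by (intro Min_le) auto
  have "m \<in> f ` {..N}" unfolding m_def by (intro Min_in) auto
  \<comment> \<open>Taking the first minimum makes the descent into \<open>k\<close> strict. With
    the weak ascent after it and \<open>a\<close> decreasing, this forces a strict drop of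
    \<open>b\<close> at \<open>k\<close>.\<close>
  define k where "k = (LEAST k. k \<le> N \<and> f k = m)"
  have k: "k \<le> N" "f k = m"
    using LeastI_ex[of "\<lambda>k. k \<le> N \<and> f k = m"] \<open>m \<in> f ` {..N}\<close> unfolding k_def by auto
  have k_least: "f j \<noteq> m" if "j < k" for j
    using not_less_Least[of j "\<lambda>k. k \<le> N \<and> f k = m"] that k(1) unfolding k_def by auto
  have m0: "m < 0" using m_le[of k1] k1 by simp
  have f0: "f 0 = 0" by (simp add: f_def)
  have fN: "f N = 0" using k1 len by (auto simp: f_def c_def N_def)
  have k0: "0 < k" "k < N" using k m0 f0 fN by (auto intro: gr0I simp: le_less)
  have step: "f (Suc j) = f j + a ! j - b ! j - c" if "j < N" for j
    using that len by (simp add: f_def take_Suc_conv_app_nth N_def algebra_simps)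
  have "f (k - 1) > f k"
    using m_le[of "k - 1"] k k_least[of "k - 1"] k0 by fastforce
  moreover have "f k = f (k - 1) + a ! (k - 1) - b ! (k - 1) - c"
    using step[of "k - 1"] k0 by simp
  moreover have "f (Suc k) = f k + a ! k - b ! k - c" using step[of k] k0 by simp
  moreover have "f k \<le> f (Suc k)" using m_le[of "Suc k"] k k0 by simp
  moreover have "a ! k \<le> a ! (k - 1)"
    using sorted_wrt_nth_less[OF a, of "k - 1" k] k0 by (simp add: N_def)
  ultimately have "b ! k < b ! (k - 1)" by linarith
  from break[OF k0(1) _ this] k0 len
  have le: "sum_list (drop k a) - sum_list (drop k b) \<le> of_nat (N - k) * c"
    by (simp add: N_def c_def)
  have "sum_list a = sum_list (take k a) + sum_list (drop k a)"
    "sum_list b = sum_list (take k b) + sum_list (drop k b)"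
    by (metis append_take_drop_id sum_list_append)+
  moreover have "of_nat N * c = sum_list a - sum_list b"
    using k1 by (simp add: c_def)
  ultimately have "f k \<ge> 0"
    using le k0 by (simp add: f_def of_nat_diff algebra_simps)
  then show False using k m0 by simp
qed

subsection \<open>The valuation of the fraction field and the Frobenius\<close>

text \<open>On a finite field the product of all \<open>X - a\<close> vanishes everywhere, so adding
  1 gives a polynomial of positive degree without roots.\<close>

lemma infinite_UNIV_alg_closed_field: "infinite (UNIV :: 'a::alg_closed_field set)"
proof
  assume fin: "finite (UNIV :: 'a set)"
  define P :: "'a poly" where "P = (\<Prod>a\<in>UNIV. [:- a, 1:]) + 1"
  have "degree (\<Prod>a\<in>UNIV. [:- a, 1:] :: 'a poly) = (\<Sum>a\<in>(UNIV::'a set). 1)"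
    by (subst degree_prod_eq_sum_degree) auto
  moreover have "0 < card (UNIV :: 'a set)" using fin by (simp add: card_gt_0_iff)
  ultimately have "degree P > 0" unfolding P_def by (subst degree_add_eq_left) simp_all
  then obtain x where "poly P x = 0" using alg_closed_imp_poly_has_root by blast
  moreover have "poly (\<Prod>a\<in>UNIV. [:- a, 1:] :: 'a poly) x = 0"
    using fin by (simp add: poly_prod prod_zero_iff)
  ultimately show False by (simp add: P_def)
qed

text \<open>Coordinates are chosen one by one; as \<open>F\<close> is a finite set of coefficients,
  each new coordinate has only finitely many values to avoid.\<close>

lemma exists_linear_indep_over_finite:
  fixes F :: "'a::field set"
  assumes inf: "infinite (UNIV :: 'a set)" and F: "finite F" and Z: "finite Z"
  shows "\<exists>y :: 'z \<Rightarrow> 'a. \<forall>c. (\<forall>z\<in>Z. c z \<in> F) \<and> (\<Sum>z\<in>Z. c z * y z) = 0 \<longrightarrow> (\<forall>z\<in>Z. c z = 0)"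
  using Z
proof (induction Z)
  case (insert w Z)
  then obtain y where y: "\<And>c. (\<forall>z\<in>Z. c z \<in> F) \<Longrightarrow> (\<Sum>z\<in>Z. c z * y z) = 0 \<Longrightarrow> (\<forall>z\<in>Z. c z = 0)"
    by blast
  \<comment> \<open>All values of the new coordinate that satisfy a relation in which its
    coefficient \<open>a\<close> is nonzero; the junk value for \<open>a = 0\<close> only enlarges
    the set.\<close>
  define S where "S = (\<lambda>(c, a). - (\<Sum>z\<in>Z. c z * y z) / a) ` ((\<Pi>\<^sub>E z\<in>Z. F) \<times> F)"
  have "finite S" unfolding S_def using F insert.hyps by (intro finite_imageI finite_cartesian_product finite_PiE) auto
  then obtain t where t: "t \<notin> S" using inf ex_new_if_finite by blast
  define y' where "y' = y(w := t)"
  have "\<forall>z\<in>insert w Z. c z = 0" if c: "\<forall>z\<in>insert w Z. c z \<in> F"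
    and sum: "(\<Sum>z\<in>insert w Z. c z * y' z) = 0" for c
  proof -
    have "(\<Sum>z\<in>Z. c z * y' z) = (\<Sum>z\<in>Z. c z * y z)"
      using insert.hyps by (intro sum.cong) (auto simp: y'_def)
    then have eq: "c w * t + (\<Sum>z\<in>Z. c z * y z) = 0"
      using sum insert.hyps by (simp add: y'_def)
    have "c w = 0"
    proof (rule ccontr)
      assume ne: "c w \<noteq> 0"
      have "c w * t = - (\<Sum>z\<in>Z. c z * y z)" using eq by (simp add: eq_neg_iff_add_eq_0)
      then have "t = - (\<Sum>z\<in>Z. c z * y z) / c w" using ne by (metis nonzero_mult_div_cancel_left)
      also have "\<dots> = - (\<Sum>z\<in>Z. restrict c Z z * y z) / c w" by simp
      also have "\<dots> \<in> S" unfolding S_def using c by (intro image_eqI[where x = "(restrict c Z, c w)"]) auto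
      finally show False using t by simp
    qed
    moreover from this have "(\<Sum>z\<in>Z. c z * y z) = 0" using eq by simp
    then have "\<forall>z\<in>Z. c z = 0" using c by (intro y) simp_all
    ultimately show ?thesis by simp
  qed
  then show ?case by blast
qed simp

section \<open>Units of \<open>W\<close> and the p-adic valuation of its fraction field\<close>

context frac_witt
begin

lemma W_zero: "0 \<in> W" using W_diff[OF W_one W_one] by simp

lemma W_minus: "a \<in> W \<Longrightarrow> - a \<in> W" using W_diff[OF W_zero] by simp

lemma W_add: "a \<in> W \<Longrightarrow> b \<in> W \<Longrightarrow> a + b \<in> W" using W_diff[OF _ W_minus] by simp

lemma W_sum: "(\<And>i. i \<in> A \<Longrightarrow> f i \<in> W) \<Longrightarrow> sum f A \<in> W"
  by (induction A rule: infinite_finite_induct) (auto intro: W_zero W_add)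

lemma W_of_nat: "of_nat n \<in> W"
  by (induction n) (auto intro: W_zero W_one W_add)

lemma W_power: "a \<in> W \<Longrightarrow> a ^ n \<in> W"
  by (induction n) (auto intro: W_one W_mult)

lemma red_zero: "red 0 = 0"
  using red_add[OF W_zero W_zero] by (metis add.right_neutral add_cancel_right_right)

lemma red_sum: "(\<And>i. i \<in> A \<Longrightarrow> f i \<in> W) \<Longrightarrow> red (sum f A) = (\<Sum>i\<in>A. red (f i))"
  by (induction A rule: infinite_finite_induct) (auto simp: red_zero red_add W_sum)

lemma of_nat_p_nonzero: "(of_nat p :: 'K) \<noteq> 0"
  using p_pos by simp

lemma red_of_nat_p_mult: "b \<in> W \<Longrightarrow> red (of_nat p * b) = 0"
  using red_kernel[OF W_mult[OF W_of_nat]] by blast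

text \<open>These are the units of the local ring \<open>W\<close>; see
  \<open>unit_W_inverse\<close>.\<close>

definition unit_W :: "'K \<Rightarrow> bool"
  where "unit_W u \<longleftrightarrow> u \<in> W \<and> red u \<noteq> 0"

lemma unit_W_mult: "unit_W u \<Longrightarrow> unit_W w \<Longrightarrow> unit_W (u * w)"
  by (simp add: unit_W_def W_mult red_mult)

text \<open>The inverse of \<open>1 - p b\<close> is the limit of the partial sums of the geometric series.\<close>

lemma inverse_one_minus:
  assumes b: "b \<in> W"
  shows "\<exists>c\<in>W. (1 - of_nat p * b) * c = 1"
proof -
  let ?q = "of_nat p * b :: 'K"
  define a where "a n = (\<Sum>i<n. ?q ^ i)" for n
  have aW: "a n \<in> W" for n
    unfolding a_def by (intro W_sum W_power W_mult W_of_nat b)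
  have "\<exists>b\<in>W. a (Suc n) - a n = of_nat p ^ n * b" for n
    by (intro bexI[of _ "b ^ n"] W_power b) (simp add: a_def power_mult_distrib)
  then obtain c where c: "c \<in> W" "\<forall>n. \<exists>b\<in>W. c - a n = of_nat p ^ n * b"
    using complete[of a, OF aW] by blast
  have "(1 - ?q) * c - 1 = 0"
  proof (rule separated)
    fix n
    obtain e where e: "e \<in> W" "c - a n = of_nat p ^ n * e" using c by blast
    have "(1 - ?q) * a n = 1 - ?q ^ n"
      unfolding a_def by (metis one_diff_power_eq)
    moreover have "c = a n + of_nat p ^ n * e" using e by (simp add: algebra_simps)
    ultimately have "(1 - ?q) * c - 1 = of_nat p ^ n * ((1 - ?q) * e - b ^ n)"
      by (simp add: algebra_simps power_mult_distrib)
    then show "\<exists>b\<in>W. (1 - ?q) * c - 1 = of_nat p ^ n * b"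
      by (intro bexI) (auto intro!: W_diff W_mult W_one W_of_nat b e W_power)
  qed
  then show ?thesis using c by (intro bexI[of _ c]) auto
qed

text \<open>A lift of the inverse residue is an inverse up to a factor \<open>1 - p b\<close>, and
  the geometric series inverts that factor.\<close>

lemma unit_W_inverse:
  assumes u: "unit_W u"
  shows "unit_W (inverse u)"
proof -
  have uW: "u \<in> W" "red u \<noteq> 0" using u by (auto simp: unit_W_def)
  obtain v where v: "v \<in> W" "red v = inverse (red u)" using red_surj by (metis UNIV_I imageE)
  have "red (u * v) = 1" using uW v by (simp add: red_mult)
  moreover have "red (u * v) + red (1 - u * v) = red 1"
    using red_add[of "u * v" "1 - u * v"] uW v by (simp add: W_mult W_diff W_one)
  ultimately have "red (1 - u * v) = 0" by (simp add: red_one)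
  then obtain b where b: "b \<in> W" "1 - u * v = of_nat p * b"
    using red_kernel[of "1 - u * v"] uW v by (auto simp: W_mult W_diff W_one)
  obtain c where c: "c \<in> W" "(1 - of_nat p * b) * c = 1" using inverse_one_minus b by blast
  have "u * v = 1 - of_nat p * b" using b by (simp add: algebra_simps)
  then have 1: "u * (v * c) = 1" using c by (metis mult.assoc)
  then have inv: "inverse u = v * c" by (metis inverse_unique)
  then have W: "inverse u \<in> W" using v c by (simp add: W_mult)
  have "red u * red (inverse u) = 1"
    using red_mult[OF uW(1) W] 1 inv by (simp add: red_one)
  then show ?thesis using W by (auto simp: unit_W_def)
qed

text \<open>Separatedness bounds the powers of \<open>p\<close> that divide \<open>a\<close>; at the
  last one the cofactor has nonzero residue.\<close>

lemma W_valuation: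
  assumes a: "a \<in> W" "a \<noteq> 0"
  shows "\<exists>n u. unit_W u \<and> a = of_nat p ^ n * u"
proof -
  define P where "P n \<longleftrightarrow> (\<exists>b\<in>W. a = of_nat p ^ n * b)" for n
  obtain n where "\<not> P n" using separated[of a] a unfolding P_def by blast
  moreover have "P 0" using a by (auto simp: P_def)
  ultimately obtain m where m: "P m" "\<not> P (Suc m)"
    by (metis nat_induct)
  obtain b where b: "b \<in> W" "a = of_nat p ^ m * b" using m by (auto simp: P_def)
  have "red b \<noteq> 0"
  proof
    assume "red b = 0"
    then obtain c where "c \<in> W" "b = of_nat p * c" using red_kernel b by blast
    then have "P (Suc m)" unfolding P_def using b by (intro bexI[of _ c]) (auto simp: mult_ac)
    then show False using m by simp
  qed
  then show ?thesis using b by (auto simp: unit_W_def)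
qed

lemma valuation:
  assumes x: "x \<noteq> 0"
  shows "\<exists>m u. unit_W u \<and> x = of_nat p powi m * u"
proof -
  obtain a b where ab: "a \<in> W" "b \<in> W" "b \<noteq> 0" "x = a / b" using fractions by blast
  then have "a \<noteq> 0" using x by auto
  then obtain i j u w where
    u: "unit_W u" "a = of_nat p ^ i * u" and w: "unit_W w" "b = of_nat p ^ j * w"
    using W_valuation ab by metis
  have "x = of_nat p powi (int i - int j) * (u * inverse w)"
    using ab(4) u(2) w(2) of_nat_p_nonzero
    by (simp add: power_int_diff divide_inverse)
  moreover have "unit_W (u * inverse w)" using u w by (simp add: unit_W_mult unit_W_inverse)
  ultimately show ?thesis by blast
qed

lemma valuation_unique:
  assumes u: "unit_W u" "unit_W w" and eq: "of_nat p powi m * u = of_nat p powi n * w"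
  shows "m = n"
proof -
  have *: False if u: "unit_W u" and w: "unit_W w" and lt: "m < n"
    and eq: "of_nat p powi m * u = of_nat p powi n * w" for m n u w
  proof -
    obtain k where k: "n = m + (1 + int k)" using zless_iff_Suc_zadd lt by (metis add.commute of_nat_Suc)
    have "of_nat p powi n = of_nat p powi m * (of_nat p * of_nat p ^ k :: 'K)"
      unfolding k using of_nat_p_nonzero by (simp add: power_int_add)
    then have "u = of_nat p * (of_nat p ^ k * w)"
      using eq of_nat_p_nonzero by (simp add: mult.assoc)
    then have "red u = 0" using w by (simp add: red_of_nat_p_mult W_mult W_power W_of_nat unit_W_def)
    then show False using u by (simp add: unit_W_def)
  qed
  show ?thesis using *[of u w m n] *[of w u n m] u eq by (metis linorder_neqE)
qed

end

section \<open>Powers of the Frobenius and their fixed elements\<close>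

context witt_frobenius
begin

abbreviation frob_pow :: "nat \<Rightarrow> 'K \<Rightarrow> 'K"
  where "frob_pow D \<equiv> \<sigma> ^^ D"

lemma frob_pow_one: "frob_pow D 1 = 1"
  by (induction D) (auto simp: frob_one)

lemma frob_pow_add: "frob_pow D (a + b) = frob_pow D a + frob_pow D b"
  by (induction D) (auto simp: frob_add)

lemma frob_pow_mult: "frob_pow D (a * b) = frob_pow D a * frob_pow D b"
  by (induction D) (auto simp: frob_mult)

lemma frob_pow_zero: "frob_pow D 0 = 0"
  using frob_pow_add[of D 0 0] by simp

lemma frob_pow_of_nat: "frob_pow D (of_nat n) = of_nat n"
  by (induction n) (auto simp: frob_pow_zero frob_pow_one frob_pow_add)

lemma frob_pow_inverse: "frob_pow D (inverse a) = inverse (frob_pow D a)"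
proof (cases "a = 0")
  case False
  then have "frob_pow D a * frob_pow D (inverse a) = 1"
    by (metis frob_pow_mult frob_pow_one right_inverse)
  then show ?thesis by (metis inverse_unique)
qed (simp add: frob_pow_zero)

lemma frob_pow_power: "frob_pow D (a ^ n) = frob_pow D a ^ n"
  by (induction n) (auto simp: frob_pow_one frob_pow_mult)

lemma frob_pow_powi: "frob_pow D (of_nat p powi m) = of_nat p powi m"
  by (cases "m \<ge> 0") (simp_all add: power_int_def frob_pow_inverse frob_pow_power frob_pow_of_nat)

lemma frob_pow_W: "a \<in> W \<Longrightarrow> frob_pow D a \<in> W"
  by (induction D) (auto simp: frob_W)

lemma red_frob_pow: "a \<in> W \<Longrightarrow> red (frob_pow D a) = red a ^ (p ^ D)"
  by (induction D) (auto simp: frob_lift frob_pow_W power_mult[symmetric] mult.commute)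

lemma unit_W_frob_pow: "unit_W u \<Longrightarrow> unit_W (frob_pow D u)"
  using p_pos by (simp add: unit_W_def frob_pow_W red_frob_pow)

text \<open>\<open>\<sigma>\<close> preserves the \<open>p\<close>-adic valuation, so \<open>\<sigma>\<close>-twisted eigenvalues have well defined slopes.\<close>

lemma frob_eigenvalue_eq:
  assumes eq: "frob_pow D c * of_nat p powi a = of_nat p powi b * c" and c: "c \<noteq> 0"
  shows "a = b" and "frob_pow D c = c"
proof -
  obtain m u where u: "unit_W u" "c = of_nat p powi m * u" using valuation c by blast
  have "of_nat p powi (m + a) * frob_pow D u = of_nat p powi (b + m) * u"
    using eq u(2) of_nat_p_nonzero
    by (simp add: frob_pow_mult frob_pow_powi power_int_add mult_ac)
  then show ab: "a = b" using valuation_unique[OF unit_W_frob_pow[OF u(1)] u(1)] by fastforce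
  show "frob_pow D c = c" using eq of_nat_p_nonzero unfolding ab by (simp add: mult.commute power_int_not_zero)
qed

text \<open>The fixed points are roots of \<open>X^(p^D) - X\<close>, which is nonzero because
  \<open>p^D > 1\<close>.\<close>

lemma finite_red_fixed: "D > 0 \<Longrightarrow> finite {y :: 'k. y ^ (p ^ D) = y}"
proof -
  assume D: "D > 0"
  have p1: "p > 1" using char_k p_pos of_nat_CHAR[where 'a = 'k] by (cases "p = 1") auto
  define P :: "'k poly" where "P = monom 1 (p ^ D) - monom 1 1"
  have "p ^ D > 1" using one_less_power[OF p1 D] .
  then have "coeff P 1 \<noteq> 0" using p1 D by (simp add: P_def coeff_monom)
  then have "P \<noteq> 0" by auto
  then have "finite {y. poly P y = 0}" by (rule poly_roots_finite)
  then show ?thesis by (simp add: P_def poly_monom)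
qed

text \<open>The coordinates are lifts of residues that are independent over the finite fixed set in
  \<open>k\<close>. A nontrivial relation with fixed coefficients, scaled so that all are integral
  and one is a unit, would reduce to a nontrivial relation between these residues.\<close>

lemma exists_linear_indep_over_fixed:
  assumes D: "D > 0" and Z: "finite Z"
  shows "\<exists>x :: 'z \<Rightarrow> 'K. \<forall>c. (\<forall>z\<in>Z. frob_pow D (c z) = c z) \<and> (\<Sum>z\<in>Z. c z * x z) = 0
           \<longrightarrow> (\<forall>z\<in>Z. c z = 0)"
proof -
  obtain y :: "'z \<Rightarrow> 'k" where y: "\<And>c. (\<forall>z\<in>Z. c z \<in> {a. a ^ (p ^ D) = a}) \<Longrightarrow>
      (\<Sum>z\<in>Z. c z * y z) = 0 \<Longrightarrow> (\<forall>z\<in>Z. c z = 0)"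
    using exists_linear_indep_over_finite[OF infinite_UNIV_alg_closed_field finite_red_fixed[OF D] Z] by blast
  obtain x where x: "\<And>z. x z \<in> W" "\<And>z. red (x z) = y z"
  proof -
    have "\<forall>z. \<exists>w. w \<in> W \<and> red w = y z" using red_surj by (metis UNIV_I imageE)
    then show ?thesis using that by metis
  qed
  have "\<forall>z\<in>Z. c z = 0" if fixed: "\<forall>z\<in>Z. frob_pow D (c z) = c z" and sum: "(\<Sum>z\<in>Z. c z * x z) = 0" for c
  proof (rule ccontr)
    assume ne: "\<not> (\<forall>z\<in>Z. c z = 0)"
    define N where "N = {z\<in>Z. c z \<noteq> 0}"
    have N: "finite N" "N \<noteq> {}" using ne Z by (auto simp: N_def)
    obtain m u where mu: "\<And>z. z \<in> N \<Longrightarrow> unit_W (u z) \<and> c z = of_nat p powi (m z) * u z"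
      using valuation[of "c _"] unfolding N_def by (metis (mono_tags, lifting) mem_Collect_eq)
    define m0 where "m0 = Min (m ` N)"
    have m0_le: "m0 \<le> m z" if "z \<in> N" for z using that N by (simp add: m0_def)
    have "m0 \<in> m ` N" unfolding m0_def using N by (intro Min_in) auto
    then obtain z0 where z0: "z0 \<in> N" "m z0 = m0" by auto
    \<comment> \<open>Powers of \<open>p\<close> are fixed by the Frobenius, so dividing by
      \<open>p\<close> to the least valuation \<open>m0\<close> keeps the coefficients fixed; it
      makes all of them integral and that of \<open>z0\<close> a unit.\<close>
    define c' where "c' z = of_nat p powi (- m0) * c z" for z
    have c'N: "c' z = of_nat p ^ nat (m z - m0) * u z" if "z \<in> N" for z
      using mu[OF that] m0_le[OF that] of_nat_p_nonzero
      by (simp add: c'_def power_int_minus power_int_def[of _ "m z - m0", symmetric] power_int_diff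
          divide_inverse flip: power_int_of_nat)
    have c'W: "c' z \<in> W" if "z \<in> Z" for z
    proof (cases "z \<in> N")
      case True
      then show ?thesis using c'N mu by (simp add: W_mult W_power W_of_nat unit_W_def)
    next
      case False
      then show ?thesis using that by (simp add: N_def c'_def W_zero)
    qed
    have "frob_pow D (c' z) = c' z" if "z \<in> Z" for z
      using fixed that by (simp add: c'_def frob_pow_mult frob_pow_powi)
    then have "red (c' z) \<in> {a. a ^ (p ^ D) = a}" if "z \<in> Z" for z
      using red_frob_pow[OF c'W[OF that], of D] that by simp
    moreover have "(\<Sum>z\<in>Z. red (c' z) * y z) = 0"
    proof -
      have "(\<Sum>z\<in>Z. c' z * x z) = of_nat p powi (- m0) * (\<Sum>z\<in>Z. c z * x z)"
        by (simp add: c'_def sum_distrib_left mult.assoc)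
      then have "red (\<Sum>z\<in>Z. c' z * x z) = 0" using sum by (simp add: red_zero)
      then show ?thesis using c'W x by (simp add: red_sum W_mult red_mult)
    qed
    ultimately have "\<forall>z\<in>Z. red (c' z) = 0" by (intro y) simp_all
    then have "red (c' z0) = 0" using z0(1) by (simp add: N_def)
    moreover have "c' z0 = u z0" using c'N z0 by simp
    ultimately show False using mu[OF z0(1)] by (simp add: unit_W_def)
  qed
  then show ?thesis by blast
qed

end

subsection \<open>Linear algebra modulo a subspace\<close>

text \<open>Linear independence of the images of \<open>b\<close> in the quotient by
  \<open>B\<close>, without a quotient type. It concerns the indexed family, so equal vectors at
  distinct indices count as dependent.\<close>

definition indep_mod :: "('a::zero \<Rightarrow> 'b::comm_monoid_add \<Rightarrow> 'b) \<Rightarrow> 'b set \<Rightarrow> 'z set \<Rightarrow> ('z \<Rightarrow> 'b) \<Rightarrow> bool"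
  where "indep_mod scale B Z b \<longleftrightarrow> (\<forall>c. (\<Sum>z\<in>Z. scale (c z) (b z)) \<in> B \<longrightarrow> (\<forall>z\<in>Z. c z = 0))"

context vector_space
begin

lemma mem_span_Un:
  assumes "subspace X" "subspace Y"
  shows "x \<in> span (X \<union> Y) \<longleftrightarrow> (\<exists>a\<in>X. \<exists>b\<in>Y. x = a + b)"
  using assms by (auto simp: span_Un span_eq_iff[THEN iffD2])

lemma mem_span_Un_image:
  assumes B: "subspace B" and Z: "finite Z"
  shows "x \<in> span (B \<union> b ` Z) \<longleftrightarrow> (\<exists>c. x - (\<Sum>z\<in>Z. c z *s b z) \<in> B)"
  using Z
proof (induction Z arbitrary: x)
  case empty
  then show ?case using B by (simp add: span_eq_iff[THEN iffD2])
next
  case (insert w Z)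
  have "x \<in> span (B \<union> b ` insert w Z) \<longleftrightarrow> (\<exists>k c. x - k *s b w - (\<Sum>z\<in>Z. c z *s b z) \<in> B)"
    using span_breakdown_eq[of x "b w" "B \<union> b ` Z"] insert.IH by simp
  also have "\<dots> \<longleftrightarrow> (\<exists>c. x - (\<Sum>z\<in>insert w Z. c z *s b z) \<in> B)"
  proof
    assume "\<exists>k c. x - k *s b w - (\<Sum>z\<in>Z. c z *s b z) \<in> B"
    then obtain k c where kc: "x - k *s b w - (\<Sum>z\<in>Z. c z *s b z) \<in> B" by blast
    have "(\<Sum>z\<in>Z. (c(w := k)) z *s b z) = (\<Sum>z\<in>Z. c z *s b z)"
      using insert.hyps by (intro sum.cong) auto
    then show "\<exists>c. x - (\<Sum>z\<in>insert w Z. c z *s b z) \<in> B"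
      using kc insert.hyps by (intro exI[of _ "c(w := k)"]) (simp add: algebra_simps)
  next
    assume "\<exists>c. x - (\<Sum>z\<in>insert w Z. c z *s b z) \<in> B"
    then show "\<exists>k c. x - k *s b w - (\<Sum>z\<in>Z. c z *s b z) \<in> B"
      using insert.hyps by (metis (no_types, lifting) diff_diff_eq sum.insert)
  qed
  finally show ?case .
qed

lemma mem_span_Un_UN:
  assumes B: "subspace B" and I: "finite I" and U: "\<And>k. k \<in> I \<Longrightarrow> subspace (U k)"
  shows "x \<in> span (B \<union> (\<Union>k\<in>I. U k)) \<longleftrightarrow> (\<exists>u. (\<forall>k\<in>I. u k \<in> U k) \<and> x - (\<Sum>k\<in>I. u k) \<in> B)"
  using I U
proof (induction I arbitrary: x)
  case empty
  then show ?case using B by (simp add: span_eq_iff[THEN iffD2])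
next
  case (insert w I)
  have "B \<union> (\<Union>k\<in>insert w I. U k) = U w \<union> (B \<union> (\<Union>k\<in>I. U k))" by blast
  then have "x \<in> span (B \<union> (\<Union>k\<in>insert w I. U k)) \<longleftrightarrow>
      (\<exists>a\<in>U w. \<exists>b\<in>span (B \<union> (\<Union>k\<in>I. U k)). x = a + b)"
    using insert.prems by (simp add: span_Un[of "U w"] span_eq_iff[THEN iffD2]) blast
  also have "\<dots> \<longleftrightarrow> (\<exists>a\<in>U w. \<exists>u. (\<forall>k\<in>I. u k \<in> U k) \<and> x - a - (\<Sum>k\<in>I. u k) \<in> B)"
  proof -
    have "(\<exists>b\<in>S. x = a + b) \<longleftrightarrow> x - a \<in> S" for a S
      by (metis add_diff_cancel_left' add.commute diff_add_cancel)
    then show ?thesis using insert.IH insert.prems by simp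
  qed
  also have "\<dots> \<longleftrightarrow> (\<exists>u. (\<forall>k\<in>insert w I. u k \<in> U k) \<and> x - (\<Sum>k\<in>insert w I. u k) \<in> B)"
  proof
    assume "\<exists>a\<in>U w. \<exists>u. (\<forall>k\<in>I. u k \<in> U k) \<and> x - a - (\<Sum>k\<in>I. u k) \<in> B"
    then obtain a u where au: "a \<in> U w" "\<forall>k\<in>I. u k \<in> U k" "x - a - (\<Sum>k\<in>I. u k) \<in> B" by blast
    have "(\<Sum>k\<in>I. (u(w := a)) k) = (\<Sum>k\<in>I. u k)"
      using insert.hyps by (intro sum.cong) auto
    then show "\<exists>u. (\<forall>k\<in>insert w I. u k \<in> U k) \<and> x - (\<Sum>k\<in>insert w I. u k) \<in> B"
      using au insert.hyps by (intro exI[of _ "u(w := a)"]) (simp add: algebra_simps)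
  next
    assume "\<exists>u. (\<forall>k\<in>insert w I. u k \<in> U k) \<and> x - (\<Sum>k\<in>insert w I. u k) \<in> B"
    then show "\<exists>a\<in>U w. \<exists>u. (\<forall>k\<in>I. u k \<in> U k) \<and> x - a - (\<Sum>k\<in>I. u k) \<in> B"
      using insert.hyps by (metis (no_types, lifting) diff_diff_eq sum.insert insertCI)
  qed
  finally show ?case .
qed

lemma indep_modD: "indep_mod scale B Z b \<Longrightarrow> (\<Sum>z\<in>Z. c z *s b z) \<in> B \<Longrightarrow> z \<in> Z \<Longrightarrow> c z = 0"
  by (auto simp: indep_mod_def)

lemma indep_mod_subset:
  assumes "indep_mod scale B Z b" "finite Z" "Z' \<subseteq> Z"
  shows "indep_mod scale B Z' b"
  unfolding indep_mod_def
proof (intro allI impI ballI)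
  fix c z assume c: "(\<Sum>z\<in>Z'. c z *s b z) \<in> B" and z: "z \<in> Z'"
  define c' where "c' z = (if z \<in> Z' then c z else 0)" for z
  have "(\<Sum>z\<in>Z. c' z *s b z) = (\<Sum>z\<in>Z'. c' z *s b z)"
    using assms(2,3) by (intro sum.mono_neutral_right) (auto simp: c'_def)
  also have "\<dots> = (\<Sum>z\<in>Z'. c z *s b z)" by (intro sum.cong) (auto simp: c'_def)
  finally have "c' z = 0" using indep_modD[OF assms(1), of c' z] c z assms(3) by auto
  then show "c z = 0" using z by (simp add: c'_def)
qed

lemma indep_mod_insert:
  assumes "finite Z" "w \<notin> Z" and B: "subspace B"
  shows "indep_mod scale B (insert w Z) b \<longleftrightarrow> indep_mod scale B Z b \<and> b w \<notin> span (B \<union> b ` Z)"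
proof
  assume i: "indep_mod scale B (insert w Z) b"
  have False if mem: "b w \<in> span (B \<union> b ` Z)"
  proof -
    obtain c where c: "b w - (\<Sum>z\<in>Z. c z *s b z) \<in> B"
      using mem[unfolded mem_span_Un_image[OF B assms(1)]] by blast
    define c' where "c' = (\<lambda>z. - c z)(w := 1)"
    have "(\<Sum>z\<in>Z. c' z *s b z) = (\<Sum>z\<in>Z. - (c z *s b z))"
      using assms(2) by (intro sum.cong) (auto simp: c'_def scale_minus_left)
    then have "(\<Sum>z\<in>insert w Z. c' z *s b z) \<in> B"
      using c assms(1,2) by (simp add: c'_def sum_negf del: fun_upd_apply) (simp add: fun_upd_same)
    then show False using indep_modD[OF i, of c' w] by (simp add: c'_def)
  qed
  then show "indep_mod scale B Z b \<and> b w \<notin> span (B \<union> b ` Z)"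
    using indep_mod_subset[OF i, of Z] assms(1) by blast
next
  assume i: "indep_mod scale B Z b \<and> b w \<notin> span (B \<union> b ` Z)"
  show "indep_mod scale B (insert w Z) b"
    unfolding indep_mod_def
  proof (intro allI impI)
    fix c assume c: "(\<Sum>z\<in>insert w Z. c z *s b z) \<in> B"
    then have eq: "c w *s b w + (\<Sum>z\<in>Z. c z *s b z) \<in> B" using assms by simp
    have "c w = 0"
    proof (rule ccontr)
      assume ne: "c w \<noteq> 0"
      have "inverse (c w) *s (c w *s b w + (\<Sum>z\<in>Z. c z *s b z)) \<in> B"
        by (rule subspace_scale[OF B eq])
      also have "inverse (c w) *s (c w *s b w + (\<Sum>z\<in>Z. c z *s b z))
          = b w - (\<Sum>z\<in>Z. (- inverse (c w) * c z) *s b z)"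
        using ne by (simp add: scale_right_distrib scale_sum_right sum_negf scale_minus_left)
      finally have "\<exists>c. b w - (\<Sum>z\<in>Z. c z *s b z) \<in> B"
        by (intro exI[of _ "\<lambda>z. - inverse (c w) * c z"])
      then have "b w \<in> span (B \<union> b ` Z)" unfolding mem_span_Un_image[OF B assms(1)] .
      then show False using i by blast
    qed
    moreover from this have "\<forall>z\<in>Z. c z = 0" using eq indep_modD[of B Z b c] i by auto
    ultimately show "\<forall>z\<in>insert w Z. c z = 0" by blast
  qed
qed

lemma exists_indep_mod_subset:
  assumes "finite Z" and B: "subspace B"
  shows "\<exists>Z0\<subseteq>Z. indep_mod scale B Z0 b \<and> span (B \<union> b ` Z0) = span (B \<union> b ` Z)"
  using assms(1)
proof (induction Z)
  case empty
  then show ?case by (auto simp: indep_mod_def)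
next
  case (insert w Z)
  then obtain Z0 where Z0: "Z0 \<subseteq> Z" "indep_mod scale B Z0 b" "span (B \<union> b ` Z0) = span (B \<union> b ` Z)" by blast
  have fin: "finite Z0" "w \<notin> Z0" using Z0 insert.hyps finite_subset by auto
  have ins: "span (B \<union> b ` insert w Z') = span (insert (b w) (span (B \<union> b ` Z')))" for Z'
  proof -
    have "span (insert (b w) (span S)) = span (insert (b w) S)" for S
      using span_mono[of S "insert (b w) S"] span_superset[of S]
      by (intro span_eq[THEN iffD2]) (auto intro: span_base)
    then show ?thesis by simp
  qed
  show ?case
  proof (cases "b w \<in> span (B \<union> b ` Z)")
    case True
    then have "span (B \<union> b ` insert w Z) = span (B \<union> b ` Z)" by (simp add: span_redundant)
    then show ?thesis using Z0 by blast
  next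
    case False
    then have "indep_mod scale B (insert w Z0) b"
      using Z0 fin B by (simp add: indep_mod_insert)
    moreover have "span (B \<union> b ` insert w Z0) = span (B \<union> b ` insert w Z)"
      unfolding ins Z0(3) ..
    ultimately show ?thesis using Z0(1) by (intro exI[of _ "insert w Z0"]) auto
  qed
qed

text \<open>Coordinates in an independent family are unique, so a common vector has none outside
  \<open>S \<inter> T\<close>.\<close>

lemma indep_mod_span_Int:
  assumes "indep_mod scale {0} Z b" "finite Z" "S \<subseteq> Z" "T \<subseteq> Z"
  shows "span (b ` S) \<inter> span (b ` T) = span (b ` (S \<inter> T))"
proof
  have fin: "finite S" "finite T" using assms finite_subset by auto
  have mem: "x \<in> span (b ` S) \<longleftrightarrow> (\<exists>c. x = (\<Sum>z\<in>S. c z *s b z))" if "finite S" for x S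
    using mem_span_Un_image[OF subspace_single_0 that, of x b] by simp
  show "span (b ` S) \<inter> span (b ` T) \<subseteq> span (b ` (S \<inter> T))"
  proof
    fix x assume "x \<in> span (b ` S) \<inter> span (b ` T)"
    then obtain c e where c: "x = (\<Sum>z\<in>S. c z *s b z)" and e: "x = (\<Sum>z\<in>T. e z *s b z)"
      unfolding Int_iff mem[OF fin(1)] mem[OF fin(2)] by blast
    define c' where "c' z = (if z \<in> S then c z else 0)" for z
    define e' where "e' z = (if z \<in> T then e z else 0)" for z
    have "(\<Sum>z\<in>Z. c' z *s b z) = (\<Sum>z\<in>S. c z *s b z)"
      using assms(2,3) by (intro sum.mono_neutral_cong_right) (auto simp: c'_def)
    moreover have "(\<Sum>z\<in>Z. e' z *s b z) = (\<Sum>z\<in>T. e z *s b z)"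
      using assms(2,4) by (intro sum.mono_neutral_cong_right) (auto simp: e'_def)
    ultimately have "(\<Sum>z\<in>Z. (c' z - e' z) *s b z) \<in> {0}"
      using c e by (simp add: scale_left_diff_distrib sum_subtractf)
    then have eq: "c' z = e' z" if "z \<in> Z" for z
      using indep_modD[OF assms(1), of "\<lambda>z. c' z - e' z"] that by auto
    have "c z = 0" if "z \<in> S - T" for z
      using eq[of z] that assms(3) by (auto simp: c'_def e'_def split: if_splits)
    then have "x = (\<Sum>z\<in>S \<inter> T. c z *s b z)"
      unfolding c using fin by (intro sum.mono_neutral_right) auto
    then show "x \<in> span (b ` (S \<inter> T))" unfolding mem[OF finite_Int[OF disjI1[OF fin(1)]]] by blast
  qed
  show "span (b ` (S \<inter> T)) \<subseteq> span (b ` S) \<inter> span (b ` T)"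
    by (intro Int_greatest span_mono image_mono) auto
qed

end

context finite_dimensional_vector_space
begin

lemma dim_span_Un_image:
  assumes "finite Z" and B: "subspace B" and "indep_mod scale B Z b"
  shows "dim (span (B \<union> b ` Z)) = dim B + card Z"
  using assms(1,3)
proof (induction Z)
  case (insert w Z)
  then have "indep_mod scale B Z b" "b w \<notin> span (B \<union> b ` Z)" by (simp_all add: indep_mod_insert B)
  then show ?case using insert dim_insert[of "b w" "B \<union> b ` Z"] by simp
qed simp

text \<open>Vectors \<open>Z\<close> that complete \<open>X \<inter> Y\<close> to \<open>X\<close>
  also complete \<open>Y\<close> to \<open>X + Y\<close>, so both dimensions grow by
  \<open>card Z\<close>.\<close>

lemma dim_span_Un_Int:
  assumes X: "subspace X" and Y: "subspace Y"
  shows "dim (span (X \<union> Y)) + dim (X \<inter> Y) = dim X + dim Y"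
proof -
  have XY: "subspace (X \<inter> Y)" using X Y by (rule subspace_inter)
  obtain C where C: "C \<subseteq> X" "independent C" "X \<subseteq> span C" "card C = dim X" by (rule basis_exists)
  have fin: "finite C" using C(2) by (rule finiteI_independent)
  obtain Z where Z: "Z \<subseteq> C" "indep_mod scale (X \<inter> Y) Z id"
    "span (X \<inter> Y \<union> id ` Z) = span (X \<inter> Y \<union> id ` C)"
    using exists_indep_mod_subset[OF fin XY] by blast
  have finZ: "finite Z" using Z(1) fin by (rule finite_subset)
  have "span (X \<inter> Y \<union> C) = X"
  proof
    show "span (X \<inter> Y \<union> C) \<subseteq> X" using C X by (intro span_minimal) auto
    show "X \<subseteq> span (X \<inter> Y \<union> C)" using C(3) span_mono[of C "X \<inter> Y \<union> C"] by auto
  qed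
  then have spX: "span (X \<inter> Y \<union> id ` Z) = X" using Z(3) by simp
  have ZX: "Z \<subseteq> X" using Z(1) C(1) by auto
  have "indep_mod scale Y Z id"
    unfolding indep_mod_def
  proof (intro allI impI)
    fix c assume "(\<Sum>z\<in>Z. c z *s id z) \<in> Y"
    moreover have "(\<Sum>z\<in>Z. c z *s id z) \<in> X"
      using ZX by (intro subspace_sum[OF X] subspace_scale[OF X]) auto
    ultimately show "\<forall>z\<in>Z. c z = 0" using Z(2) unfolding indep_mod_def by blast
  qed
  then have "dim (span (Y \<union> id ` Z)) = dim Y + card Z" using dim_span_Un_image[OF finZ Y] by blast
  moreover have "dim X = dim (X \<inter> Y) + card Z"
    using dim_span_Un_image[OF finZ XY Z(2)] unfolding spX .
  moreover have "span (Y \<union> id ` Z) = span (X \<union> Y)"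
  proof (rule span_eq[THEN iffD2], intro conjI)
    show "Y \<union> id ` Z \<subseteq> span (X \<union> Y)" using ZX by (auto intro: span_base)
    have "X \<subseteq> span (Y \<union> id ` Z)"
      by (subst spX[symmetric]) (intro span_mono, auto)
    then show "X \<union> Y \<subseteq> span (Y \<union> id ` Z)" by (auto intro: span_base)
  qed
  ultimately show ?thesis by (simp only: add.assoc add.commute)
qed

end

text \<open>The library locale fixes a basis as a parameter, while \<open>isocrystal\<close>
  provides only a finite spanning set; hence a basis is chosen.\<close>

sublocale isocrystal \<subseteq> finite_dimensional_vector_space scale
  "SOME B. finite B \<and> \<not> dependent B \<and> span B = UNIV"
proof -
  obtain B where B: "finite B" "span B = UNIV" using finite_dim by blast
  obtain C where C: "C \<subseteq> B" "independent C" "B \<subseteq> span C"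
    by (rule maximal_independent_subset)
  have "\<exists>B. finite B \<and> \<not> dependent B \<and> span B = UNIV"
    using B C by (intro exI[of _ C]) (metis finite_subset span_mono span_span top.extremum_unique)
  from someI_ex[OF this]
  show "finite_dimensional_vector_space scale (SOME B. finite B \<and> \<not> dependent B \<and> span B = UNIV)"
    by unfold_locales auto
qed

subsection \<open>Eigenbases and the Newton number\<close>

lemma count_image_mset_set:
  "finite Z \<Longrightarrow> count (image_mset a (mset_set Z)) m = card {z\<in>Z. a z = m}"
  by (auto simp: count_image_mset intro!: arg_cong[where f = card])

context isocrystal
begin

abbreviation Phi_pow :: "nat \<Rightarrow> 'v \<Rightarrow> 'v"
  where "Phi_pow D \<equiv> \<Phi> ^^ D"

lemma Phi_pow_add: "Phi_pow D (x + y) = Phi_pow D x + Phi_pow D y"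
  by (induction D) (auto simp: Phi_add)

lemma Phi_pow_semilinear: "Phi_pow D (c *s x) = frob_pow D c *s Phi_pow D x"
  by (induction D) (auto simp: Phi_semilinear)

lemma Phi_pow_zero: "Phi_pow D 0 = 0"
  using Phi_pow_add[of D 0 0] by simp

lemma Phi_pow_diff: "Phi_pow D (x - y) = Phi_pow D x - Phi_pow D y"
  using Phi_pow_add[of D "x - y" y] by (simp add: eq_diff_eq)

lemma Phi_pow_sum: "Phi_pow D (sum f A) = (\<Sum>a\<in>A. Phi_pow D (f a))"
  by (induction A rule: infinite_finite_induct) (auto simp: Phi_pow_zero Phi_pow_add)

lemma Phi_zero: "\<Phi> 0 = 0" and Phi_diff: "\<Phi> (x - y) = \<Phi> x - \<Phi> y"
  and Phi_sum: "\<Phi> (sum f A) = (\<Sum>a\<in>A. \<Phi> (f a))"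
  using Phi_pow_zero[of 1] Phi_pow_diff[of 1 x y] Phi_pow_sum[of 1 f A] by auto

lemma subisocrystal_subspace: "subisocrystal U \<Longrightarrow> subspace U"
  by (simp add: subisocrystal_def)

lemma Phi_mem_iff: "subisocrystal U \<Longrightarrow> \<Phi> x \<in> U \<longleftrightarrow> x \<in> U"
  unfolding subisocrystal_def using Phi_bij by (metis bij_is_inj inj_image_mem_iff)

lemma Phi_pow_mem_iff: "subisocrystal U \<Longrightarrow> Phi_pow D x \<in> U \<longleftrightarrow> x \<in> U"
  by (induction D) (auto simp: Phi_mem_iff)

text \<open>Closure under scalars uses that the Frobenius is onto: every \<open>c\<close> is
  \<open>\<sigma> c'\<close>.\<close>

lemma Phi_image_subspace: "subspace U \<Longrightarrow> subspace (\<Phi> ` U)"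
proof -
  assume U: "subspace U"
  show "subspace (\<Phi> ` U)"
  proof (rule subspaceI)
    show "0 \<in> \<Phi> ` U" using subspace_0[OF U] Phi_zero by force
    show "x + y \<in> \<Phi> ` U" if "x \<in> \<Phi> ` U" "y \<in> \<Phi> ` U" for x y
      using that Phi_add subspace_add[OF U] by (metis (no_types, opaque_lifting) imageE imageI)
    show "c *s x \<in> \<Phi> ` U" if x: "x \<in> \<Phi> ` U" for c x
    proof -
      obtain u where u: "u \<in> U" "x = \<Phi> u" using x by blast
      obtain c' where "c = \<sigma> c'" using frob_bij by (metis bij_is_surj surjD)
      then have "c *s x = \<Phi> (c' *s u)" using u by (simp add: Phi_semilinear)
      then show ?thesis using subspace_scale[OF U u(1)] by blast
    qed
  qed
qed

lemma Phi_image_span: "\<Phi> ` span S = span (\<Phi> ` S)"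
proof
  show "span (\<Phi> ` S) \<subseteq> \<Phi> ` span S"
    by (intro span_minimal Phi_image_subspace image_mono) (auto simp: span_superset)
  show "\<Phi> ` span S \<subseteq> span (\<Phi> ` S)"
  proof
    fix y assume "y \<in> \<Phi> ` span S"
    then obtain x where x: "x \<in> span S" "y = \<Phi> x" by blast
    have "\<Phi> x \<in> span (\<Phi> ` S)"
      using x(1)
      by (induction rule: span_induct_alt)
        (auto simp: Phi_zero Phi_add Phi_semilinear span_zero intro!: span_add span_scale intro: span_base)
    then show "y \<in> span (\<Phi> ` S)" using x by simp
  qed
qed

lemma subisocrystal_span: "\<Phi> ` S = S \<Longrightarrow> subisocrystal (span S)"
  by (simp add: subisocrystal_def Phi_image_span)

lemma subisocrystal_span_Un: "subisocrystal X \<Longrightarrow> subisocrystal Y \<Longrightarrow> subisocrystal (span (X \<union> Y))"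
  by (intro subisocrystal_span) (simp add: image_Un subisocrystal_def)

lemma subisocrystal_span_Un_UN:
  "subisocrystal B \<Longrightarrow> (\<And>k. k \<in> I \<Longrightarrow> subisocrystal (U k)) \<Longrightarrow> subisocrystal (span (B \<union> (\<Union>k\<in>I. U k)))"
  by (intro subisocrystal_span) (simp add: image_Un image_UN subisocrystal_def)

lemma subisocrystal_Int: "subisocrystal X \<Longrightarrow> subisocrystal Y \<Longrightarrow> subisocrystal (X \<inter> Y)"
  using Phi_bij by (simp add: subisocrystal_def image_Int bij_is_inj subspace_inter)

lemma subisocrystal_zero: "subisocrystal {0}"
  by (simp add: subisocrystal_def Phi_zero)

text \<open>Applying the inverse Frobenius to the coefficients turns a relation between images of
  basis vectors into one between the vectors themselves.\<close>

lemma dim_Phi_image: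
  assumes U: "subspace U"
  shows "dim (\<Phi> ` U) = dim U"
proof -
  obtain C where C: "C \<subseteq> U" "independent C" "U \<subseteq> span C" "card C = dim U" by (rule basis_exists)
  have fin: "finite C" using C(2) by (rule finiteI_independent)
  have span: "span C = U" using C(1,3) U by (simp add: span_subspace)
  have "indep_mod scale {0} C \<Phi>"
    unfolding indep_mod_def
  proof (intro allI impI ballI)
    fix c z assume c: "(\<Sum>z\<in>C. c z *s \<Phi> z) \<in> {0}" and z: "z \<in> C"
    have inv: "\<sigma> (inv \<sigma> a) = a" for a using frob_bij by (simp add: bij_is_surj surj_f_inv_f)
    have "\<Phi> (\<Sum>z\<in>C. inv \<sigma> (c z) *s z) = \<Phi> 0"
      using c by (simp add: Phi_sum Phi_semilinear inv Phi_zero)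
    then have "(\<Sum>z\<in>C. inv \<sigma> (c z) *s z) = 0" using Phi_bij by (metis bij_is_inj injD)
    from independentD[OF C(2) fin subset_refl this z] have "inv \<sigma> (c z) = 0" .
    then show "c z = 0" using inv[of "c z"] frob_pow_zero[of 1] by simp
  qed
  then have "dim (span ({0} \<union> \<Phi> ` C)) = dim U"
    using dim_span_Un_image[OF fin subspace_single_0] C(4) by simp
  moreover have "span ({0} \<union> \<Phi> ` C) = \<Phi> ` U" using span Phi_image_span[of C] by simp
  ultimately show ?thesis by metis
qed

text \<open>Counting dimensions upgrades stability to equality; this serves for spans of iterates of
  a vector.\<close>

lemma subisocrystalI: "subspace U \<Longrightarrow> \<Phi> ` U \<subseteq> U \<Longrightarrow> subisocrystal U"
  unfolding subisocrystal_def
  using subspace_dim_equal[of "\<Phi> ` U" U] by (simp add: Phi_image_subspace dim_Phi_image)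

section \<open>Eigenbases and uniqueness of their weights\<close>

text \<open>\<open>Phi_pow D\<close> is diagonal modulo \<open>B\<close>, with a power of
  \<open>p\<close> at each basis vector; the weight \<open>a z\<close> stands for the slope
  \<open>a z / D\<close>.\<close>

definition eigenbasis :: "nat \<Rightarrow> 'v set \<Rightarrow> 'v set \<Rightarrow> 'z set \<Rightarrow> ('z \<Rightarrow> 'v) \<Rightarrow> ('z \<Rightarrow> int) \<Rightarrow> bool"
  where "eigenbasis D A B Z b a \<longleftrightarrow> finite Z \<and> span (B \<union> b ` Z) = A \<and> indep_mod scale B Z b \<and>
    (\<forall>z\<in>Z. Phi_pow D (b z) - (of_nat p powi a z) *s b z \<in> B)"

text \<open>Applying \<open>Phi_pow D\<close> to the expansion of \<open>y\<close> and comparing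
  coefficients gives \<open>frob_pow D (c z) * p^(a z) = p^m * c z\<close>. The first conclusion
  separates slopes, the second puts coordinates into the fixed field. A full eigenbasis is not
  assumed, so the lemma also applies modulo a larger subisocrystal.\<close>

lemma eigenvector_coeff:
  assumes B: "subisocrystal B" and i: "indep_mod scale B Z b"
    and b: "\<And>z. z \<in> Z \<Longrightarrow> Phi_pow D (b z) - (of_nat p powi a z) *s b z \<in> B"
    and y: "Phi_pow D y - (of_nat p powi m) *s y \<in> B" "y - (\<Sum>z\<in>Z. c z *s b z) \<in> B"
    and z: "z \<in> Z" "c z \<noteq> 0"
  shows "a z = m" and "frob_pow D (c z) = c z"
proof -
  note sub = subisocrystal_subspace[OF B]
  let ?q = "\<lambda>m. of_nat p powi m :: 'K"
  have "(\<Sum>z\<in>Z. (frob_pow D (c z) * ?q (a z) - ?q m * c z) *s b z) =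
      (Phi_pow D y - ?q m *s y) - (Phi_pow D (y - (\<Sum>z\<in>Z. c z *s b z)))
      + ?q m *s (y - (\<Sum>z\<in>Z. c z *s b z))
      - (\<Sum>z\<in>Z. frob_pow D (c z) *s (Phi_pow D (b z) - ?q (a z) *s b z))"
    by (simp add: Phi_pow_diff Phi_pow_sum Phi_pow_semilinear scale_right_diff_distrib
        scale_left_diff_distrib scale_sum_right sum_subtractf)
  also have "\<dots> \<in> B"
  proof -
    have h1: "Phi_pow D (y - (\<Sum>z\<in>Z. c z *s b z)) \<in> B"
      using y(2) by (simp only: Phi_pow_mem_iff[OF B])
    have h2: "?q m *s (y - (\<Sum>z\<in>Z. c z *s b z)) \<in> B"
      by (rule subspace_scale[OF sub y(2)])
    have h3: "(\<Sum>z\<in>Z. frob_pow D (c z) *s (Phi_pow D (b z) - ?q (a z) *s b z)) \<in> B"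
      by (intro subspace_sum[OF sub] subspace_scale[OF sub] b)
    show ?thesis
      by (rule subspace_diff[OF sub subspace_add[OF sub subspace_diff[OF sub y(1) h1] h2] h3])
  qed
  finally have "frob_pow D (c z) * ?q (a z) - ?q m * c z = 0"
    using indep_modD[OF i, of "\<lambda>z. frob_pow D (c z) * ?q (a z) - ?q m * c z"] z(1) by blast
  then have "frob_pow D (c z) * ?q (a z) = ?q m * c z" by simp
  from frob_eigenvalue_eq[OF this z(2)] show "a z = m" and "frob_pow D (c z) = c z" by auto
qed

text \<open>Vectors of weight \<open>m\<close> in one eigenbasis lie modulo \<open>B\<close> in the
  span of those of weight \<open>m\<close> in the other; then dimensions are compared.\<close>

lemma eigenbasis_card_le:
  assumes B: "subisocrystal B" and e: "eigenbasis D A B Z b a" and e': "eigenbasis D A B Z' b' a'"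
  shows "card {z\<in>Z'. a' z = m} \<le> card {z\<in>Z. a z = m}"
proof -
  note sub = subisocrystal_subspace[OF B]
  let ?Z = "{z\<in>Z. a z = m}" and ?Z' = "{z\<in>Z'. a' z = m}"
  have fin: "finite Z" "finite Z'" using e e' by (auto simp: eigenbasis_def)
  have "b' w \<in> span (B \<union> b ` ?Z)" if w: "w \<in> ?Z'" for w
  proof -
    have "b' w \<in> span (B \<union> b ` Z)" using w e e' by (auto simp: eigenbasis_def intro: span_base)
    then obtain c where c: "b' w - (\<Sum>z\<in>Z. c z *s b z) \<in> B"
      unfolding mem_span_Un_image[OF sub fin(1)] by blast
    have "Phi_pow D (b' w) - (of_nat p powi m) *s b' w \<in> B"
      using w e' unfolding eigenbasis_def by blast
    then have "c z = 0" if "z \<in> Z - ?Z" for z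
      using eigenvector_coeff(1)[OF B, of Z b D a "b' w" m c z] e c that unfolding eigenbasis_def by blast
    then have "(\<Sum>z\<in>Z. c z *s b z) = (\<Sum>z\<in>?Z. c z *s b z)"
      using fin by (intro sum.mono_neutral_right) auto
    then have "b' w - (\<Sum>z\<in>?Z. c z *s b z) \<in> B" using c by simp
    moreover have "finite ?Z" using fin by simp
    ultimately show ?thesis using mem_span_Un_image[OF sub, of ?Z "b' w" b] by blast
  qed
  then have "span (B \<union> b' ` ?Z') \<subseteq> span (B \<union> b ` ?Z)"
    by (intro span_minimal) (auto intro: span_base)
  then have "dim (span (B \<union> b' ` ?Z')) \<le> dim (span (B \<union> b ` ?Z))" by (rule dim_subset)
  moreover have "dim (span (B \<union> b ` ?Z)) = dim B + card ?Z"
  proof (rule dim_span_Un_image[OF _ sub])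
    show "finite ?Z" using fin by simp
    show "indep_mod scale B ?Z b"
      using indep_mod_subset[of B Z b ?Z] e by (simp add: eigenbasis_def)
  qed
  moreover have "dim (span (B \<union> b' ` ?Z')) = dim B + card ?Z'"
  proof (rule dim_span_Un_image[OF _ sub])
    show "finite ?Z'" using fin by simp
    show "indep_mod scale B ?Z' b'"
      using indep_mod_subset[of B Z' b' ?Z'] e' by (simp add: eigenbasis_def)
  qed
  ultimately show ?thesis by simp
qed

lemma eigenbasis_weights_unique:
  assumes "subisocrystal B" "eigenbasis D A B Z b a" "eigenbasis D A B Z' b' a'"
  shows "image_mset a (mset_set Z) = image_mset a' (mset_set Z')"
proof (rule multiset_eqI)
  fix m
  have "card {z\<in>Z. a z = m} = card {z\<in>Z'. a' z = m}"
    using eigenbasis_card_le[OF assms] eigenbasis_card_le[OF assms(1,3,2)] by (intro antisym) auto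
  then show "count (image_mset a (mset_set Z)) m = count (image_mset a' (mset_set Z')) m"
    using assms by (simp add: eigenbasis_def count_image_mset_set)
qed

section \<open>Decompositions into simple summands and the value of \<open>t_N\<close>\<close>

text \<open>This is \<open>has_newton_slopes\<close> with the summands exposed and over any finite
  index set, so that subquotients can share one pair \<open>r\<close>, \<open>s\<close> and split
  only the indices.\<close>

definition decomp :: "'v set \<Rightarrow> 'v set \<Rightarrow> nat set \<Rightarrow> (nat \<Rightarrow> int) \<Rightarrow> (nat \<Rightarrow> nat) \<Rightarrow> (nat \<Rightarrow> 'v set) \<Rightarrow> bool"
  where "decomp A B I r s U \<longleftrightarrow> finite I \<and> subisocrystal B \<and>
    (\<forall>i\<in>I. simple_of_slope (U i) B (r i) (s i)) \<and>
    span (B \<union> (\<Union>i\<in>I. U i)) = A \<and>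
    (\<forall>u. (\<forall>i\<in>I. u i \<in> U i) \<and> (\<Sum>i\<in>I. u i) \<in> B \<longrightarrow> (\<forall>i\<in>I. u i \<in> B))"

lemma simple_of_slopeD:
  assumes "simple_of_slope A B r s"
  shows "simple A B" "subisocrystal A" "subisocrystal B" "B \<subseteq> A" "subspace A" "subspace B" "s > 0"
    "coprime r (int s)"
  using assms by (auto simp: simple_of_slope_def simple_def subisocrystal_def)

lemma decompD:
  assumes "decomp A B I r s U"
  shows "finite I" "subisocrystal B" "subspace B" "subisocrystal A" "subspace A" "B \<subseteq> A"
    "\<And>i. i \<in> I \<Longrightarrow> simple_of_slope (U i) B (r i) (s i)"
    "\<And>i. i \<in> I \<Longrightarrow> subisocrystal (U i)" "\<And>i. i \<in> I \<Longrightarrow> subspace (U i)"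
    "\<And>i. i \<in> I \<Longrightarrow> B \<subseteq> U i" "\<And>i. i \<in> I \<Longrightarrow> U i \<subseteq> A" "span (B \<union> (\<Union>i\<in>I. U i)) = A"
    "\<And>u i. (\<And>i. i \<in> I \<Longrightarrow> u i \<in> U i) \<Longrightarrow> (\<Sum>i\<in>I. u i) \<in> B \<Longrightarrow> i \<in> I \<Longrightarrow> u i \<in> B"
proof -
  show 1: "finite I" "subisocrystal B" "span (B \<union> (\<Union>i\<in>I. U i)) = A"
    and s: "\<And>i. i \<in> I \<Longrightarrow> simple_of_slope (U i) B (r i) (s i)"
    using assms by (auto simp: decomp_def)
  show "subspace B" using 1 by (simp add: subisocrystal_subspace)
  show U: "\<And>i. i \<in> I \<Longrightarrow> subisocrystal (U i)" "\<And>i. i \<in> I \<Longrightarrow> subspace (U i)"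
    "\<And>i. i \<in> I \<Longrightarrow> B \<subseteq> U i"
    using simple_of_slopeD[OF s] by auto
  show "B \<subseteq> A" "\<And>i. i \<in> I \<Longrightarrow> U i \<subseteq> A" using span_superset[of "B \<union> (\<Union>i\<in>I. U i)"] unfolding 1(3) by auto
  show "subisocrystal A" using subisocrystal_span_Un_UN[of B I U] 1 U by simp
  then show "subspace A" by (rule subisocrystal_subspace)
  show "u i \<in> B" if "\<And>i. i \<in> I \<Longrightarrow> u i \<in> U i" "(\<Sum>i\<in>I. u i) \<in> B" "i \<in> I" for u i
    using assms that unfolding decomp_def by blast
qed

lemma decomp_mem_iff:
  assumes "decomp A B I r s U"
  shows "x \<in> A \<longleftrightarrow> (\<exists>u. (\<forall>k\<in>I. u k \<in> U k) \<and> x - (\<Sum>k\<in>I. u k) \<in> B)"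
  using mem_span_Un_UN[of B I U x] decompD[OF assms] by simp

lemma has_newton_slopes_decomp:
  assumes "subisocrystal B"
  shows "has_newton_slopes A B l r s \<longleftrightarrow> (\<exists>U. decomp A B {1..l} r s U)"
  using assms unfolding has_newton_slopes_def decomp_def by blast

text \<open>One round of \<open>s\<close> steps through the cyclic basis multiplies every
  \<open>e i\<close>, not only \<open>e 0\<close>, by \<open>p^r\<close>, because the Frobenius
  fixes the factor picked up on the way.\<close>

lemma simple_basis_eigen:
  assumes B: "subisocrystal B" and s: "s > 0"
    and e1: "\<And>i. Suc i < s \<Longrightarrow> \<Phi> (e i) - e (Suc i) \<in> B"
    and e2: "\<Phi> (e (s - 1)) - (of_nat p powi r) *s e 0 \<in> B"
    and i: "i < s"
  shows "Phi_pow (s * k) (e i) - (of_nat p powi (r * int k)) *s e i \<in> B"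
proof -
  note sub = subisocrystal_subspace[OF B]
  have up: "Phi_pow j (e i) - e (i + j) \<in> B" if "i + j < s" for i j
    using that
  proof (induction j)
    case (Suc j)
    then have "\<Phi> (Phi_pow j (e i) - e (i + j)) \<in> B" by (simp add: Phi_mem_iff[OF B])
    from subspace_add[OF sub this e1[of "i + j"]] Suc.prems
    show ?case by (simp add: Phi_diff)
  qed (simp add: subspace_0[OF sub])
  have one: "Phi_pow s (e i) - (of_nat p powi r) *s e i \<in> B"
  proof -
    \<comment> \<open>\<open>j\<close> steps lead from \<open>e i\<close> to the last vector, one
      more produces \<open>p^r\<close> times \<open>e 0\<close>, and the remaining \<open>i\<close>
      steps return to \<open>e i\<close>.\<close>
    define j where "j = s - 1 - i"
    have sij: "s = i + (1 + j)" using i by (simp add: j_def)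
    have "\<Phi> (Phi_pow j (e i) - e (i + j)) \<in> B" using up[of i j] sij by (simp add: Phi_mem_iff[OF B])
    then have "\<Phi> (Phi_pow j (e i) - e (i + j)) + (\<Phi> (e (i + j)) - (of_nat p powi r) *s e 0) \<in> B"
      using e2 sij by (intro subspace_add[OF sub]) auto
    then have "Phi_pow (1 + j) (e i) - (of_nat p powi r) *s e 0 \<in> B" by (simp add: Phi_diff)
    then have "Phi_pow i (Phi_pow (1 + j) (e i) - (of_nat p powi r) *s e 0) \<in> B"
      by (simp only: Phi_pow_mem_iff[OF B])
    then have "Phi_pow s (e i) - (of_nat p powi r) *s Phi_pow i (e 0) \<in> B"
      unfolding sij funpow_add
      by (simp add: Phi_pow_diff Phi_pow_semilinear frob_pow_powi)
    moreover have "(of_nat p powi r) *s (Phi_pow i (e 0) - e i) \<in> B"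
      using up[of 0 i] i by (intro subspace_scale[OF sub]) simp
    ultimately have "Phi_pow s (e i) - (of_nat p powi r) *s Phi_pow i (e 0)
        + (of_nat p powi r) *s (Phi_pow i (e 0) - e i) \<in> B"
      by (rule subspace_add[OF sub])
    then show ?thesis by (simp add: scale_right_diff_distrib)
  qed
  show ?thesis
  proof (induction k)
    case (Suc k)
    have "Phi_pow s (Phi_pow (s * k) (e i) - (of_nat p powi (r * int k)) *s e i)
       + (of_nat p powi (r * int k)) *s (Phi_pow s (e i) - (of_nat p powi r) *s e i) \<in> B"
      using Suc one by (intro subspace_add[OF sub] subspace_scale[OF sub]) (simp add: Phi_pow_mem_iff[OF B])
    then show ?case
      using of_nat_p_nonzero
      by (simp add: Phi_pow_diff Phi_pow_semilinear frob_pow_powi scale_right_diff_distrib funpow_add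
          power_int_add distrib_left mult.commute)
  qed (simp add: subspace_0[OF sub])
qed

text \<open>The cyclic bases of all summands are put together; for a common multiple
  \<open>D\<close>, \<open>Phi_pow D\<close> makes \<open>D div s k\<close> full rounds in the
  \<open>k\<close>-th one.\<close>

lemma decomp_eigenbasis:
  assumes d: "decomp A B I r s U" and D: "\<And>k. k \<in> I \<Longrightarrow> s k dvd D"
  shows "\<exists>b. eigenbasis D A B (Sigma I (\<lambda>k. {..<s k})) b (\<lambda>(k, j). r k * int (D div s k))"
proof -
  note D' = decompD[OF d]
  have "\<forall>k\<in>I. \<exists>e. span (B \<union> e ` {..<s k}) = U k \<and>
       (\<forall>c. (\<Sum>i<s k. c i *s e i) \<in> B \<longrightarrow> (\<forall>i<s k. c i = 0)) \<and>
       (\<forall>i. Suc i < s k \<longrightarrow> \<Phi> (e i) - e (Suc i) \<in> B) \<and>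
       \<Phi> (e (s k - 1)) - (of_nat p powi r k) *s e 0 \<in> B"
    using D'(7) unfolding simple_of_slope_def by blast
  from bchoice[OF this] obtain e where e0: "\<forall>k\<in>I. span (B \<union> e k ` {..<s k}) = U k \<and>
       (\<forall>c. (\<Sum>i<s k. c i *s e k i) \<in> B \<longrightarrow> (\<forall>i<s k. c i = 0)) \<and>
       (\<forall>i. Suc i < s k \<longrightarrow> \<Phi> (e k i) - e k (Suc i) \<in> B) \<and>
       \<Phi> (e k (s k - 1)) - (of_nat p powi r k) *s e k 0 \<in> B" by blast
  have e: "\<And>k. k \<in> I \<Longrightarrow> span (B \<union> e k ` {..<s k}) = U k"
       "\<And>k c i. k \<in> I \<Longrightarrow> (\<Sum>i<s k. c i *s e k i) \<in> B \<Longrightarrow> i < s k \<Longrightarrow> c i = 0"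
       "\<And>k i. k \<in> I \<Longrightarrow> Suc i < s k \<Longrightarrow> \<Phi> (e k i) - e k (Suc i) \<in> B"
       "\<And>k. k \<in> I \<Longrightarrow> \<Phi> (e k (s k - 1)) - (of_nat p powi r k) *s e k 0 \<in> B"
    using e0 by auto
  define b where "b = (\<lambda>(k, j). e k j)"
  let ?Z = "Sigma I (\<lambda>k. {..<s k})"
  have finZ: "finite ?Z" using D'(1) by auto
  have eU: "e k j \<in> U k" if "k \<in> I" "j < s k" for k j
    using e(1)[OF that(1)] span_base[of "e k j" "B \<union> e k ` {..<s k}"] that by auto
  have "span (B \<union> b ` ?Z) = A"
  proof
    show "span (B \<union> b ` ?Z) \<subseteq> A"
      using D'(5,6) subsetD[OF D'(11) eU] by (intro span_minimal) (auto simp: b_def)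
    have "U k \<subseteq> span (B \<union> b ` ?Z)" if "k \<in> I" for k
      unfolding e(1)[OF that, symmetric] using that by (intro span_mono) (auto simp: b_def)
    then show "A \<subseteq> span (B \<union> b ` ?Z)"
      unfolding D'(12)[symmetric] by (intro span_minimal) (auto intro: span_base)
  qed
  moreover have "indep_mod scale B ?Z b"
    unfolding indep_mod_def
  proof (intro allI impI ballI)
    fix c z assume c: "(\<Sum>z\<in>?Z. c z *s b z) \<in> B" and z: "z \<in> ?Z"
    define u where "u k = (\<Sum>j<s k. c (k, j) *s e k j)" for k
    have "(\<Sum>k\<in>I. u k) = (\<Sum>z\<in>?Z. c z *s b z)"
      unfolding u_def using D'(1) by (subst sum.Sigma) (auto simp: b_def intro!: sum.cong)
    moreover have "u k \<in> U k" if "k \<in> I" for k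
      unfolding u_def using that eU D'(9) by (intro subspace_sum subspace_scale) auto
    ultimately have u: "u k \<in> B" if "k \<in> I" for k using D'(13)[of u k] c that by simp
    obtain k j where kj: "z = (k, j)" "k \<in> I" "j < s k" using z by auto
    then show "c z = 0" using e(2)[of k "\<lambda>j. c (k, j)" j] u[of k] by (simp add: u_def)
  qed
  moreover have "Phi_pow D (b z) - (of_nat p powi (case z of (k, j) \<Rightarrow> r k * int (D div s k))) *s b z \<in> B"
    if z: "z \<in> ?Z" for z
  proof -
    obtain k j where kj: "z = (k, j)" "k \<in> I" "j < s k" using z by auto
    have "s k * (D div s k) = D" using D[OF kj(2)] by simp
    then show ?thesis
      using simple_basis_eigen[OF D'(2) _ e(3,4)[OF kj(2)], of j "D div s k"] kj
      by (simp add: b_def)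
  qed
  ultimately show ?thesis using finZ unfolding eigenbasis_def by blast
qed

lemma decomp_dim:
  assumes d: "decomp A B I r s U"
  shows "dim A = dim B + (\<Sum>k\<in>I. s k)"
proof -
  have "\<And>k. k \<in> I \<Longrightarrow> s k dvd (\<Prod>k\<in>I. s k)" using decompD(1)[OF d] by auto
  from decomp_eigenbasis[OF d this] obtain b a where
    "eigenbasis (\<Prod>k\<in>I. s k) A B (Sigma I (\<lambda>k. {..<s k})) b a" by blast
  then have "dim A = dim B + card (Sigma I (\<lambda>k. {..<s k}))"
    unfolding eigenbasis_def using dim_span_Un_image decompD(3)[OF d] by metis
  then show ?thesis using decompD(1)[OF d] by simp
qed

text \<open>Summand \<open>k\<close> contributes \<open>s k\<close> weights
  \<open>r k * D / s k\<close>, in total \<open>D * r k\<close>. For fixed \<open>D\<close> the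
  weights depend only on \<open>A\<close> and \<open>B\<close>, hence so does the sum of the
  \<open>r k\<close>.\<close>

lemma decomp_sum_unique:
  assumes d: "decomp A B I r s U" and d': "decomp A B I' r' s' U'"
  shows "(\<Sum>k\<in>I. r k) = (\<Sum>k\<in>I'. r' k)"
proof -
  note fin = decompD(1)[OF d] decompD(1)[OF d']
  \<comment> \<open>Divisible by the denominators of both decompositions, so that one power of
    \<open>\<Phi>\<close> serves both.\<close>
  define D where "D = (\<Prod>k\<in>I. s k) * (\<Prod>k\<in>I'. s' k)"
  have sD: "s k dvd D" if "k \<in> I" for k
    unfolding D_def using that fin by (intro dvd_mult2) auto
  have sD': "s' k dvd D" if "k \<in> I'" for k
    unfolding D_def using that fin by (intro dvd_mult) auto
  have pos: "s k > 0" if "k \<in> I" for k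
    by (rule simple_of_slopeD(7)[OF decompD(7)[OF d that]])
  have pos': "s' k > 0" if "k \<in> I'" for k
    by (rule simple_of_slopeD(7)[OF decompD(7)[OF d' that]])
  have "D > 0" unfolding D_def using pos pos' by (auto intro!: prod_pos)
  obtain b where b: "eigenbasis D A B (Sigma I (\<lambda>k. {..<s k})) b (\<lambda>(k, j). r k * int (D div s k))"
    using decomp_eigenbasis[OF d sD] by blast
  obtain b' where b': "eigenbasis D A B (Sigma I' (\<lambda>k. {..<s' k})) b' (\<lambda>(k, j). r' k * int (D div s' k))"
    using decomp_eigenbasis[OF d' sD'] by blast
  have sum: "(\<Sum>(k, j)\<in>Sigma I (\<lambda>k. {..<s k}). r k * int (D div s k)) = int D * (\<Sum>k\<in>I. r k)"
    if "finite I" "\<And>k. k \<in> I \<Longrightarrow> s k dvd D" for I :: "nat set" and r :: "nat \<Rightarrow> int" and s :: "nat \<Rightarrow> nat"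
  proof -
    have "(\<Sum>(k, j)\<in>Sigma I (\<lambda>k. {..<s k}). r k * int (D div s k)) = (\<Sum>k\<in>I. \<Sum>j<s k. r k * int (D div s k))"
      using that by (subst sum.Sigma) auto
    also have "\<dots> = (\<Sum>k\<in>I. int D * r k)"
    proof (intro sum.cong refl)
      fix k assume "k \<in> I"
      then have "int D = int (s k) * int (D div s k)"
        using that(2) by (metis dvd_mult_div_cancel of_nat_mult)
      then show "(\<Sum>j<s k. r k * int (D div s k)) = int D * r k" by simp
    qed
    finally show ?thesis by (simp add: sum_distrib_left)
  qed
  have "image_mset (\<lambda>(k, j). r k * int (D div s k)) (mset_set (Sigma I (\<lambda>k. {..<s k}))) =
      image_mset (\<lambda>(k, j). r' k * int (D div s' k)) (mset_set (Sigma I' (\<lambda>k. {..<s' k})))"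
    by (rule eigenbasis_weights_unique[OF decompD(2)[OF d] b b'])
  from arg_cong[OF this, of sum_mset]
  have "(\<Sum>(k, j)\<in>Sigma I (\<lambda>k. {..<s k}). r k * int (D div s k)) =
      (\<Sum>(k, j)\<in>Sigma I' (\<lambda>k. {..<s' k}). r' k * int (D div s' k))"
    by (simp only: sum_unfold_sum_mset)
  then have "int D * (\<Sum>k\<in>I. r k) = int D * (\<Sum>k\<in>I'. r' k)"
    using sum[of I s r, OF fin(1) sD] sum[of I' s' r', OF fin(2) sD'] by simp
  then show ?thesis using \<open>D > 0\<close> by simp
qed

lemma decomp_reindex:
  assumes d: "decomp A B I r s U" and f: "bij_betw f I' I"
  shows "decomp A B I' (r \<circ> f) (s \<circ> f) (U \<circ> f)"
proof -
  note D = decompD[OF d]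
  have inj: "inj_on f I'" and img: "f ` I' = I" using f by (auto simp: bij_betw_def)
  have "u i \<in> B" if u: "\<forall>i\<in>I'. u i \<in> U (f i)" "(\<Sum>i\<in>I'. u i) \<in> B" and i: "i \<in> I'" for u i
  proof -
    define v where "v = u \<circ> inv_into I' f"
    have v: "v (f i) = u i" if "i \<in> I'" for i using inj that by (simp add: v_def)
    have "(\<Sum>k\<in>I. v k) = (\<Sum>i\<in>I'. u i)"
      unfolding img[symmetric] using inj v by (simp add: sum.reindex)
    moreover have "v k \<in> U k" if "k \<in> I" for k using that u(1) v img by auto
    moreover have "f i \<in> I" using i img by auto
    ultimately have "v (f i) \<in> B" using D(13)[of v "f i"] u(2) by simp
    then show ?thesis using v i by simp
  qed
  moreover have "(\<Union>i\<in>I'. (U \<circ> f) i) = (\<Union>i\<in>I. U i)" using img by auto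
  moreover have "finite I'" using f D(1) bij_betw_finite by blast
  ultimately show ?thesis using D(2,7,12) img unfolding decomp_def by auto
qed

text \<open>\<open>t_N\<close> is a definite description: reindexing by \<open>{1..card I}\<close>
  gives a value, \<open>decomp_sum_unique\<close> makes it unique, and the factors
  \<open>s k\<close> cancel.\<close>

lemma decomp_t_N:
  assumes d: "decomp A B I r s U"
  shows "t_N A B = of_int (\<Sum>k\<in>I. r k)"
proof -
  note B = decompD(2)[OF d]
  have sum: "(\<Sum>i=1..l. of_nat (s i) * (of_int (r i) / of_nat (s i))) = (of_int (\<Sum>i=1..l. r i) :: rat)"
    if d: "decomp A B {1..l} r s U" for l r s U
  proof -
    have "s i > 0" if "i \<in> {1..l}" for i by (rule simple_of_slopeD(7)[OF decompD(7)[OF d that]])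
    then show ?thesis by (auto intro!: sum.cong simp: of_int_sum)
  qed
  obtain f where f: "bij_betw f {1..card I} I" using ex_bij_betw_nat_finite_1 decompD(1)[OF d] by blast
  have d1: "decomp A B {1..card I} (r \<circ> f) (s \<circ> f) (U \<circ> f)" by (rule decomp_reindex[OF d f])
  show ?thesis
    unfolding t_N_def
  proof (rule the_equality)
    have "(\<Sum>i=1..card I. (r \<circ> f) i) = (\<Sum>k\<in>I. r k)"
      using sum.reindex_bij_betw[OF f, of r] by simp
    then show "\<exists>l r' s'. has_newton_slopes A B l r' s' \<and>
       (of_int (\<Sum>k\<in>I. r k) :: rat) = (\<Sum>i=1..l. of_nat (s' i) * (of_int (r' i) / of_nat (s' i)))"
      using d1 sum[OF d1, symmetric] unfolding has_newton_slopes_decomp[OF B]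
      by (intro exI[of _ "card I"] exI[of _ "r \<circ> f"] exI[of _ "s \<circ> f"] conjI) auto
  next
    fix t :: rat
    assume "\<exists>l r' s'. has_newton_slopes A B l r' s' \<and>
        t = (\<Sum>i=1..l. of_nat (s' i) * (of_int (r' i) / of_nat (s' i)))"
    then obtain l r' s' U' where d': "decomp A B {1..l} r' s' U'"
      and t: "t = (\<Sum>i=1..l. of_nat (s' i) * (of_int (r' i) / of_nat (s' i)))"
      unfolding has_newton_slopes_decomp[OF B] by blast
    show "t = of_int (\<Sum>k\<in>I. r k)"
      unfolding t sum[OF d'] decomp_sum_unique[OF d' d] ..
  qed
qed

end

subsection \<open>Semisimplicity and cyclic vectors\<close>

context isocrystal
begin

lemma subset_span_Un: "X \<subseteq> span (X \<union> Y)" "Y \<subseteq> span (X \<union> Y)"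
  using span_superset[of "X \<union> Y"] by auto

text \<open>Second isomorphism theorem: \<open>(A + Y)/Y\<close> is
  \<open>A/(A \<inter> Y) = A/B\<close>, and the same cyclic basis works.\<close>

lemma simple_of_slope_sum:
  assumes h: "simple_of_slope A B r s" and Y: "subisocrystal Y" and AY: "A \<inter> Y = B"
  shows "simple_of_slope (span (A \<union> Y)) Y r s"
proof -
  note D = simple_of_slopeD[OF h]
  note subY = subisocrystal_subspace[OF Y]
  have BY: "B \<subseteq> Y" using AY by blast
  have mem: "x \<in> span (A \<union> Y) \<longleftrightarrow> (\<exists>a\<in>A. \<exists>y\<in>Y. x = a + y)" for x
    by (rule mem_span_Un[OF D(5) subY])
  have "simple (span (A \<union> Y)) Y"
    unfolding simple_def
  proof (intro conjI allI impI)
    show "subisocrystal (span (A \<union> Y))" by (rule subisocrystal_span_Un[OF D(2) Y])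
    show "subisocrystal Y" by (rule Y)
    obtain a where "a \<in> A" "a \<notin> B" using D(1) by (auto simp: simple_def)
    then have "a \<in> span (A \<union> Y)" "a \<notin> Y" using AY subset_span_Un by auto
    then show "Y \<subset> span (A \<union> Y)" using subset_span_Un(2)[of Y A] by blast
    fix X assume X: "subisocrystal X \<and> Y \<subseteq> X \<and> X \<subseteq> span (A \<union> Y)"
    then have subX: "subspace X" by (simp add: subisocrystal_subspace)
    have "subisocrystal (X \<inter> A)" using X D(2) by (simp add: subisocrystal_Int)
    moreover have "B \<subseteq> X \<inter> A" using X D(4) BY by auto
    ultimately have "X \<inter> A = B \<or> X \<inter> A = A" using D(1) by (auto simp: simple_def)
    then show "X = Y \<or> X = span (A \<union> Y)"
    proof
      assume XA: "X \<inter> A = B"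
      have "x \<in> Y" if x: "x \<in> X" for x
      proof -
        obtain a y where ay: "a \<in> A" "y \<in> Y" "x = a + y" using x X mem by blast
        then have "a = x - y" by simp
        moreover have "x - y \<in> X" using subspace_diff[OF subX] that ay(2) X by blast
        ultimately have "a \<in> X" by simp
        then have "a \<in> Y" using ay XA BY by blast
        then show ?thesis using ay subspace_add[OF subY] by blast
      qed
      then show ?thesis using X by blast
    next
      assume "X \<inter> A = A"
      then have "A \<union> Y \<subseteq> X" using X by blast
      then have "span (A \<union> Y) \<subseteq> X" using subX by (rule span_minimal)
      then show ?thesis using X by blast
    qed
  qed
  moreover obtain e where e: "span (B \<union> e ` {..<s}) = A"
       "\<forall>c. (\<Sum>i<s. c i *s e i) \<in> B \<longrightarrow> (\<forall>i<s. c i = 0)"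
       "\<forall>i. Suc i < s \<longrightarrow> \<Phi> (e i) - e (Suc i) \<in> B"
       "\<Phi> (e (s - 1)) - (of_nat p powi r) *s e 0 \<in> B"
    using h unfolding simple_of_slope_def by blast
  have eA: "e i \<in> A" if "i < s" for i
    using span_superset[of "B \<union> e ` {..<s}"] that unfolding e(1) by auto
  have "span (Y \<union> e ` {..<s}) = span (A \<union> Y)"
  proof (rule span_eq[THEN iffD2], intro conjI Un_least)
    show "Y \<subseteq> span (A \<union> Y)" by (rule subset_span_Un)
    show "e ` {..<s} \<subseteq> span (A \<union> Y)" using eA subset_span_Un by auto
    show "Y \<subseteq> span (Y \<union> e ` {..<s})" by (rule subset_span_Un)
    show "A \<subseteq> span (Y \<union> e ` {..<s})" unfolding e(1)[symmetric] using BY by (intro span_mono) auto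
  qed
  moreover have "\<forall>i<s. c i = 0" if "(\<Sum>i<s. c i *s e i) \<in> Y" for c
  proof -
    have "(\<Sum>i<s. c i *s e i) \<in> A"
      using eA by (intro subspace_sum[OF D(5)] subspace_scale[OF D(5)]) auto
    then show ?thesis using that e(2) AY by blast
  qed
  ultimately show ?thesis
    using D(7,8) e(3,4) BY unfolding simple_of_slope_def by blast
qed

text \<open>The opposite direction: \<open>A \<inter> X\<close> maps onto \<open>A/B\<close> with
  kernel \<open>B \<inter> X\<close>. The cyclic basis is moved into \<open>X\<close> modulo
  \<open>B\<close>, so that its relations hold modulo \<open>B \<inter> X\<close>.\<close>

lemma simple_of_slope_Int:
  assumes h: "simple_of_slope A B r s" and X: "subisocrystal X" and AX: "A \<subseteq> span (X \<union> B)"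
  shows "simple_of_slope (A \<inter> X) (B \<inter> X) r s"
proof -
  note D = simple_of_slopeD[OF h]
  note subX = subisocrystal_subspace[OF X]
  have dec: "\<exists>x\<in>A \<inter> X. a - x \<in> B" if a: "a \<in> A" for a
  proof -
    obtain x b where xb: "x \<in> X" "b \<in> B" "a = x + b"
      using a AX mem_span_Un[OF subX D(6)] by blast
    then have "x = a - b" by simp
    moreover have "a - b \<in> A" using subspace_diff[OF D(5)] that xb(2) D(4) by blast
    ultimately have "x \<in> A" by simp
    then show ?thesis using xb by (intro bexI[of _ x]) auto
  qed
  have subAX: "subspace (A \<inter> X)" by (rule subspace_inter[OF D(5) subX])
  have "simple (A \<inter> X) (B \<inter> X)"
    unfolding simple_def
  proof (intro conjI allI impI)
    show "subisocrystal (A \<inter> X)" "subisocrystal (B \<inter> X)" using D X by (auto intro: subisocrystal_Int)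
    obtain a where a: "a \<in> A" "a \<notin> B" using D(1) by (auto simp: simple_def)
    obtain x where x: "x \<in> A \<inter> X" "a - x \<in> B" using dec a by blast
    have "x \<notin> B"
    proof
      assume "x \<in> B"
      then have "(a - x) + x \<in> B" by (rule subspace_add[OF D(6) x(2)])
      then show False using a by simp
    qed
    then show "B \<inter> X \<subset> A \<inter> X" using x D(4) by blast
    fix Y assume Y: "subisocrystal Y \<and> B \<inter> X \<subseteq> Y \<and> Y \<subseteq> A \<inter> X"
    then have subY: "subspace Y" by (simp add: subisocrystal_subspace)
    have "subisocrystal (span (Y \<union> B))" using Y D(3) by (intro subisocrystal_span_Un) auto
    moreover have "B \<subseteq> span (Y \<union> B)" by (rule subset_span_Un)
    moreover have "span (Y \<union> B) \<subseteq> A" using Y D(4,5) by (intro span_minimal) auto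
    ultimately have "span (Y \<union> B) = B \<or> span (Y \<union> B) = A" using D(1) by (simp add: simple_def)
    then show "Y = B \<inter> X \<or> Y = A \<inter> X"
    proof
      assume "span (Y \<union> B) = B"
      then have "Y \<subseteq> B" using subset_span_Un(1)[of Y B] by simp
      then show ?thesis using Y by blast
    next
      assume YA: "span (Y \<union> B) = A"
      have "a \<in> Y" if a: "a \<in> A \<inter> X" for a
      proof -
        have "a \<in> span (Y \<union> B)" using a YA by blast
        then obtain y b where yb: "y \<in> Y" "b \<in> B" "a = y + b"
          unfolding mem_span_Un[OF subY D(6)] by blast
        then have "b = a - y" by simp
        moreover have "a - y \<in> X" using subspace_diff[OF subX] a yb(1) Y by blast
        ultimately have "b \<in> X" by simp
        then have "b \<in> Y" using yb Y by blast
        then show ?thesis using yb subspace_add[OF subY] by blast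
      qed
      then show ?thesis using Y by blast
    qed
  qed
  moreover obtain e where e: "span (B \<union> e ` {..<s}) = A"
       "\<And>c. (\<Sum>i<s. c i *s e i) \<in> B \<Longrightarrow> (\<forall>i<s. c i = 0)"
       "\<And>i. Suc i < s \<Longrightarrow> \<Phi> (e i) - e (Suc i) \<in> B"
       "\<Phi> (e (s - 1)) - (of_nat p powi r) *s e 0 \<in> B"
    using h unfolding simple_of_slope_def by blast
  have eA: "e i \<in> A" if "i < s" for i
    using span_superset[of "B \<union> e ` {..<s}"] that unfolding e(1) by auto
  have "\<forall>i. \<exists>x. i < s \<longrightarrow> x \<in> A \<inter> X \<and> e i - x \<in> B" using dec eA by blast
  then obtain f where f: "\<And>i. i < s \<Longrightarrow> f i \<in> A \<inter> X" "\<And>i. i < s \<Longrightarrow> e i - f i \<in> B"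
    by metis
  have diff: "(\<Sum>i<s. c i *s e i) - (\<Sum>i<s. c i *s f i) \<in> B" for c
  proof -
    have "(\<Sum>i<s. c i *s (e i - f i)) \<in> B"
      using f by (intro subspace_sum[OF D(6)] subspace_scale[OF D(6)]) auto
    then show ?thesis by (simp add: scale_right_diff_distrib sum_subtractf)
  qed
  have fsum: "(\<Sum>i<s. c i *s f i) \<in> A \<inter> X" for c
    using f by (intro subspace_sum[OF subAX] subspace_scale[OF subAX]) auto
  have "span (B \<inter> X \<union> f ` {..<s}) = A \<inter> X"
  proof
    show "span (B \<inter> X \<union> f ` {..<s}) \<subseteq> A \<inter> X"
      using f(1) D(4) by (intro span_minimal subAX) auto
    show "A \<inter> X \<subseteq> span (B \<inter> X \<union> f ` {..<s})"
    proof
      fix a assume a: "a \<in> A \<inter> X"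
      have "a \<in> span (B \<union> e ` {..<s})" using a e(1) by blast
      then obtain c where c: "a - (\<Sum>i<s. c i *s e i) \<in> B"
        unfolding mem_span_Un_image[OF D(6) finite_lessThan] by blast
      have "a - (\<Sum>i<s. c i *s f i) \<in> B"
        using subspace_add[OF D(6) c diff[of c]] by simp
      moreover have "a - (\<Sum>i<s. c i *s f i) \<in> X"
        using a fsum[of c] by (intro subspace_diff[OF subX]) auto
      ultimately show "a \<in> span (B \<inter> X \<union> f ` {..<s})"
        unfolding mem_span_Un_image[OF subspace_inter[OF D(6) subX] finite_lessThan] by blast
    qed
  qed
  moreover have "\<forall>i<s. c i = 0" if "(\<Sum>i<s. c i *s f i) \<in> B \<inter> X" for c
  proof -
    have "(\<Sum>i<s. c i *s e i) \<in> B"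
      using subspace_add[OF D(6) diff[of c], of "\<Sum>i<s. c i *s f i"] that by simp
    then show ?thesis by (rule e(2))
  qed
  moreover have "\<Phi> (f i) - f (Suc i) \<in> B \<inter> X" if i: "Suc i < s" for i
  proof
    have "\<Phi> (e i - f i) \<in> B" using f(2)[of i] i by (simp add: Phi_mem_iff[OF D(3)])
    then have "(\<Phi> (e i) - e (Suc i)) - \<Phi> (e i - f i) + (e (Suc i) - f (Suc i)) \<in> B"
      by (intro subspace_add[OF D(6)] subspace_diff[OF D(6) e(3)[OF i]] f(2)[OF i])
    then show "\<Phi> (f i) - f (Suc i) \<in> B" by (simp add: Phi_diff)
    show "\<Phi> (f i) - f (Suc i) \<in> X"
      using f(1)[of i] f(1)[of "Suc i"] i
      by (intro subspace_diff[OF subX]) (auto simp: Phi_mem_iff[OF X])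
  qed
  moreover have "\<Phi> (f (s - 1)) - (of_nat p powi r) *s f 0 \<in> B \<inter> X"
  proof
    have "\<Phi> (e (s - 1) - f (s - 1)) \<in> B" using f(2)[of "s - 1"] D(7) by (simp add: Phi_mem_iff[OF D(3)])
    then have "(\<Phi> (e (s - 1)) - (of_nat p powi r) *s e 0) - \<Phi> (e (s - 1) - f (s - 1))
        + (of_nat p powi r) *s (e 0 - f 0) \<in> B"
      by (intro subspace_add[OF D(6)] subspace_diff[OF D(6) e(4)] subspace_scale[OF D(6)] f(2)[OF D(7)])
    then show "\<Phi> (f (s - 1)) - (of_nat p powi r) *s f 0 \<in> B"
      by (simp add: Phi_diff scale_right_diff_distrib)
    show "\<Phi> (f (s - 1)) - (of_nat p powi r) *s f 0 \<in> X"
      using f(1)[of "s - 1"] f(1)[OF D(7)] D(7)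
      by (intro subspace_diff[OF subX] subspace_scale[OF subX]) (auto simp: Phi_mem_iff[OF X])
  qed
  ultimately show ?thesis using D(7,8) unfolding simple_of_slope_def by blast
qed

text \<open>\<open>X/B\<close> and \<open>(X + Y)/Y\<close> are isomorphic; a decomposition is
  carried upwards here and back down in \<open>decomp_Int\<close>.\<close>

lemma decomp_sum:
  assumes d: "decomp X B I r s U" and Y: "subisocrystal Y" and XY: "X \<inter> Y = B"
  shows "decomp (span (X \<union> Y)) Y I r s (\<lambda>k. span (U k \<union> Y))"
proof -
  note D = decompD[OF d]
  note subY = subisocrystal_subspace[OF Y]
  have BY: "B \<subseteq> Y" using XY by blast
  have "simple_of_slope (span (U k \<union> Y)) Y (r k) (s k)" if "k \<in> I" for k
    by (rule simple_of_slope_sum[OF D(7)[OF that] Y]) (use D(10,11)[OF that] XY in blast)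
  moreover have "span (Y \<union> (\<Union>k\<in>I. span (U k \<union> Y))) = span (X \<union> Y)"
  proof (rule span_eq[THEN iffD2], intro conjI Un_least UN_least)
    show "Y \<subseteq> span (X \<union> Y)" "Y \<subseteq> span (Y \<union> (\<Union>k\<in>I. span (U k \<union> Y)))" by (rule subset_span_Un)+
    show "span (U k \<union> Y) \<subseteq> span (X \<union> Y)" if "k \<in> I" for k
      using D(11)[OF that] by (intro span_mono) auto
    have "U k \<subseteq> span (U k \<union> Y)" for k by (rule subset_span_Un)
    then show "X \<subseteq> span (Y \<union> (\<Union>k\<in>I. span (U k \<union> Y)))"
      unfolding D(12)[symmetric] using BY by (intro span_mono) blast
  qed
  moreover have "u k \<in> Y" if u: "\<forall>k\<in>I. u k \<in> span (U k \<union> Y)" "(\<Sum>k\<in>I. u k) \<in> Y" and k: "k \<in> I" for u k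
  proof -
    have "\<forall>k\<in>I. \<exists>v. v \<in> U k \<and> u k - v \<in> Y"
    proof
      fix k assume k: "k \<in> I"
      then obtain v y where "v \<in> U k" "y \<in> Y" "u k = v + y"
        using u(1) mem_span_Un[OF D(9)[OF k] subY] by blast
      then show "\<exists>v. v \<in> U k \<and> u k - v \<in> Y" by (intro exI[of _ v]) auto
    qed
    from bchoice[OF this] obtain v where v: "\<forall>k\<in>I. v k \<in> U k \<and> u k - v k \<in> Y" by blast
    have "(\<Sum>k\<in>I. u k - v k) \<in> Y" using v by (intro subspace_sum[OF subY]) auto
    from subspace_diff[OF subY u(2) this] have "(\<Sum>k\<in>I. v k) \<in> Y" by (simp add: sum_subtractf)
    moreover have "(\<Sum>k\<in>I. v k) \<in> X" using v D(11) by (intro subspace_sum[OF D(5)]) blast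
    ultimately have "v k \<in> B" using D(13)[of v k] v k XY by blast
    then have "(u k - v k) + v k \<in> Y" using v k BY by (intro subspace_add[OF subY]) auto
    then show ?thesis by simp
  qed
  ultimately show ?thesis using D(1) Y unfolding decomp_def by blast
qed

lemma decomp_Int:
  assumes d: "decomp A Y I r s U" and X: "subisocrystal X" and XY: "span (X \<union> Y) = A"
  shows "decomp X (X \<inter> Y) I r s (\<lambda>k. U k \<inter> X)"
proof -
  note D = decompD[OF d]
  note subX = subisocrystal_subspace[OF X]
  have "simple_of_slope (U k \<inter> X) (X \<inter> Y) (r k) (s k)" if "k \<in> I" for k
    using simple_of_slope_Int[OF D(7)[OF that] X] D(11)[OF that] XY by (simp add: Int_commute)
  moreover have "span (X \<inter> Y \<union> (\<Union>k\<in>I. U k \<inter> X)) = X"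
  proof
    show "span (X \<inter> Y \<union> (\<Union>k\<in>I. U k \<inter> X)) \<subseteq> X" by (intro span_minimal subX) auto
    show "X \<subseteq> span (X \<inter> Y \<union> (\<Union>k\<in>I. U k \<inter> X))"
    proof
      fix x assume x: "x \<in> X"
      then have "x \<in> A" using XY subset_span_Un(1)[of X Y] by blast
      then obtain u where u: "\<forall>k\<in>I. u k \<in> U k" "x - (\<Sum>k\<in>I. u k) \<in> Y"
        using decomp_mem_iff[OF d] by blast
      have "\<forall>k\<in>I. \<exists>v. v \<in> U k \<inter> X \<and> u k - v \<in> Y"
      proof
        fix k assume k: "k \<in> I"
        then have "u k \<in> span (X \<union> Y)" using u(1) D(11) XY by blast
        then obtain v y where vy: "v \<in> X" "y \<in> Y" "u k = v + y"
          unfolding mem_span_Un[OF subX D(3)] by blast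
        then have "v = u k - y" by simp
        moreover have "u k - y \<in> U k"
          using u(1) k vy(2) D(10)[OF k] subspace_diff[OF D(9)[OF k]] by blast
        ultimately have "v \<in> U k" by simp
        then show "\<exists>v. v \<in> U k \<inter> X \<and> u k - v \<in> Y" using vy by (intro exI[of _ v]) auto
      qed
      from bchoice[OF this] obtain v where v: "\<forall>k\<in>I. v k \<in> U k \<inter> X \<and> u k - v k \<in> Y" by blast
      have "(\<Sum>k\<in>I. u k - v k) \<in> Y" using v by (intro subspace_sum[OF D(3)]) auto
      from subspace_add[OF D(3) u(2) this] have "x - (\<Sum>k\<in>I. v k) \<in> Y" by (simp add: sum_subtractf)
      moreover have "x - (\<Sum>k\<in>I. v k) \<in> X"
        using v x by (intro subspace_diff[OF subX] subspace_sum[OF subX]) auto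
      ultimately show "x \<in> span (X \<inter> Y \<union> (\<Union>k\<in>I. U k \<inter> X))"
        using mem_span_Un_UN[of "X \<inter> Y" I "\<lambda>k. U k \<inter> X" x] v D(1,3,9) subX
        by (auto simp: subspace_inter)
    qed
  qed
  moreover have "u k \<in> X \<inter> Y" if "\<forall>k\<in>I. u k \<in> U k \<inter> X" "(\<Sum>k\<in>I. u k) \<in> X \<inter> Y" "k \<in> I" for u k
    using D(13)[of u k] that by auto
  ultimately show ?thesis
    using D(1) subisocrystal_Int[OF X D(2)] unfolding decomp_def by blast
qed

lemma decomp_subset:
  assumes d: "decomp A B I r s U" and T: "T \<subseteq> I"
  shows "decomp (span (B \<union> (\<Union>k\<in>T. U k))) B T r s U"
proof -
  note D = decompD[OF d]
  have "u k \<in> B" if u: "\<forall>k\<in>T. u k \<in> U k" "(\<Sum>k\<in>T. u k) \<in> B" and k: "k \<in> T" for u k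
  proof -
    define v where "v k = (if k \<in> T then u k else 0)" for k
    have "(\<Sum>k\<in>I. v k) = (\<Sum>k\<in>T. u k)"
      using D(1) T by (intro sum.mono_neutral_cong_right) (auto simp: v_def)
    moreover have "v k \<in> U k" if "k \<in> I" for k
      using u(1) subspace_0[OF D(9)[OF that]] by (simp add: v_def)
    ultimately have "v k \<in> B" using D(13)[of v k] u(2) k T by auto
    then show ?thesis using k by (simp add: v_def)
  qed
  then show ?thesis
    using D(2,7) finite_subset[OF T D(1)] T unfolding decomp_def by blast
qed

lemma decomp_parts_Int:
  assumes d: "decomp A B I r s U" and T: "T \<subseteq> I" "T' \<subseteq> I" "T \<inter> T' = {}"
  shows "span (B \<union> (\<Union>k\<in>T. U k)) \<inter> span (B \<union> (\<Union>k\<in>T'. U k)) = B"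
proof
  note D = decompD[OF d]
  show "span (B \<union> (\<Union>k\<in>T. U k)) \<inter> span (B \<union> (\<Union>k\<in>T'. U k)) \<subseteq> B"
  proof
    fix x assume x: "x \<in> span (B \<union> (\<Union>k\<in>T. U k)) \<inter> span (B \<union> (\<Union>k\<in>T'. U k))"
    obtain u where u: "\<forall>k\<in>T. u k \<in> U k" "x - (\<Sum>k\<in>T. u k) \<in> B"
      using x decomp_mem_iff[OF decomp_subset[OF d T(1)]] by blast
    obtain u' where u': "\<forall>k\<in>T'. u' k \<in> U k" "x - (\<Sum>k\<in>T'. u' k) \<in> B"
      using x decomp_mem_iff[OF decomp_subset[OF d T(2)]] by blast
    define v where "v k = (if k \<in> T then u k else if k \<in> T' then - u' k else 0)" for k
    have "(\<Sum>k\<in>I. v k) = (\<Sum>k\<in>T \<union> T'. v k)"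
      using D(1) T by (intro sum.mono_neutral_right) (auto simp: v_def)
    also have "\<dots> = (\<Sum>k\<in>T. v k) + (\<Sum>k\<in>T'. v k)"
      using T D(1) by (intro sum.union_disjoint) (auto intro: finite_subset)
    also have "(\<Sum>k\<in>T'. v k) = (\<Sum>k\<in>T'. - u' k)"
      using T by (intro sum.cong) (auto simp: v_def)
    finally have "(\<Sum>k\<in>I. v k) = (x - (\<Sum>k\<in>T'. u' k)) - (x - (\<Sum>k\<in>T. u k))"
      by (simp add: v_def sum_negf)
    then have sum: "(\<Sum>k\<in>I. v k) \<in> B" using subspace_diff[OF D(3) u'(2) u(2)] by simp
    have "v k \<in> U k" if k: "k \<in> I" for k
      using u(1) u'(1) subspace_0[OF D(9)[OF k]] subspace_neg[OF D(9)[OF k]] by (simp add: v_def)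
    then have "v k \<in> B" if "k \<in> T" for k using D(13)[of v k] sum T that by blast
    then have "(\<Sum>k\<in>T. u k) \<in> B" by (intro subspace_sum[OF D(3)]) (metis v_def)
    from subspace_add[OF D(3) u(2) this] show "x \<in> B" by simp
  qed
  show "B \<subseteq> span (B \<union> (\<Union>k\<in>T. U k)) \<inter> span (B \<union> (\<Union>k\<in>T'. U k))"
    using subset_span_Un(1) by simp
qed

lemma span_parts_Un:
  "span (span (B \<union> (\<Union>k\<in>T. U k)) \<union> span (B \<union> (\<Union>k\<in>T'. U k))) = span (B \<union> (\<Union>k\<in>T \<union> T'. U k))"
proof (rule antisym)
  show "span (span (B \<union> (\<Union>k\<in>T. U k)) \<union> span (B \<union> (\<Union>k\<in>T'. U k))) \<subseteq> span (B \<union> (\<Union>k\<in>T \<union> T'. U k))"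
    by (intro span_minimal Un_least span_mono) auto
  have "B \<union> (\<Union>k\<in>T \<union> T'. U k) \<subseteq> span (B \<union> (\<Union>k\<in>T. U k)) \<union> span (B \<union> (\<Union>k\<in>T'. U k))"
    using span_superset[of "B \<union> (\<Union>k\<in>T. U k)"] span_superset[of "B \<union> (\<Union>k\<in>T'. U k)"] by auto
  then show "span (B \<union> (\<Union>k\<in>T \<union> T'. U k)) \<subseteq> span (span (B \<union> (\<Union>k\<in>T. U k)) \<union> span (B \<union> (\<Union>k\<in>T'. U k)))"
    by (rule span_mono)
qed

text \<open>Makes a prescribed block \<open>T'\<close> of summands one layer of a filtration by
  partial sums.\<close>

lemma decomp_layer:
  assumes d: "decomp A B I r s U" and T: "T \<subseteq> I" "T' \<subseteq> I" "T \<inter> T' = {}"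
  shows "\<exists>U'. decomp (span (B \<union> (\<Union>k\<in>T \<union> T'. U k))) (span (B \<union> (\<Union>k\<in>T. U k))) T' r s U'"
  using decomp_sum[OF decomp_subset[OF d T(2)] decompD(4)[OF decomp_subset[OF d T(1)]]]
    decomp_parts_Int[OF d T(2,1)] T(3) unfolding span_parts_Un by (auto simp: Un_commute Int_commute)

text \<open>Semisimplicity with a record of the indices. A maximal \<open>T\<close> whose partial
  sum \<open>P T\<close> meets \<open>X\<close> only in \<open>B\<close> gives a complement of
  \<open>X\<close>. Then \<open>A/X\<close> is \<open>P T / B\<close> and \<open>X/B\<close> is
  \<open>A / P T\<close>, so the two use complementary indices.\<close>

lemma decomp_split:
  assumes d: "decomp A B I r s U" and X: "subisocrystal X" "B \<subseteq> X" "X \<subseteq> A"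
  shows "\<exists>T U1 U2. T \<subseteq> I \<and> decomp A X T r s U1 \<and> decomp X B (I - T) r s U2"
proof -
  note D = decompD[OF d]
  define P where "P T = span (B \<union> (\<Union>k\<in>T. U k))" for T
  have P: "subisocrystal (P T)" "subspace (P T)" "B \<subseteq> P T" if "T \<subseteq> I" for T
    using decompD[OF decomp_subset[OF d that]] by (auto simp: P_def)
  define S where "S = {T. T \<subseteq> I \<and> X \<inter> P T = B}"
  have "finite S" unfolding S_def using D(1) by simp
  moreover have "{} \<in> S" using X(2) by (auto simp: S_def P_def span_eq_iff[THEN iffD2, OF D(3)])
  ultimately obtain T where T: "T \<in> S" "\<And>T'. T' \<in> S \<Longrightarrow> T \<subseteq> T' \<Longrightarrow> T' = T"
    using finite_has_maximal[of S] by blast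
  then have TI: "T \<subseteq> I" and XP: "X \<inter> P T = B" by (auto simp: S_def)
  have "U k \<subseteq> span (X \<union> P T)" if k: "k \<in> I - T" for k
  proof -
    \<comment> \<open>By maximality \<open>X\<close> meets \<open>P (insert k T)\<close> outside
      \<open>B\<close>. The \<open>U k\<close>-component of such a vector lies in
      \<open>X + P T\<close> but not in \<open>B\<close>, so simplicity puts all of
      \<open>U k\<close> there.\<close>
    have "insert k T \<notin> S" using T(2)[of "insert k T"] k by blast
    then have "X \<inter> P (insert k T) \<noteq> B" using k TI by (auto simp: S_def)
    moreover have "B \<subseteq> X \<inter> P (insert k T)" using X(2) P(3)[of "insert k T"] k TI by blast
    ultimately obtain x where x: "x \<in> X" "x \<in> P (insert k T)" "x \<notin> B" by blast
    have kI: "k \<in> I" using k by simp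
    have "P (insert k T) = span (U k \<union> P T)"
    proof -
      have "P (insert k T) = span (U k \<union> (B \<union> (\<Union>k\<in>T. U k)))"
        by (simp add: P_def Un_left_commute)
      also have "\<dots> = span (U k \<union> P T)"
        unfolding P_def span_Un[of "U k"] span_span ..
      finally show ?thesis .
    qed
    then obtain w t where wt: "w \<in> U k" "t \<in> P T" "x = w + t"
      using x(2) mem_span_Un[OF D(9)[OF kI] P(2)[OF TI]] by auto
    have "w \<notin> B"
    proof
      assume "w \<in> B"
      then have "x \<in> P T" using wt P(3)[OF TI] subspace_add[OF P(2)[OF TI]] by blast
      then show False using x XP by blast
    qed
    moreover have "w \<in> span (X \<union> P T)"
    proof -
      have "w = x - t" using wt by simp
      then show ?thesis using x(1) wt(2) by (auto intro!: span_diff intro: span_base)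
    qed
    ultimately have "span (X \<union> P T) \<inter> U k \<noteq> B" using wt(1) by blast
    moreover have "subisocrystal (span (X \<union> P T) \<inter> U k)"
      by (intro subisocrystal_Int subisocrystal_span_Un X P(1)[OF TI] D(8)[OF kI])
    moreover have "B \<subseteq> span (X \<union> P T) \<inter> U k" using D(10)[OF kI] X(2) subset_span_Un(1)[of X "P T"] by blast
    ultimately have "span (X \<union> P T) \<inter> U k = U k"
      using simple_of_slopeD(1)[OF D(7)[OF kI]] by (auto simp: simple_def)
    then show ?thesis by blast
  qed
  moreover have "U k \<subseteq> span (X \<union> P T)" if "k \<in> T" for k
  proof -
    have "U k \<subseteq> P T" using span_superset[of "B \<union> (\<Union>k\<in>T. U k)"] that by (auto simp: P_def)
    then show ?thesis using subset_span_Un(2)[of "P T" X] by blast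
  qed
  ultimately have "B \<union> (\<Union>k\<in>I. U k) \<subseteq> span (X \<union> P T)"
    using X(2) subset_span_Un(1)[of X "P T"] by blast
  then have "A \<subseteq> span (X \<union> P T)" unfolding D(12)[symmetric] by (intro span_minimal) auto
  moreover have "P T \<subseteq> A" unfolding P_def D(12)[symmetric] using TI by (intro span_mono) auto
  ultimately have XPA: "span (X \<union> P T) = A" using X(3) D(5) by (intro antisym span_minimal) auto
  have "decomp (span (P T \<union> X)) X T r s (\<lambda>k. span (U k \<union> X))"
    using decomp_sum[OF decomp_subset[OF d TI, folded P_def] X(1)] XP by (simp add: Int_commute)
  then have d1: "decomp A X T r s (\<lambda>k. span (U k \<union> X))" using XPA by (simp add: Un_commute)
  obtain U' where "decomp (P (T \<union> (I - T))) (P T) (I - T) r s U'"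
    using decomp_layer[OF d TI, of "I - T"] unfolding P_def by auto
  moreover have "P (T \<union> (I - T)) = A" using TI D(12) by (simp add: P_def Un_absorb1)
  ultimately have "decomp A (P T) (I - T) r s U'" by simp
  from decomp_Int[OF this X(1) XPA] have "decomp X B (I - T) r s (\<lambda>k. U' k \<inter> X)"
    unfolding XP .
  then show ?thesis using TI d1 by blast
qed

text \<open>
  Take coordinates of \<open>v\<close> that are linearly independent over the field fixed by \<open>\<sigma>\<^sup>D\<close>: all
  coefficients of the linear forms that cut out a subisocrystal can be taken in that field.
\<close>

lemma exists_cyclic_vector:
  assumes d: "decomp A B I r s U"
  shows "\<exists>v\<in>A. \<forall>X. subisocrystal X \<longrightarrow> B \<subseteq> X \<longrightarrow> X \<subseteq> A \<longrightarrow> v \<in> X \<longrightarrow> X = A"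
proof -
  note D = decompD[OF d]
  define m where "m = (\<Prod>k\<in>I. s k)"
  have "s k > 0" if "k \<in> I" for k by (rule simple_of_slopeD(7)[OF D(7)[OF that]])
  then have m: "m > 0" unfolding m_def by (auto intro: prod_pos)
  have sm: "\<And>k. k \<in> I \<Longrightarrow> s k dvd m" unfolding m_def using D(1) by auto
  define Z where "Z = Sigma I (\<lambda>k. {..<s k})"
  obtain b a where b: "eigenbasis m A B Z b a"
    using decomp_eigenbasis[OF d sm] unfolding Z_def by blast
  have finZ: "finite Z" and spb: "span (B \<union> b ` Z) = A"
    and eig: "\<And>z. z \<in> Z \<Longrightarrow> Phi_pow m (b z) - (of_nat p powi a z) *s b z \<in> B"
    using b by (auto simp: eigenbasis_def)
  obtain x :: "nat \<times> nat \<Rightarrow> 'K" where x: "\<And>c. (\<forall>z\<in>Z. frob_pow m (c z) = c z) \<Longrightarrow>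
      (\<Sum>z\<in>Z. c z * x z) = 0 \<Longrightarrow> (\<forall>z\<in>Z. c z = 0)"
    using exists_linear_indep_over_fixed[OF m finZ] by blast
  define v where "v = (\<Sum>z\<in>Z. x z *s b z)"
  have bA: "b z \<in> A" if "z \<in> Z" for z
    using span_superset[of "B \<union> b ` Z"] that unfolding spb by auto
  then have "v \<in> A" unfolding v_def by (intro subspace_sum[OF D(5)] subspace_scale[OF D(5)]) auto
  moreover have "X = A" if X: "subisocrystal X" "B \<subseteq> X" "X \<subseteq> A" "v \<in> X" for X
  proof (rule ccontr)
    assume ne: "X \<noteq> A"
    note subX = subisocrystal_subspace[OF X(1)]
    \<comment> \<open>A part of the eigenbasis of \<open>A/B\<close> that is a basis of
      \<open>A/X\<close>. All \<open>b z\<close> remain eigenvectors modulo \<open>X\<close>, so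
      \<open>eigenvector_coeff\<close> applies to their coordinates there.\<close>
    obtain Z0 where Z0: "Z0 \<subseteq> Z" "indep_mod scale X Z0 b" "span (X \<union> b ` Z0) = span (X \<union> b ` Z)"
      using exists_indep_mod_subset[OF finZ subX] by blast
    have finZ0: "finite Z0" using Z0(1) finZ by (rule finite_subset)
    have "A \<subseteq> span (X \<union> b ` Z)" unfolding spb[symmetric] using X(2) by (intro span_mono) auto
    then have A: "A \<subseteq> span (X \<union> b ` Z0)" using Z0(3) by simp
    have "Z0 \<noteq> {}" using A ne X(3) span_eq_iff[THEN iffD2, OF subX]
      by (metis image_empty sup_bot_right subset_antisym)
    then obtain w where w: "w \<in> Z0" by blast
    have "\<forall>z\<in>Z. \<exists>c. b z - (\<Sum>y\<in>Z0. c y *s b y) \<in> X"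
      using bA A mem_span_Un_image[OF subX finZ0] by blast
    from bchoice[OF this] obtain c where c: "\<And>z. z \<in> Z \<Longrightarrow> b z - (\<Sum>y\<in>Z0. c z y *s b y) \<in> X"
      by blast
    have eigX: "Phi_pow m (b z) - (of_nat p powi a z) *s b z \<in> X" if "z \<in> Z" for z
      using eig[OF that] X(2) by blast
    have fixed: "frob_pow m (c z w) = c z w" if z: "z \<in> Z" for z
    proof (cases "c z w = 0")
      case True
      then show ?thesis by (simp add: frob_pow_zero)
    next
      case False
      show ?thesis
        by (rule eigenvector_coeff(2)[OF X(1) Z0(2) _ eigX[OF z] c[OF z] w False])
          (use eigX Z0(1) in blast)
    qed
    have "(\<Sum>z\<in>Z. x z *s (b z - (\<Sum>y\<in>Z0. c z y *s b y))) \<in> X"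
      using c by (intro subspace_sum[OF subX] subspace_scale[OF subX]) auto
    then have "v - (\<Sum>z\<in>Z. x z *s (b z - (\<Sum>y\<in>Z0. c z y *s b y))) \<in> X"
      by (rule subspace_diff[OF subX X(4)])
    also have "v - (\<Sum>z\<in>Z. x z *s (b z - (\<Sum>y\<in>Z0. c z y *s b y)))
        = (\<Sum>z\<in>Z. \<Sum>y\<in>Z0. (c z y * x z) *s b y)"
      by (simp add: v_def scale_right_diff_distrib sum_subtractf scale_sum_right mult.commute)
    also have "\<dots> = (\<Sum>y\<in>Z0. (\<Sum>z\<in>Z. c z y * x z) *s b y)"
      by (subst sum.swap) (simp add: scale_sum_left)
    \<comment> \<open>The \<open>w\<close>-coordinate of \<open>v\<close> modulo \<open>X\<close>: a
      relation between the \<open>x z\<close> with coefficients in the fixed field.\<close>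
    finally have "(\<Sum>z\<in>Z. c z w * x z) = 0"
      using indep_modD[OF Z0(2), of "\<lambda>y. \<Sum>z\<in>Z. c z y * x z"] w by blast
    then have zero: "c w w = 0" using x[of "\<lambda>z. c z w"] fixed w Z0(1) by blast
    \<comment> \<open>\<open>\<delta>\<close> is the difference of two expansions of
      \<open>b w\<close>, the trivial one and \<open>c w\<close>. They agree, so
      \<open>c w w\<close> is 1, against \<open>zero\<close>.\<close>
    define \<delta> where "\<delta> y = (if y = w then 1 else 0) - c w y" for y
    have "(\<Sum>y\<in>Z0. \<delta> y *s b y) = (\<Sum>y\<in>Z0. (if y = w then b y else 0)) - (\<Sum>y\<in>Z0. c w y *s b y)"
      by (auto simp: \<delta>_def scale_left_diff_distrib sum_subtractf intro!: sum.cong)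
    also have "\<dots> = b w - (\<Sum>y\<in>Z0. c w y *s b y)" using w finZ0 by simp
    finally have "\<delta> w = 0" using indep_modD[OF Z0(2), of \<delta> w] c[of w] w Z0(1) by auto
    then show False using zero by (simp add: \<delta>_def)
  qed
  ultimately show ?thesis by blast
qed

text \<open>Each further iterate raises the dimension until \<open>A\<close> is reached: if
  \<open>Phi_pow m v\<close> is already in the span, the span is \<open>\<Phi>\<close>-stable and
  contains \<open>v\<close>, hence is \<open>A\<close>. One \<open>v\<close> serves every
  \<open>X\<close>, so its flag is in general position to all of them.\<close>

lemma cyclic_vector_dim:
  assumes v: "v \<in> A" "\<And>X. subisocrystal X \<Longrightarrow> B \<subseteq> X \<Longrightarrow> X \<subseteq> A \<Longrightarrow> v \<in> X \<Longrightarrow> X = A"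
    and A: "subisocrystal A" and X: "subisocrystal X" "B \<subseteq> X" "X \<subseteq> A"
  shows "dim (span (X \<union> (\<lambda>j. Phi_pow j v) ` {..<m})) = min (dim X + m) (dim A)"
proof -
  define G where "G m = span (X \<union> (\<lambda>j. Phi_pow j v) ` {..<m})" for m
  note subX = subisocrystal_subspace[OF X(1)] and subA = subisocrystal_subspace[OF A]
  have GA: "G m \<subseteq> A" for m
    unfolding G_def using X(3) v(1) Phi_pow_mem_iff[OF A] by (intro span_minimal subA) auto
  have GS: "G (Suc m) = span (insert (Phi_pow m v) (G m))" for m
  proof -
    have "span (insert y (span S)) = span (insert y S)" for y S
      using span_mono[of S "insert y S"] span_superset[of S]
      by (intro span_eq[THEN iffD2]) (auto intro: span_base)
    then show ?thesis by (simp add: G_def lessThan_Suc)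
  qed
  have stop: "G m = A" if "Phi_pow m v \<in> G m" for m
  proof (rule v(2))
    have Phi_gen: "\<Phi> y \<in> G m" if y: "y \<in> X \<union> (\<lambda>j. Phi_pow j v) ` {..<m}" for y
    proof (cases "y \<in> X")
      case True
      then have "\<Phi> y \<in> X" by (simp add: Phi_mem_iff[OF X(1)])
      then show ?thesis unfolding G_def by (intro span_base) simp
    next
      case False
      then obtain j where j: "j < m" "y = Phi_pow j v" using y by auto
      show ?thesis
      proof (cases "Suc j = m")
        case True
        then show ?thesis using j \<open>Phi_pow m v \<in> G m\<close> by auto
      next
        case ne: False
        then have "Suc j \<in> {..<m}" using j by simp
        then have "Phi_pow (Suc j) v \<in> G m" unfolding G_def by (intro span_base) blast
        then show ?thesis using j by simp
      qed
    qed
    show "subisocrystal (G m)"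
    proof (rule subisocrystalI)
      show "subspace (G m)" by (simp add: G_def)
      then have "span (\<Phi> ` (X \<union> (\<lambda>j. Phi_pow j v) ` {..<m})) \<subseteq> G m"
        using Phi_gen by (intro span_minimal) auto
      then show "\<Phi> ` G m \<subseteq> G m"
        by (simp only: G_def Phi_image_span)
    qed
    show "B \<subseteq> G m" using X(2) subset_span_Un(1)[of X] unfolding G_def by blast
    show "G m \<subseteq> A" by (rule GA)
    show "v \<in> G m"
    proof (cases m)
      case 0
      then show ?thesis using that by simp
    next
      case (Suc m')
      have "Phi_pow 0 v \<in> (\<lambda>j. Phi_pow j v) ` {..<m}" using Suc by (intro imageI) simp
      then show ?thesis unfolding G_def by (intro span_base) simp
    qed
  qed
  have "dim (G m) = min (dim X + m) (dim A)"
  proof (induction m)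
    case 0
    have "G 0 = X" using subX by (simp add: G_def)
    then show ?case using dim_subset[OF X(3)] by simp
  next
    case (Suc m)
    show ?case
    proof (cases "Phi_pow m v \<in> G m")
      case True
      then have "G m = A" by (rule stop)
      moreover have "G (Suc m) = G m"
      proof -
        have "span (G m) = G m" by (simp add: G_def)
        then show ?thesis unfolding GS using True span_redundant by metis
      qed
      ultimately show ?thesis using Suc.IH by simp
    next
      case False
      moreover have "span (G m) = G m" by (simp add: G_def)
      ultimately have "Phi_pow m v \<notin> span (G m)" by metis
      then have "dim (G (Suc m)) = dim (G m) + 1" unfolding GS by (simp add: dim_insert)
      then show ?thesis using Suc.IH dim_subset[OF GA[of "Suc m"]] by simp
    qed
  qed
  then show ?thesis by (simp only: G_def)
qed

end

subsection \<open>Graded dimensions\<close>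

lemma sum_mset_eq_sum_count:
  fixes M :: "rat multiset"
  shows "sum_mset M = (\<Sum>x\<in>set_mset M. x * of_nat (count M x))"
proof -
  have "sum_mset M = (\<Sum>x\<in>S. x * of_nat (count M x))" if "finite S" "set_mset M \<subseteq> S" for S
    using that(2)
  proof (induction M)
    case (add y M)
    have "(\<Sum>x\<in>S. x * of_nat (count (add_mset y M) x)) =
        (\<Sum>x\<in>S. x * of_nat (count M x) + (if x = y then x else 0))"
      by (intro sum.cong) (auto simp: algebra_simps)
    also have "\<dots> = (\<Sum>x\<in>S. x * of_nat (count M x)) + y"
      using that(1) add.prems by (simp add: sum.distrib)
    finally show ?case using add by simp
  qed simp
  then show ?thesis by simp
qed

text \<open>The truncated subtraction is intended: it matches the dimension of an intersection in
  general position.\<close>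

lemma length_filter_ge_drop:
  assumes "sorted_wrt (\<ge>) (xs :: rat list)"
  shows "length (filter (\<lambda>y. x \<le> y) (drop q xs)) = length (filter (\<lambda>y. x \<le> y) xs) - q"
  using assms
proof (induction xs arbitrary: q)
  case (Cons h t)
  show ?case
  proof (cases q)
    case (Suc q')
    show ?thesis
    proof (cases "x \<le> h")
      case True
      then show ?thesis using Cons Suc by simp
    next
      case False
      then have "filter (\<lambda>y. x \<le> y) t = []" using Cons.prems by (auto simp: filter_empty_conv)
      then show ?thesis using Cons Suc False by simp
    qed
  qed simp
qed simp

lemma nth_ge_iff_less_length_filter:
  assumes "sorted_wrt (\<ge>) (xs :: rat list)" "j < length xs"
  shows "x \<le> xs ! j \<longleftrightarrow> j < length (filter (\<lambda>y. x \<le> y) xs)"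
  using assms
proof (induction xs arbitrary: j)
  case (Cons h t)
  show ?case
  proof (cases "x \<le> h")
    case True
    then show ?thesis using Cons by (cases j) auto
  next
    case False
    then have "filter (\<lambda>y. x \<le> y) t = []" using Cons.prems by (auto simp: filter_empty_conv)
    moreover have "(h # t) ! j \<le> h" using Cons.prems by (cases j) auto
    ultimately show ?thesis using False by auto
  qed
qed simp

context isocrystal
begin

lemma induced_eq:
  assumes "subspace (F x)" "subspace A" "subspace B"
  shows "induced F A B x = span ((F x \<inter> A) \<union> B)"
  using mem_span_Un[OF subspace_inter[OF assms(1,2)] assms(3)] unfolding induced_def by blast

lemma induced_mono:
  assumes F: "filtration F" and "x \<le> y"
  shows "induced F A B y \<subseteq> induced F A B x"
proof -
  have "F y \<subseteq> F x" using F assms(2) by (auto simp: filtration_def monotone_def)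
  then show ?thesis unfolding induced_def by blast
qed

lemma filtration_subspace: "filtration F \<Longrightarrow> subspace (F x)"
  by (simp add: filtration_def)

lemma filtration_antimono: "filtration F \<Longrightarrow> x \<le> y \<Longrightarrow> F y \<subseteq> F x"
  by (auto simp: filtration_def monotone_def)

text \<open>Dimensions are bounded, so some step beyond \<open>x\<close> has greatest dimension, and
  all steps between \<open>x\<close> and it coincide with it. This step replaces the union in
  \<open>gr_dim\<close>.\<close>

lemma filtration_constant_right:
  assumes F: "filtration F"
  shows "\<exists>y>x. \<forall>z. x < z \<longrightarrow> z \<le> y \<longrightarrow> F z = F y"
proof -
  have "x < x + 1" by simp
  moreover have "\<forall>y. x < y \<longrightarrow> dim (F y) < Suc (dim (UNIV :: 'v set))"
    by (intro allI impI le_imp_less_Suc dim_subset subset_UNIV)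
  ultimately have "\<exists>y. x < y \<and> (\<forall>z. x < z \<longrightarrow> dim (F z) \<le> dim (F y))"
    by (rule ex_has_greatest_nat[where P = "\<lambda>y. x < y" and f = "\<lambda>y. dim (F y)"])
  then obtain y where y: "x < y" "\<And>z. x < z \<Longrightarrow> dim (F z) \<le> dim (F y)" by blast
  have "F z = F y" if "x < z" "z \<le> y" for z
    using subspace_dim_equal[of "F y" "F z"] filtration_subspace[OF F] filtration_antimono[OF F that(2)] y(2)[OF that(1)]
    by simp
  then show ?thesis using y(1) by blast
qed

lemma gr_dim_eq_diff:
  assumes F: "filtration F" and y: "x < y" "\<And>z. x < z \<Longrightarrow> z \<le> y \<Longrightarrow> F z = F y"
  shows "gr_dim F A B x = dim (induced F A B x) - dim (induced F A B y)"
proof -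
  have "(\<Union>z\<in>{x<..}. induced F A B z) = induced F A B y"
  proof
    have "induced F A B z \<subseteq> induced F A B y" if "x < z" for z
    proof (cases "z \<le> y")
      case True
      then show ?thesis using y(2)[OF that True] by (simp add: induced_def)
    next
      case False
      then show ?thesis by (intro induced_mono[OF F]) simp
    qed
    then show "(\<Union>z\<in>{x<..}. induced F A B z) \<subseteq> induced F A B y" by auto
    show "induced F A B y \<subseteq> (\<Union>z\<in>{x<..}. induced F A B z)" using y(1) by auto
  qed
  then show ?thesis by (simp add: gr_dim_def)
qed

lemma dim_induced:
  assumes F: "filtration F" and A: "subspace A" and B: "subspace B" "B \<subseteq> A"
  shows "dim (induced F A B x) + dim (F x \<inter> B) = dim (F x \<inter> A) + dim B"
proof -
  have "F x \<inter> A \<inter> B = F x \<inter> B" using B(2) by blast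
  then show ?thesis
    using dim_span_Un_Int[OF subspace_inter[OF filtration_subspace[OF F, of x] A] B(1)]
      induced_eq[of F x A B, OF filtration_subspace[OF F] A B(1)] by metis
qed

text \<open>Exactness of \<open>0 \<rightarrow> B/C \<rightarrow> A/C \<rightarrow> A/B
  \<rightarrow> 0\<close> on graded pieces. \<open>dim_induced\<close> expresses all dimensions
  through the intersections of the steps with \<open>A\<close>, \<open>B\<close> and
  \<open>C\<close>, which leaves linear arithmetic.\<close>

lemma gr_dim_add:
  assumes F: "filtration F" and A: "subspace A" and B: "subspace B" "B \<subseteq> A" and C: "subspace C" "C \<subseteq> B"
  shows "gr_dim F A C x = gr_dim F A B x + gr_dim F B C x"
proof -
  obtain y where y: "x < y" "\<And>z. x < z \<Longrightarrow> z \<le> y \<Longrightarrow> F z = F y"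
    using filtration_constant_right[OF F] by blast
  have mono: "dim (induced F A B y) \<le> dim (induced F A B x)" for A B
    using induced_mono[OF F, of x y A B] y(1) by (intro dim_subset) simp
  have CA: "C \<subseteq> A" using B C by blast
  show ?thesis
    using gr_dim_eq_diff[OF F y, of A C] gr_dim_eq_diff[OF F y, of A B] gr_dim_eq_diff[OF F y, of B C]
      mono[of A C] mono[of A B] mono[of B C]
      dim_induced[OF F A B, of x] dim_induced[OF F A B, of y]
      dim_induced[OF F A C(1) CA, of x] dim_induced[OF F A C(1) CA, of y]
      dim_induced[OF F B(1) C, of x] dim_induced[OF F B(1) C, of y]
    by linarith
qed

text \<open>A telescoping sum; it is only an inequality because the steps may also shrink at a cut
  that no rational index marks.\<close>

lemma sum_gr_dim_le:
  assumes F: "filtration F" and A: "subspace A" and B: "subspace B" "B \<subseteq> A" and S: "finite S"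
  shows "(\<Sum>x\<in>S. gr_dim F A B x) \<le> dim A - dim B"
proof -
  have sub: "B \<subseteq> induced F A B z" "induced F A B z \<subseteq> A" for z
  proof -
    note eq = induced_eq[of F z A B, OF filtration_subspace[OF F] A B(1)]
    show "B \<subseteq> induced F A B z" unfolding eq by (rule subset_span_Un)
    show "induced F A B z \<subseteq> A" unfolding eq using B(2) by (intro span_minimal A) auto
  qed
  \<comment> \<open>Strengthened by the step at any \<open>z\<close> beyond \<open>S\<close>, since
    the induction adds the largest index.\<close>
  have "\<forall>z. (\<forall>x\<in>S. x < z) \<longrightarrow> (\<Sum>x\<in>S. gr_dim F A B x) + dim (induced F A B z) \<le> dim A"
    using S
  proof (induction S rule: finite_linorder_max_induct)
    case empty
    then show ?case using sub(2) by (auto intro: dim_subset)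
  next
    case (insert x S)
    show ?case
    proof (intro allI impI)
      fix z assume z: "\<forall>x\<in>insert x S. x < z"
      obtain y where y: "x < y" "\<And>z. x < z \<Longrightarrow> z \<le> y \<Longrightarrow> F z = F y"
        using filtration_constant_right[OF F] by blast
      have "dim (induced F A B z) \<le> dim (induced F A B y)"
      proof (cases "z \<le> y")
        case True
        then show ?thesis using y(2)[of z] z by (simp add: induced_def)
      next
        case False
        then show ?thesis by (intro dim_subset induced_mono[OF F]) simp
      qed
      moreover have "dim (induced F A B y) \<le> dim (induced F A B x)"
        using y(1) by (intro dim_subset induced_mono[OF F]) simp
      ultimately have "gr_dim F A B x + dim (induced F A B z) \<le> dim (induced F A B x)"
        using gr_dim_eq_diff[OF F y, of A B] by simp
      moreover have "(\<Sum>x\<in>S. gr_dim F A B x) + dim (induced F A B x) \<le> dim A"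
        using insert.IH insert.hyps by blast
      moreover have "x \<notin> S" using insert.hyps by blast
      ultimately show "(\<Sum>x\<in>insert x S. gr_dim F A B x) + dim (induced F A B z) \<le> dim A"
        using insert.hyps(1) by simp
    qed
  qed
  moreover obtain z where "\<forall>x\<in>S. x < z"
  proof
    show "\<forall>x\<in>S. x < Max (insert 0 S) + 1"
    proof
      fix x assume "x \<in> S"
      then have "x \<le> Max (insert 0 S)" using S by (intro Max_ge) auto
      then show "x < Max (insert 0 S) + 1" by linarith
    qed
  qed
  ultimately have "(\<Sum>x\<in>S. gr_dim F A B x) + dim (induced F A B z) \<le> dim A" by blast
  moreover have "dim B \<le> dim (induced F A B z)" by (intro dim_subset sub(1))
  ultimately show ?thesis by simp
qed

lemma deg_eq_sum_mset:
  assumes "\<And>x. gr_dim F A B x = count M x"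
  shows "deg F A B = sum_mset M"
  unfolding deg_def sum_mset_eq_sum_count assms set_mset_def by (simp add: neq0_conv)

section \<open>Hodge weights of subquotients as multisets\<close>

text \<open>\<open>Abs_multiset\<close> is meaningful only for finite support, which
  \<open>count_gr_mset\<close> provides for a filtration of given type.\<close>

definition gr_mset :: "(rat \<Rightarrow> 'v set) \<Rightarrow> 'v set \<Rightarrow> 'v set \<Rightarrow> rat multiset"
  where "gr_mset F A B = Abs_multiset (gr_dim F A B)"

lemma gr_mset_UNIV:
  assumes "filtration_of_type F d \<mu>"
  shows "gr_mset F UNIV {0} = image_mset \<mu> (mset_set {1..d})"
proof -
  have "gr_dim F UNIV {0} = count (image_mset \<mu> (mset_set {1..d}))"
    using assms by (simp add: fun_eq_iff filtration_of_type_def count_image_mset_set)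
  then show ?thesis by (simp add: gr_mset_def count_inverse)
qed

text \<open>By additivity a weight of a subquotient is a weight of the whole space, hence one of the
  finitely many values of \<open>\<mu>\<close>.\<close>

lemma count_gr_mset:
  assumes F: "filtration_of_type F d \<mu>" and A: "subspace A" and B: "subspace B" "B \<subseteq> A"
  shows "count (gr_mset F A B) x = gr_dim F A B x"
proof -
  have fil: "filtration F" using F by (simp add: filtration_of_type_def)
  have le: "gr_dim F A B x \<le> gr_dim F UNIV {0} x" for x
    using gr_dim_add[OF fil subspace_UNIV A _ subspace_single_0, of x]
      gr_dim_add[OF fil A B subspace_single_0, of x] subspace_0[OF A] subspace_0[OF B(1)] by simp
  have "{x. 0 < gr_dim F A B x} \<subseteq> \<mu> ` {1..d}"
  proof
    fix x assume "x \<in> {x. 0 < gr_dim F A B x}"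
    then have "0 < gr_dim F UNIV {0} x" using le[of x] by simp
    moreover have "gr_dim F UNIV {0} x = card {j\<in>{1..d}. \<mu> j = x}"
      using F unfolding filtration_of_type_def by blast
    ultimately have "{j\<in>{1..d}. \<mu> j = x} \<noteq> {}" by (metis card.empty less_irrefl)
    then show "x \<in> \<mu> ` {1..d}" by blast
  qed
  then have "finite {x. 0 < gr_dim F A B x}" by (rule finite_subset) simp
  then show ?thesis by (simp add: gr_mset_def Abs_multiset_inverse)
qed

lemma gr_mset_add:
  assumes "filtration_of_type F d \<mu>" "subspace A" "subspace B" "B \<subseteq> A" "subspace C" "C \<subseteq> B"
  shows "gr_mset F A C = gr_mset F A B + gr_mset F B C"
proof (rule multiset_eqI)
  fix x
  have CA: "C \<subseteq> A" using assms by blast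
  have F: "filtration F" using assms(1) by (simp add: filtration_of_type_def)
  show "count (gr_mset F A C) x = count (gr_mset F A B + gr_mset F B C) x"
    using gr_dim_add[OF F assms(2-6), of x]
    by (simp add: count_gr_mset[OF assms(1,2,5) CA] count_gr_mset[OF assms(1-4)]
        count_gr_mset[OF assms(1,3,5,6)])
qed

text \<open>
  A filtration may drop at a real cut without any graded piece seeing it; that the type has as many
  entries as the dimension excludes this, and hence also for every subquotient.
\<close>

lemma size_gr_mset:
  assumes F: "filtration_of_type F d \<mu>" and d: "dim (UNIV :: 'v set) = d"
    and A: "subspace A" and B: "subspace B" "B \<subseteq> A"
  shows "size (gr_mset F A B) = dim A - dim B"
proof -
  have fil: "filtration F" using F by (simp add: filtration_of_type_def)
  have le: "size (gr_mset F A B) \<le> dim A - dim B" if "subspace A" "subspace B" "B \<subseteq> A" for A B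
  proof -
    have "size (gr_mset F A B) = (\<Sum>x\<in>set_mset (gr_mset F A B). gr_dim F A B x)"
      using count_gr_mset[OF F that] by (simp add: size_multiset_overloaded_eq)
    then show ?thesis using sum_gr_dim_le[OF fil that, of "set_mset (gr_mset F A B)"] by simp
  qed
  have z: "{0} \<subseteq> A" "{0} \<subseteq> B" using subspace_0[OF A] subspace_0[OF B(1)] by auto
  \<comment> \<open>The sizes for \<open>UNIV/A\<close>, \<open>A/B\<close> and \<open>B/{0}\<close>
    add up to \<open>d\<close>, and so do their upper bounds; hence each bound is attained.\<close>
  have "size (gr_mset F UNIV {0}) = d" using gr_mset_UNIV[OF F] by simp
  moreover have "gr_mset F UNIV {0} = gr_mset F UNIV A + (gr_mset F A B + gr_mset F B {0})"
    using gr_mset_add[OF F subspace_UNIV A _ subspace_single_0 z(1)]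
      gr_mset_add[OF F A B subspace_single_0 z(2)] by simp
  ultimately have "size (gr_mset F UNIV A) + size (gr_mset F A B) + size (gr_mset F B {0}) = d" by simp
  moreover have "dim B \<le> dim A" "dim A \<le> d" using dim_subset[OF B(2)] dim_subset[of A UNIV] d by auto
  ultimately show ?thesis
    using le[OF subspace_UNIV A] le[OF A B] le[OF B(1) subspace_single_0 z(2)] d by simp
qed

lemma deg_eq_gr_mset:
  assumes "filtration_of_type F d \<mu>" "subspace A" "subspace B" "B \<subseteq> A"
  shows "deg F A B = sum_mset (gr_mset F A B)"
  by (rule deg_eq_sum_mset) (simp add: count_gr_mset[OF assms])

text \<open>The steps are constant just to the right of \<open>x\<close>, so \<open>M\<close> has no
  entries there and the jump at \<open>x\<close> counts exactly the entries equal to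
  \<open>x\<close>. The constant \<open>m\<close> absorbs the dimension of \<open>B\<close>.\<close>

lemma gr_dim_from_steps:
  assumes F: "filtration F" and step: "\<And>x. dim (induced F A B x) = m + size (filter_mset (\<lambda>y. x \<le> y) M)"
  shows "gr_dim F A B x = count M x"
proof -
  obtain y where y: "x < y" "\<And>z. x < z \<Longrightarrow> z \<le> y \<Longrightarrow> F z = F y"
    using filtration_constant_right[OF F] by blast
  have same: "size (filter_mset (\<lambda>k. z \<le> k) M) = size (filter_mset (\<lambda>k. y \<le> k) M)"
    if "x < z" "z \<le> y" for z
  proof -
    have "induced F A B z = induced F A B y" using y(2)[OF that] by (simp add: induced_def)
    then show ?thesis using step[of z] step[of y] by simp
  qed
  have ge: "y \<le> z" if z: "z \<in># M" "x < z" for z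
  proof (rule ccontr)
    assume "\<not> y \<le> z"
    then have zy: "z < y" by simp
    have "filter_mset (\<lambda>k. y \<le> k) M + {#z#} \<subseteq># filter_mset (\<lambda>k. z \<le> k) M"
    proof (rule mset_subset_eqI)
      fix a
      show "count (filter_mset (\<lambda>k. y \<le> k) M + {#z#}) a \<le> count (filter_mset (\<lambda>k. z \<le> k) M) a"
        using zy z(1) by (auto simp: Suc_le_eq)
    qed
    from size_mset_mono[OF this] same[of z] z zy show False by simp
  qed
  have "filter_mset (\<lambda>k. x \<le> k) M = replicate_mset (count M x) x + filter_mset (\<lambda>k. y \<le> k) M"
  proof (rule multiset_eqI)
    fix a
    show "count (filter_mset (\<lambda>k. x \<le> k) M) a =
        count (replicate_mset (count M x) x + filter_mset (\<lambda>k. y \<le> k) M) a"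
      using ge[of a] y(1) by (cases "a \<in># M") (auto simp: not_in_iff)
  qed
  then have "size (filter_mset (\<lambda>k. x \<le> k) M) = count M x + size (filter_mset (\<lambda>k. y \<le> k) M)" by simp
  then show ?thesis using gr_dim_eq_diff[OF F y, of A B] step[of x] step[of y] by simp
qed

end

subsection \<open>From Harder--Narasimhan filtrations to partitions\<close>

definition slope_mset :: "(nat \<Rightarrow> int) \<Rightarrow> (nat \<Rightarrow> nat) \<Rightarrow> nat set \<Rightarrow> rat multiset"
  where "slope_mset r s I = (\<Sum>k\<in>I. replicate_mset (s k) (of_int (r k) / of_nat (s k)))"

lemma newton_part_eq: "newton_part r s I = decreasing_tuple (slope_mset r s I)"
  by (simp add: newton_part_def slope_mset_def)

lemma slope_mset_Un:
  "finite I \<Longrightarrow> finite I' \<Longrightarrow> I \<inter> I' = {} \<Longrightarrow> slope_mset r s (I \<union> I') = slope_mset r s I + slope_mset r s I'"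
  by (simp add: slope_mset_def sum.union_disjoint)

lemma size_slope_mset: "size (slope_mset r s I) = (\<Sum>k\<in>I. s k)"
  by (induction I rule: infinite_finite_induct) (auto simp: slope_mset_def)

lemma sum_slope_mset:
  "(\<And>k. k \<in> I \<Longrightarrow> s k > 0) \<Longrightarrow> sum_mset (slope_mset r s I) = of_int (\<Sum>k\<in>I. r k)"
  by (induction I rule: infinite_finite_induct) (auto simp: slope_mset_def)

lemma filter_slope_mset:
  "finite I \<Longrightarrow> filter_mset (\<lambda>x. x \<le> c) (slope_mset r s I) =
     slope_mset r s {k\<in>I. of_int (r k) / of_nat (s k) \<le> c}"
proof (induction I rule: finite_induct)
  case (insert k I)
  have "{j\<in>insert k I. of_int (r j) / of_nat (s j) \<le> c} =
      (if of_int (r k) / of_nat (s k) \<le> c then insert k {j\<in>I. of_int (r j) / of_nat (s j) \<le> c}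
       else {j\<in>I. of_int (r j) / of_nat (s j) \<le> c})" by auto
  moreover have "filter_mset (\<lambda>x. x \<le> c) (replicate_mset n y) = (if y \<le> c then replicate_mset n y else {#})"
    for n y by (induction n) auto
  ultimately show ?case using insert by (simp add: slope_mset_def)
qed (simp add: slope_mset_def)

text \<open>The tail form of domination, obtained by subtracting head sums from the totals;
  \<open>k = 0\<close> is included and gives an equality.\<close>

lemma dominates_drop:
  assumes "dominates a b" "k < length a"
  shows "sum_list (drop k a) - sum_list (drop k b)
     \<le> of_nat (length a - k) * ((sum_list a - sum_list b) / of_nat (length a))"
proof -
  define c where "c = (sum_list a - sum_list b) / of_nat (length a)"
  have c: "of_nat (length a) * c = sum_list a - sum_list b" using assms(2) by (auto simp: c_def)
  have sums: "sum_list a = sum_list (take k a) + sum_list (drop k a)"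
    "sum_list b = sum_list (take k b) + sum_list (drop k b)"
    by (metis append_take_drop_id sum_list_append)+
  have "sum_list (take k a) - sum_list (take k b) \<ge> of_nat k * c"
  proof (cases "k = 0")
    case False
    then have "k \<in> {1..<length a}" using assms(2) by simp
    then have "sum_list (take k a) - of_nat k * sum_list a / of_nat (length a) \<ge>
       sum_list (take k b) - of_nat k * sum_list b / of_nat (length b)"
      using assms(1) unfolding dominates_def by blast
    moreover have "length a = length b" using assms(1) by (simp add: dominates_def)
    ultimately show ?thesis by (simp add: c_def algebra_simps diff_divide_distrib)
  qed simp
  then have "sum_list (drop k a) - sum_list (drop k b) \<le> of_nat (length a - k) * c"
    using c sums assms(2) by (simp add: of_nat_diff algebra_simps)
  then show ?thesis by (simp add: c_def)
qed

context isocrystal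
begin

lemma slope_eq:
  assumes "filtration_of_type F d \<mu>" "decomp A B I r s U" and D: "dim (UNIV :: 'v set) = d"
  shows "slope F A B = (sum_list (decreasing_tuple (gr_mset F A B)) - sum_list (newton_part r s I))
     / of_nat (\<Sum>k\<in>I. s k)"
    and "length (decreasing_tuple (gr_mset F A B)) = (\<Sum>k\<in>I. s k)"
    and "t_N A B = sum_list (newton_part r s I)"
proof -
  note D = decompD[OF assms(2)]
  have dim: "dim A - dim B = (\<Sum>k\<in>I. s k)" using decomp_dim[OF assms(2)] by simp
  have "s k > 0" if "k \<in> I" for k by (rule simple_of_slopeD(7)[OF D(7)[OF that]])
  then show t: "t_N A B = sum_list (newton_part r s I)"
    unfolding newton_part_eq decreasing_tuple decomp_t_N[OF assms(2)] by (simp add: sum_slope_mset)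
  show "slope F A B = (sum_list (decreasing_tuple (gr_mset F A B)) - sum_list (newton_part r s I))
     / of_nat (\<Sum>k\<in>I. s k)"
    unfolding slope_def t dim deg_eq_gr_mset[OF assms(1) D(5,3,6)] decreasing_tuple ..
  show "length (decreasing_tuple (gr_mset F A B)) = (\<Sum>k\<in>I. s k)"
    unfolding decreasing_tuple size_gr_mset[OF assms(1,3) D(5,3,6)] dim ..
qed

text \<open>The test objects are the sums of all simple summands of slope at most the value after a
  break: their \<open>t_N\<close> is exactly a tail sum of the Newton tuple, while their degree is
  at least the corresponding Hodge tail.\<close>

lemma semistable_dominates:
  assumes F: "filtration_of_type F d \<mu>" and dim: "dim (UNIV :: 'v set) = d"
    and d: "decomp A B I r s U" and ss: "semistable F A B"
  shows "dominates (decreasing_tuple (gr_mset F A B)) (newton_part r s I)"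
proof -
  note D = decompD[OF d]
  define a where "a = decreasing_tuple (gr_mset F A B)"
  define b where "b = newton_part r s I"
  have b: "mset b = slope_mset r s I" "sorted_wrt (\<ge>) b" "length b = (\<Sum>k\<in>I. s k)"
    unfolding b_def newton_part_eq decreasing_tuple(1,3) by (simp_all add: decreasing_tuple size_slope_mset)
  have la: "length a = (\<Sum>k\<in>I. s k)" unfolding a_def by (rule slope_eq(2)[OF F d dim])
  have "dominates a b"
  proof (rule dominatesI_breaks)
    show "sorted_wrt (\<ge>) a" unfolding a_def by (rule decreasing_tuple)
    show "length a = length b" using la b by simp
    fix k assume k: "0 < k" "k < length b" "b ! k < b ! (k - 1)"
    define T where "T = {j\<in>I. of_int (r j) / of_nat (s j) \<le> b ! k}"
    define X where "X = span (B \<union> (\<Union>j\<in>T. U j))"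
    have TI: "T \<subseteq> I" by (auto simp: T_def)
    have dX: "decomp X B T r s U" unfolding X_def by (rule decomp_subset[OF d TI])
    note DX = decompD[OF dX]
    have "drop k b = filter (\<lambda>x. x \<le> b ! k) b" using filter_sorted_eq_drop[OF b(2) k] by simp
    then have mT: "mset (drop k b) = slope_mset r s T"
      unfolding T_def using filter_slope_mset[OF D(1)] b(1) by simp
    then have lenT: "length b - k = (\<Sum>j\<in>T. s j)"
      by (metis length_drop size_mset size_slope_mset)
    have XA: "X \<subseteq> A" unfolding X_def D(12)[symmetric] using TI by (intro span_mono) auto
    have dimX: "dim X = dim B + (length b - k)" using decomp_dim[OF dX] lenT by simp
    then have "B \<noteq> X" using k by auto
    then have "slope F X B \<le> slope F A B"
      using ss DX(4,6) XA unfolding semistable_def by blast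
    moreover have "slope F A B = (sum_list a - sum_list b) / of_nat (length b)"
      unfolding a_def b_def slope_eq(1)[OF F d dim] b(3)[unfolded b_def] ..
    moreover have "slope F X B = (sum_mset (gr_mset F X B) - sum_list (drop k b)) / of_nat (length b - k)"
    proof -
      have "sum_list (newton_part r s T) = sum_list (drop k b)"
        unfolding newton_part_eq decreasing_tuple mT[symmetric] by (rule sum_mset_sum_list)
      then show ?thesis using slope_eq(1)[OF F dX dim] lenT by (simp add: decreasing_tuple)
    qed
    moreover have "sum_list (drop k a) \<le> sum_mset (gr_mset F X B)"
    proof -
      have "gr_mset F X B \<subseteq># mset a"
        unfolding a_def decreasing_tuple using gr_mset_add[OF F D(5) DX(5) XA D(3) DX(6)] by simp
      moreover have "size (gr_mset F X B) = length b - k"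
        using size_gr_mset[OF F dim DX(5) D(3) DX(6)] dimX by simp
      ultimately show ?thesis
        using sum_list_drop_le_sum_mset[of a "gr_mset F X B"] k la b(3) by (simp add: a_def decreasing_tuple)
    qed
    ultimately have le: "(sum_list (drop k a) - sum_list (drop k b)) / of_nat (length b - k)
        \<le> (sum_list a - sum_list b) / of_nat (length b)"
      by (smt (verit) divide_right_mono diff_right_mono of_nat_0_le_iff order_trans)
    have "(0::rat) < of_nat (length b - k)" using k(2) by simp
    from le[unfolded pos_divide_le_eq[OF this]]
    show "sum_list (drop k a) - sum_list (drop k b)
        \<le> of_nat (length a - k) * ((sum_list a - sum_list b) / of_nat (length a))"
      unfolding la b(3) by (simp only: mult.commute)
  qed
  then show ?thesis by (simp add: a_def b_def)
qed

lemma decomp_empty: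
  assumes d: "decomp A A I r s U"
  shows "I = {}"
proof (rule ccontr)
  assume "I \<noteq> {}"
  then obtain k where "k \<in> I" by blast
  then show False
    using decompD(7,11)[OF d] by (meson simple_def simple_of_slopeD(1) leD)
qed

text \<open>\<open>decomp_split\<close> at \<open>H n\<close> gives the top layer its indices and
  leaves the others to the shorter chain.\<close>

lemma decomp_chain:
  fixes H :: "nat \<Rightarrow> 'v set"
  assumes "decomp (H n) (H 0) I r s U"
    and "\<And>i. i \<le> n \<Longrightarrow> subisocrystal (H i)" "\<And>i. i \<in> {1..n} \<Longrightarrow> H (i - 1) \<subseteq> H i"
  shows "\<exists>J. disjoint_family_on J {1..n} \<and> (\<Union>i\<in>{1..n}. J i) = I \<and>
           (\<forall>i\<in>{1..n}. \<exists>U. decomp (H i) (H (i - 1)) (J i) r s U)"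
  using assms
proof (induction n arbitrary: I U)
  case 0
  then show ?case using decomp_empty[OF 0(1)] by (auto simp: disjoint_family_on_def)
next
  case (Suc n)
  have "H 0 \<subseteq> H i" if "i \<le> n" for i
    using that
  proof (induction i)
    case (Suc i)
    then show ?case using Suc.prems \<open>\<And>i. i \<in> {1..Suc n} \<Longrightarrow> H (i - 1) \<subseteq> H i\<close>[of "Suc i"] by auto
  qed simp
  moreover have "H n \<subseteq> H (Suc n)" using Suc.prems(3)[of "Suc n"] by simp
  ultimately obtain T U1 U2 where T: "T \<subseteq> I" "decomp (H (Suc n)) (H n) T r s U1"
    "decomp (H n) (H 0) (I - T) r s U2"
    using decomp_split[OF Suc.prems(1), of "H n"] Suc.prems(2)[of n] by auto
  obtain J where J: "disjoint_family_on J {1..n}" "(\<Union>i\<in>{1..n}. J i) = I - T"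
    "\<forall>i\<in>{1..n}. \<exists>U. decomp (H i) (H (i - 1)) (J i) r s U"
    using Suc.IH[OF T(3)] Suc.prems(2,3) by auto
  define J' where "J' = J(Suc n := T)"
  have J'1: "J' (Suc n) = T" and J'2: "\<And>i. i \<in> {1..n} \<Longrightarrow> J' i = J i" by (auto simp: J'_def)
  have ins: "{1..Suc n} = insert (Suc n) {1..n}" by auto
  have "(\<Union>i\<in>{1..n}. J' i) = I - T" using J(2) J'2 by (metis (no_types, lifting) SUP_cong)
  then have un: "(\<Union>i\<in>{1..Suc n}. J' i) = I"
    unfolding ins UN_insert J'1 using T(1) by blast
  have "disjoint_family_on J' {1..n}"
    using J(1) J'2 unfolding disjoint_family_on_def by metis
  then have "disjoint_family_on J' {1..Suc n}"
    unfolding ins using J'1 \<open>(\<Union>i\<in>{1..n}. J' i) = I - T\<close>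
    by (subst disjoint_family_on_insert) auto
  moreover have "\<forall>i\<in>{1..Suc n}. \<exists>U. decomp (H i) (H (i - 1)) (J' i) r s U"
    unfolding ins using J(3) J'1 J'2 T(2) by auto
  ultimately show ?case using un by blast
qed

text \<open>Layer \<open>i\<close> yields \<open>I i\<close> through its simple summands and
  \<open>J i\<close> through its Hodge weights.\<close>

lemma HN_vector_imp_partition:
  assumes dim: "dim (UNIV :: 'v set) = d"
    and newton: "has_newton_slopes UNIV {0} l r s"
    and lam: "strict_antimono_on {1..n} lam" and ds: "\<And>i. i \<in> {1..n} \<Longrightarrow> ds i \<ge> 1"
    and F: "filtration_of_type F d \<mu>"
    and HN: "is_HN_vector F (concat (map (\<lambda>i. replicate (ds i) (lam i)) [1..<Suc n]))"
  shows "\<exists>I J. is_partition {1..l} n I \<and> is_partition {1..d} n J \<and>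
           (\<forall>i\<in>{1..n}. card (J i) = ds i \<and> ds i = (\<Sum>k\<in>I i. s k) \<and>
              dominates (hodge_part \<mu> (J i)) (newton_part r s (I i)) \<and>
              lam i * of_nat (ds i) = sum_list (hodge_part \<mu> (J i)) - sum_list (newton_part r s (I i)))"
proof -
  obtain n' H where H: "is_HN_filtration F n' H"
    and eq: "concat (map (\<lambda>i. replicate (ds i) (lam i)) [1..<Suc n]) =
      concat (map (\<lambda>i. replicate (dim (H i) - dim (H (i - 1))) (slope F (H i) (H (i - 1)))) [1..<Suc n'])"
    using HN unfolding is_HN_vector_def by blast
  have H0: "H 0 = {0}" "H n' = UNIV" and sub: "\<And>i. i \<le> n' \<Longrightarrow> subisocrystal (H i)"
    and step: "\<And>i. i \<in> {1..n'} \<Longrightarrow> H (i - 1) \<subset> H i" "\<And>i. i \<in> {1..n'} \<Longrightarrow> semistable F (H i) (H (i - 1))"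
    and mono: "strict_antimono_on {1..n'} (\<lambda>i. slope F (H i) (H (i - 1)))"
    using H by (auto simp: is_HN_filtration_def)
  have subsp: "subspace (H i)" if "i \<le> n'" for i using sub[OF that] by (rule subisocrystal_subspace)
  have dimpos: "dim (H i) - dim (H (i - 1)) > 0" if i: "i \<in> {1..n'}" for i
  proof -
    have "span (H (i - 1)) \<subset> span (H i)"
      using step(1)[OF i] span_eq_iff[THEN iffD2, OF subsp[of i]]
        span_eq_iff[THEN iffD2, OF subsp[of "i - 1"]] i by fastforce
    then show ?thesis using dim_psubset by simp
  qed
  have dspos: "ds i > 0" if "i \<in> {1..n}" for i using ds[OF that] by simp
  \<comment> \<open>Positive multiplicities and strictly decreasing values let the list determine
    the layers.\<close>
  have n: "n = n'"
    by (rule concat_replicate_upt_inject(1)[OF eq dspos dimpos lam mono])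
  have dsi: "ds i = dim (H i) - dim (H (i - 1)) \<and> lam i = slope F (H i) (H (i - 1))" if "i \<in> {1..n}" for i
    by (rule concat_replicate_upt_inject(2)[OF eq dspos dimpos lam mono that])
  obtain U where U: "decomp UNIV {0} {1..l} r s U"
    using newton unfolding has_newton_slopes_decomp[OF subisocrystal_zero] by blast
  have "decomp (H n) (H 0) {1..l} r s U" using U H0 n by simp
  then have "\<exists>I. disjoint_family_on I {1..n} \<and> (\<Union>i\<in>{1..n}. I i) = {1..l} \<and>
      (\<forall>i\<in>{1..n}. \<exists>U. decomp (H i) (H (i - 1)) (I i) r s U)"
    by (rule decomp_chain) (use sub step(1) n in auto)
  then obtain I where I: "disjoint_family_on I {1..n}" "(\<Union>i\<in>{1..n}. I i) = {1..l}"
    "\<forall>i\<in>{1..n}. \<exists>U. decomp (H i) (H (i - 1)) (I i) r s U"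
    by (elim exE conjE)
  let ?M = "\<lambda>i. gr_mset F (H i) (H (i - 1))"
  \<comment> \<open>The weights add up along the chain, so that
    \<open>partition_by_image_mset\<close> can distribute the indices of
    \<open>\<mu>\<close>.\<close>
  have "gr_mset F (H m) (H 0) = (\<Sum>i=1..m. ?M i)" if "m \<le> n" for m
    using that
  proof (induction m)
    case 0
    have "size (gr_mset F (H 0) (H 0)) = 0"
      using size_gr_mset[OF F dim subsp subsp, of 0 0] by simp
    then show ?case by simp
  next
    case (Suc m)
    have "{0} \<subseteq> H m" using subspace_0[OF subsp[of m]] Suc.prems n by simp
    moreover have "H m \<subseteq> H (Suc m)" using step(1)[of "Suc m"] Suc.prems n by auto
    ultimately have "gr_mset F (H (Suc m)) (H 0) = gr_mset F (H (Suc m)) (H m) + gr_mset F (H m) (H 0)"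
      using gr_mset_add[OF F subsp subsp _ subsp, of "Suc m" m 0] Suc.prems n H0(1) by simp
    then show ?case using Suc by (simp add: add.commute)
  qed
  from this[of n] have "image_mset \<mu> (mset_set {1..d}) = (\<Sum>i=1..n. ?M i)"
    using gr_mset_UNIV[OF F] H0 n by simp
  then obtain J where J: "disjoint_family_on J {1..n}" "(\<Union>i\<in>{1..n}. J i) = {1..d}"
    "\<forall>i\<in>{1..n}. image_mset \<mu> (mset_set (J i)) = ?M i"
    using partition_by_image_mset[of "{1..d}" \<mu> ?M n] by auto
  have hodge: "hodge_part \<mu> (J i) = decreasing_tuple (?M i)" if "i \<in> {1..n}" for i
    using J(3) that by (simp add: hodge_part_def)
  have main: "card (J i) = ds i \<and> ds i = (\<Sum>k\<in>I i. s k) \<and>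
              dominates (hodge_part \<mu> (J i)) (newton_part r s (I i)) \<and>
              lam i * of_nat (ds i) = sum_list (hodge_part \<mu> (J i)) - sum_list (newton_part r s (I i))"
    if i: "i \<in> {1..n}" for i
  proof -
    obtain U' where U': "decomp (H i) (H (i - 1)) (I i) r s U'" using bspec[OF I(3) i] by blast
    note D = decompD[OF U']
    have 1: "ds i = (\<Sum>k\<in>I i. s k)" using dsi[OF i] decomp_dim[OF U'] by simp
    have "card (J i) = size (?M i)"
      using J(3) i by (metis size_image_mset size_mset_set)
    also have "\<dots> = ds i" using size_gr_mset[OF F dim D(5,3,6)] dsi[OF i] by simp
    finally have 2: "card (J i) = ds i" .
    have 3: "dominates (hodge_part \<mu> (J i)) (newton_part r s (I i))"
      unfolding hodge[OF i] using semistable_dominates[OF F dim U'] step(2) i n by blast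
    have "lam i = (sum_list (hodge_part \<mu> (J i)) - sum_list (newton_part r s (I i))) / of_nat (ds i)"
      unfolding conjunct2[OF dsi[OF i]] slope_eq(1)[OF F U' dim] hodge[OF i] 1 ..
    then have "lam i * of_nat (ds i) = sum_list (hodge_part \<mu> (J i)) - sum_list (newton_part r s (I i))"
      using dspos[OF i] by simp
    then show ?thesis using 1 2 3 by blast
  qed
  have "I i \<noteq> {}" "J i \<noteq> {}" if "i \<in> {1..n}" for i
    using main[OF that] dspos[OF that] by auto
  then have "is_partition {1..l} n I" "is_partition {1..d} n J"
    using I(1,2) J(1,2) by (auto simp: is_partition_def)
  then show ?thesis using main by blast
qed

end

subsection \<open>From partitions to Harder--Narasimhan filtrations\<close>

context isocrystal
begin

lemma indep_mod_if_card_eq_dim: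
  assumes "finite Z" "span (b ` Z) = UNIV" "card Z = dim (UNIV :: 'v set)"
  shows "indep_mod scale {0} Z b"
proof -
  obtain Z0 where Z0: "Z0 \<subseteq> Z" "indep_mod scale {0} Z0 b" "span ({0} \<union> b ` Z0) = span ({0} \<union> b ` Z)"
    using exists_indep_mod_subset[OF assms(1) subspace_single_0] by blast
  have "finite Z0" using Z0(1) assms(1) by (rule finite_subset)
  then have "dim (span ({0} \<union> b ` Z0)) = dim {0 :: 'v} + card Z0"
    by (rule dim_span_Un_image[OF _ subspace_single_0 Z0(2)])
  moreover have "span ({0} \<union> b ` Z0) = UNIV" unfolding Z0(3) using assms(2) by simp
  moreover have "dim {0 :: 'v} = 0" by simp
  ultimately have "card Z0 = card Z" using assms(3) by (metis add_0)
  then have "Z0 = Z" using card_subset_eq[OF assms(1) Z0(1)] by simp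
  then show ?thesis using Z0(2) by simp
qed

text \<open>
  The iterates \<open>\<Phi>\<^sup>j (v i)\<close> of cyclic vectors \<open>v i\<close> of the layers form a basis of the whole space.
  Filtering by its weights puts every step in general position to all subisocrystals of the layers.
\<close>

lemma partition_imp_HN_vector:
  assumes dim: "dim (UNIV :: 'v set) = d"
    and newton: "has_newton_slopes UNIV {0} l r s"
    and lam: "strict_antimono_on {1..n} lam" and ds: "\<And>i. i \<in> {1..n} \<Longrightarrow> ds i \<ge> 1"
    and d: "(\<Sum>i=1..n. ds i) = d"
    and I: "is_partition {1..l} n I" and J: "is_partition {1..d} n J"
    and cardJ: "\<And>i. i \<in> {1..n} \<Longrightarrow> card (J i) = ds i"
    and dsI: "\<And>i. i \<in> {1..n} \<Longrightarrow> ds i = (\<Sum>k\<in>I i. s k)"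
    and dom: "\<And>i. i \<in> {1..n} \<Longrightarrow> dominates (hodge_part \<mu> (J i)) (newton_part r s (I i))"
    and lam_eq: "\<And>i. i \<in> {1..n} \<Longrightarrow>
      lam i * of_nat (ds i) = sum_list (hodge_part \<mu> (J i)) - sum_list (newton_part r s (I i))"
  shows "\<exists>F. filtration_of_type F d \<mu> \<and>
           is_HN_vector F (concat (map (\<lambda>i. replicate (ds i) (lam i)) [1..<Suc n]))"
proof -
  obtain U where U: "decomp UNIV {0} {1..l} r s U"
    using newton unfolding has_newton_slopes_decomp[OF subisocrystal_zero] by blast
  \<comment> \<open>The candidate filtration sums the simple summands of the first \<open>i\<close>
    blocks, so that layer \<open>i\<close> has index set \<open>I i\<close>.\<close>
  define P where "P i = (\<Union>j\<in>{1..i}. I j)" for i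
  define H where "H i = span ({0} \<union> (\<Union>k\<in>P i. U k))" for i
  have Pl: "P i \<subseteq> {1..l}" if "i \<le> n" for i
    using I that unfolding P_def is_partition_def by fastforce
  have H_sub: "subisocrystal (H i)" if "i \<le> n" for i
    unfolding H_def by (rule decompD(4)[OF decomp_subset[OF U Pl[OF that]]])
  have subH: "subspace (H i)" for i by (simp add: H_def)
  have H0: "H 0 = {0}" by (simp add: H_def P_def)
  have "P n = {1..l}" using I by (auto simp: P_def is_partition_def)
  then have Hn: "H n = UNIV" using decompD(12)[OF U] by (simp add: H_def)
  have H_layer: "\<exists>U. decomp (H i) (H (i - 1)) (I i) r s U" if i: "i \<in> {1..n}" for i
  proof -
    have ins: "{1..i} = insert i {1..i - 1}" using i by auto
    have P: "P i = P (i - 1) \<union> I i" unfolding P_def ins by auto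
    have "I j \<inter> I i = {}" if "j \<in> {1..i - 1}" for j
    proof -
      have "disjoint_family_on I {1..n}" using I by (simp add: is_partition_def)
      moreover have "j \<in> {1..n}" "j \<noteq> i" using that i by auto
      ultimately show ?thesis using i by (intro disjoint_family_onD)
    qed
    then have "P (i - 1) \<inter> I i = {}" unfolding P_def by blast
    moreover have "P (i - 1) \<subseteq> {1..l}" "I i \<subseteq> {1..l}" using Pl[of i] i unfolding P by auto
    ultimately show ?thesis
      using decomp_layer[OF U, of "P (i - 1)" "I i"] unfolding H_def P by blast
  qed
  have dimH: "dim (H i) = dim (H (i - 1)) + ds i" if i: "i \<in> {1..n}" for i
    using H_layer[OF i] decomp_dim dsI[OF i] by metis
  have H_le: "H (i - 1) \<subseteq> H i" if i: "i \<in> {1..n}" for i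
    using H_layer[OF i] decompD(6) by blast
  have "\<forall>i\<in>{1..n}. \<exists>v. v \<in> H i \<and>
      (\<forall>X. subisocrystal X \<longrightarrow> H (i - 1) \<subseteq> X \<longrightarrow> X \<subseteq> H i \<longrightarrow> v \<in> X \<longrightarrow> X = H i)"
    using H_layer exists_cyclic_vector by meson
  from bchoice[OF this] obtain v where v0: "\<forall>i\<in>{1..n}. v i \<in> H i \<and>
      (\<forall>X. subisocrystal X \<longrightarrow> H (i - 1) \<subseteq> X \<longrightarrow> X \<subseteq> H i \<longrightarrow> v i \<in> X \<longrightarrow> X = H i)"
    by (rule exE)
  have v: "\<And>i. i \<in> {1..n} \<Longrightarrow> v i \<in> H i"
    "\<And>i X. i \<in> {1..n} \<Longrightarrow> subisocrystal X \<Longrightarrow> H (i - 1) \<subseteq> X \<Longrightarrow> X \<subseteq> H i \<Longrightarrow> v i \<in> X \<Longrightarrow> X = H i"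
    using v0 by simp_all
  define hs where "hs i = hodge_part \<mu> (J i)" for i
  define ns where "ns i = newton_part r s (I i)" for i
  have hs: "sorted_wrt (\<ge>) (hs i)" "mset (hs i) = image_mset \<mu> (mset_set (J i))" for i
    by (simp_all add: hs_def hodge_part_def decreasing_tuple)
  have len_hs: "length (hs i) = ds i" if "i \<in> {1..n}" for i
    using cardJ[OF that] by (simp add: hs_def hodge_part_def decreasing_tuple)
  define Z where "Z m = Sigma {1..m} (\<lambda>i. {..<ds i})" for m
  define b where "b = (\<lambda>(i, j). Phi_pow j (v i))"
  \<comment> \<open>The iterates of \<open>v i\<close> receive the weights of \<open>J i\<close> in
    decreasing order. Large weights thus sit on early iterates, and every step of \<open>F\<close>
    induces on the layer a term of the flag of \<open>v i\<close>.\<close>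
  define w where "w = (\<lambda>(i, j). hs i ! j)"
  define F where "F x = span (b ` {z\<in>Z n. x \<le> w z})" for x
  define G where "G i m = span (H (i - 1) \<union> (\<lambda>j. Phi_pow j (v i)) ` {..<m})" for i m
  have finZ: "finite (Z m)" for m by (simp add: Z_def)
  have cyc: "dim (span (X \<union> (\<lambda>j. Phi_pow j (v i)) ` {..<m})) = min (dim X + m) (dim (H i))"
    if i: "i \<in> {1..n}" and X: "subisocrystal X" "H (i - 1) \<subseteq> X" "X \<subseteq> H i" for i X m
    using cyclic_vector_dim[OF v(1)[OF i] v(2)[OF i] _ X] H_sub[of i] i by auto
  have GH: "G i m \<subseteq> H i" if i: "i \<in> {1..n}" for i m
    unfolding G_def using H_le[OF i] v(1)[OF i] i H_sub[of i]
    by (intro span_minimal subH) (auto simp: Phi_pow_mem_iff)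
  have dimG: "dim (G i m) = min (dim (H (i - 1)) + m) (dim (H i))" if i: "i \<in> {1..n}" for i m
    unfolding G_def using cyc[OF i H_sub[of "i - 1"]] H_le[OF i] i by auto
  have spanH: "span (b ` Z m) = H m" if "m \<le> n" for m
    using that
  proof (induction m)
    case 0
    then show ?case by (simp add: Z_def H0)
  next
    case (Suc m)
    have i: "Suc m \<in> {1..n}" using Suc.prems by simp
    have "{1..Suc m} = insert (Suc m) {1..m}" by auto
    then have "b ` Z (Suc m) = b ` Z m \<union> (\<lambda>j. Phi_pow j (v (Suc m))) ` {..<ds (Suc m)}"
      by (auto simp: Z_def b_def image_Un)
    then have "span (b ` Z (Suc m)) = span (span (b ` Z m) \<union> (\<lambda>j. Phi_pow j (v (Suc m))) ` {..<ds (Suc m)})"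
      by (simp only: span_Un span_span)
    then have "span (b ` Z (Suc m)) = G (Suc m) (ds (Suc m))"
      using Suc by (simp add: G_def)
    moreover have "G (Suc m) (ds (Suc m)) = H (Suc m)"
      using dimG[OF i, of "ds (Suc m)"] dimH[OF i]
      by (intro subspace_dim_equal[OF _ subH GH[OF i]]) (simp_all add: G_def)
    ultimately show ?case by simp
  qed
  \<comment> \<open>The spanning family has as many members as the dimension, so it is a
    basis.\<close>
  have cardZ: "card (Z n) = dim (UNIV :: 'v set)" unfolding dim using d by (simp add: Z_def)
  have indep: "indep_mod scale {0} (Z n) b"
    by (rule indep_mod_if_card_eq_dim[OF finZ _ cardZ]) (use spanH[of n] Hn in simp)
  have subF: "subspace (F x)" for x by (simp add: F_def)
  have filF: "filtration F"
    unfolding filtration_def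
  proof (intro conjI allI)
    show "subspace (F x)" for x by (rule subF)
    show "antimono F" unfolding F_def by (intro antimonoI span_mono image_mono) auto
    obtain x0 where x0: "\<forall>z\<in>Z n. x0 \<le> w z"
    proof
      show "\<forall>z\<in>Z n. Min (w ` Z n) \<le> w z" using finZ by auto
    qed
    then have "{z\<in>Z n. x0 \<le> w z} = Z n" by blast
    then have "F x0 = UNIV" using spanH[of n] Hn by (simp add: F_def)
    then show "(\<Union>x. F x) = UNIV" by blast
    obtain x1 where x1: "\<forall>z\<in>Z n. w z < x1"
    proof
      show "\<forall>z\<in>Z n. w z < Max (w ` Z n) + 1"
      proof
        fix z assume "z \<in> Z n"
        then have "w z \<le> Max (w ` Z n)" using finZ by (intro Max_ge) auto
        then show "w z < Max (w ` Z n) + 1" by linarith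
      qed
    qed
    then have none: "{z\<in>Z n. x1 \<le> w z} = {}" by fastforce
    have "F x1 = {0}" unfolding F_def none by simp
    then show "(\<Inter>x. F x) = {0}" using subspace_0[OF subF] by fastforce
  qed
  have typeF: "filtration_of_type F d \<mu>"
  proof -
    have steps: "dim (induced F UNIV {0} x) = 0 + size (filter_mset (\<lambda>y. x \<le> y) (image_mset w (mset_set (Z n))))" for x
    proof -
      have "induced F UNIV {0} x = F x"
        using induced_eq[of F x UNIV "{0}", OF subF subspace_UNIV subspace_single_0]
          span_eq_iff[THEN iffD2, OF subF[of x]] by simp
      moreover have "indep_mod scale {0} {z\<in>Z n. x \<le> w z} b"
        by (rule indep_mod_subset[OF indep finZ]) auto
      then have "dim (span ({0} \<union> b ` {z\<in>Z n. x \<le> w z})) = dim {0 :: 'v} + card {z\<in>Z n. x \<le> w z}"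
        using finZ by (intro dim_span_Un_image subspace_single_0) auto
      ultimately have "dim (induced F UNIV {0} x) = card {z\<in>Z n. x \<le> w z}"
        by (simp add: F_def)
      moreover have "filter_mset (\<lambda>y. x \<le> y) (image_mset w (mset_set (Z n))) =
          image_mset w (mset_set {z\<in>Z n. x \<le> w z})"
        using finZ by (simp add: filter_mset_image_mset comp_def)
      ultimately show ?thesis by simp
    qed
    have "image_mset w (mset_set (Z m)) = image_mset \<mu> (mset_set (\<Union>i\<in>{1..m}. J i))" if "m \<le> n" for m
      using that
    proof (induction m)
      case 0
      then show ?case by (simp add: Z_def)
    next
      case (Suc m)
      have ins: "{1..Suc m} = insert (Suc m) {1..m}" by auto
      have fin: "finite (J i)" if "i \<in> {1..n}" for i
      proof -
        have "J i \<subseteq> {1..d}" using J that by (auto simp: is_partition_def)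
        then show ?thesis by (rule finite_subset) simp
      qed
      have "Z (Suc m) = Z m \<union> Pair (Suc m) ` {..<ds (Suc m)}" unfolding Z_def ins by auto
      moreover have "Z m \<inter> Pair (Suc m) ` {..<ds (Suc m)} = {}" by (auto simp: Z_def)
      ultimately have "mset_set (Z (Suc m)) = mset_set (Z m) + mset_set (Pair (Suc m) ` {..<ds (Suc m)})"
        using finZ by (simp add: mset_set_Union)
      also have "mset_set (Pair (Suc m) ` {..<ds (Suc m)}) = image_mset (Pair (Suc m)) (mset_set {..<ds (Suc m)})"
        by (intro image_mset_mset_set[symmetric]) (auto intro: inj_onI)
      finally have "image_mset w (mset_set (Z (Suc m))) = image_mset w (mset_set (Z m)) +
          image_mset (\<lambda>j. hs (Suc m) ! j) (mset_set {..<ds (Suc m)})"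
        by (simp add: image_mset.compositionality comp_def w_def)
      also have "image_mset (\<lambda>j. hs (Suc m) ! j) (mset_set {..<ds (Suc m)}) = mset (hs (Suc m))"
      proof -
        have "mset (hs (Suc m)) = mset (map (\<lambda>j. hs (Suc m) ! j) [0..<ds (Suc m)])"
          using len_hs[of "Suc m"] Suc.prems by (simp add: map_nth del: upt_Suc flip: len_hs)
        then show ?thesis by (simp add: lessThan_atLeast0)
      qed
      also have "\<dots> = image_mset \<mu> (mset_set (J (Suc m)))" by (rule hs)
      also have "image_mset w (mset_set (Z m)) = image_mset \<mu> (mset_set (\<Union>i\<in>{1..m}. J i))"
        using Suc by simp
      also have "\<dots> + image_mset \<mu> (mset_set (J (Suc m))) =
          image_mset \<mu> (mset_set ((\<Union>i\<in>{1..m}. J i) \<union> J (Suc m)))"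
      proof -
        have "J i \<inter> J (Suc m) = {}" if "i \<in> {1..m}" for i
        proof -
          have "disjoint_family_on J {1..n}" using J by (simp add: is_partition_def)
          moreover have "i \<in> {1..n}" "Suc m \<in> {1..n}" "i \<noteq> Suc m" using that Suc.prems by auto
          ultimately show ?thesis by (intro disjoint_family_onD)
        qed
        then have "(\<Union>i\<in>{1..m}. J i) \<inter> J (Suc m) = {}" by blast
        then show ?thesis using fin Suc.prems by (subst mset_set_Union) auto
      qed
      also have "(\<Union>i\<in>{1..m}. J i) \<union> J (Suc m) = (\<Union>i\<in>{1..Suc m}. J i)"
        unfolding ins UN_insert by blast
      finally show ?case .
    qed
    from this[of n] have "image_mset w (mset_set (Z n)) = image_mset \<mu> (mset_set {1..d})"
      using J by (simp add: is_partition_def)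
    then have "gr_dim F UNIV {0} x = count (image_mset \<mu> (mset_set {1..d})) x" for x
      using gr_dim_from_steps[OF filF steps, of x] by simp
    then show ?thesis using filF by (simp add: filtration_of_type_def count_image_mset_set)
  qed
  \<comment> \<open>General position: \<open>X\<close> loses the largest weights of the layer, as
    many as its codimension \<open>?q\<close>, and keeps the others. This is the least sum that
    \<open>dim X - dim (H (i - 1))\<close> weights from \<open>hs i\<close> can have.\<close>
  have gr_layer: "gr_mset F X (H (i - 1)) = mset (drop (dim (H i) - dim X) (hs i))"
    if i: "i \<in> {1..n}" and X: "subisocrystal X" "H (i - 1) \<subseteq> X" "X \<subseteq> H i" for i X
  proof -
    note subX = subisocrystal_subspace[OF X(1)]
    let ?B = "H (i - 1)" and ?q = "dim (H i) - dim X"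
    have "dim (induced F X ?B x) = dim ?B + size (filter_mset (\<lambda>y. x \<le> y) (mset (drop ?q (hs i))))" for x
    proof -
      \<comment> \<open>Since the weights decrease, the iterates of \<open>v i\<close> among the
        generators of \<open>F x\<close> are those with index below \<open>m\<close>.\<close>
      define m where "m = length (filter (\<lambda>y. x \<le> y) (hs i))"
      have m: "m \<le> ds i" unfolding m_def using length_filter_le[of "\<lambda>y. x \<le> y" "hs i"] len_hs[OF i] by simp
      have wm: "x \<le> hs i ! j \<longleftrightarrow> j < m" if "j < ds i" for j
        unfolding m_def using nth_ge_iff_less_length_filter[OF hs(1)] len_hs[OF i] that by simp
      have i': "i \<le> n" "i - 1 \<le> n" using i by auto
      have gens: "Phi_pow j (v i) \<in> F x" if "j < m" for j
      proof -
        have "(i, j) \<in> {z\<in>Z n. x \<le> w z}" using that m wm i by (auto simp: Z_def w_def)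
        then have "b (i, j) \<in> F x" unfolding F_def by (intro span_base imageI)
        then show ?thesis by (simp add: b_def)
      qed
      have "induced F X ?B x = G i m \<inter> X"
      proof
        \<comment> \<open>\<open>F x\<close> and \<open>H i\<close> are spanned by parts of one
          basis, hence so is their intersection; its members from earlier layers are absorbed by
          \<open>H (i - 1)\<close>.\<close>
        have "F x \<inter> H i \<subseteq> G i m"
        proof -
          have ZZ: "Z i \<subseteq> Z n" using i by (auto simp: Z_def)
          have "F x \<inter> H i = span (b ` {z\<in>Z n. x \<le> w z}) \<inter> span (b ` Z i)"
            using spanH[OF i'(1)] by (simp add: F_def)
          also have "\<dots> = span (b ` ({z\<in>Z n. x \<le> w z} \<inter> Z i))"
            by (rule indep_mod_span_Int[OF indep finZ _ ZZ]) auto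
          also have "\<dots> \<subseteq> G i m"
          proof (rule span_minimal)
            show "subspace (G i m)" by (simp add: G_def)
            show "b ` ({z\<in>Z n. x \<le> w z} \<inter> Z i) \<subseteq> G i m"
            proof
              fix y assume "y \<in> b ` ({z\<in>Z n. x \<le> w z} \<inter> Z i)"
              then obtain i1 j where ij: "y = b (i1, j)" "i1 \<in> {1..i}" "j < ds i1" "x \<le> hs i1 ! j"
                by (auto simp: Z_def w_def)
              show "y \<in> G i m"
              proof (cases "i1 = i")
                case True
                then have "j < m" using wm ij by simp
                then show ?thesis using ij True by (auto simp: G_def b_def intro!: span_base)
              next
                case False
                then have "(i1, j) \<in> Z (i - 1)" using ij by (auto simp: Z_def)
                then have "y \<in> span (b ` Z (i - 1))" using ij(1) by (auto intro: span_base)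
                then have "y \<in> H (i - 1)" using spanH[OF i'(2)] by simp
                then show ?thesis by (auto simp: G_def intro!: span_base)
              qed
            qed
          qed
          finally show ?thesis .
        qed
        moreover have "?B \<subseteq> G i m" unfolding G_def by (rule subset_span_Un)
        ultimately have "(F x \<inter> X) \<union> ?B \<subseteq> G i m \<inter> X" using X by blast
        moreover have "subspace (G i m \<inter> X)" by (intro subspace_inter subX) (simp add: G_def)
        ultimately show "induced F X ?B x \<subseteq> G i m \<inter> X"
          unfolding induced_eq[of F x X ?B, OF subF subX subH] by (rule span_minimal)
        show "G i m \<inter> X \<subseteq> induced F X ?B x"
        proof
          fix y assume y: "y \<in> G i m \<inter> X"
          then have "y \<in> span (?B \<union> (\<lambda>j. Phi_pow j (v i)) ` {..<m})" by (simp add: G_def)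
          then obtain c where c: "y - (\<Sum>j<m. c j *s Phi_pow j (v i)) \<in> ?B"
            unfolding mem_span_Un_image[OF subH finite_lessThan] by (rule exE)
          let ?g = "\<Sum>j<m. c j *s Phi_pow j (v i)"
          have "?g \<in> F x" using gens by (intro subspace_sum[OF subF] subspace_scale[OF subF]) auto
          moreover have "y - (y - ?g) \<in> X"
            by (rule subspace_diff[OF subX]) (use y c X(2) in blast)+
          then have "?g \<in> X" by simp
          moreover have "y = ?g + (y - ?g)" by simp
          ultimately show "y \<in> induced F X ?B x" unfolding induced_def using c by blast
        qed
      qed
      moreover have "span (G i m \<union> X) = span (X \<union> (\<lambda>j. Phi_pow j (v i)) ` {..<m})"
      proof (rule span_eq[THEN iffD2], intro conjI Un_least)
        show "G i m \<subseteq> span (X \<union> (\<lambda>j. Phi_pow j (v i)) ` {..<m})"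
          unfolding G_def using X(2) by (intro span_mono) auto
        show "X \<subseteq> span (X \<union> (\<lambda>j. Phi_pow j (v i)) ` {..<m})" "X \<subseteq> span (G i m \<union> X)"
          by (rule subset_span_Un)+
        have "(\<lambda>j. Phi_pow j (v i)) ` {..<m} \<subseteq> G i m" unfolding G_def by (rule subset_span_Un)
        then show "(\<lambda>j. Phi_pow j (v i)) ` {..<m} \<subseteq> span (G i m \<union> X)"
          using subset_span_Un(1)[of "G i m" X] by blast
      qed
      ultimately have "dim (induced F X ?B x) + min (dim X + m) (dim (H i)) =
          min (dim ?B + m) (dim (H i)) + dim X"
        using dim_span_Un_Int[of "G i m" X] cyc[OF i X, of m] dimG[OF i, of m] subX
        by (simp add: G_def)
      moreover have "dim ?B \<le> dim X" "dim X \<le> dim (H i)" using X by (auto intro: dim_subset)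
      \<comment> \<open>The sum of \<open>G i m\<close> and \<open>X\<close> has dimension
        \<open>min (dim X + m) (dim (H i))\<close>, so their intersection exceeds \<open>?B\<close>
        by \<open>m - ?q\<close>, truncated at 0.\<close>
      ultimately have "dim (induced F X ?B x) = dim ?B + (m - ?q)"
        using m dimH[OF i] by (simp add: min_def split: if_splits)
      moreover have "size (filter_mset (\<lambda>y. x \<le> y) (mset (drop ?q (hs i)))) = m - ?q"
        unfolding m_def length_filter_ge_drop[OF hs(1), of x ?q i, symmetric]
        by (metis mset_filter size_mset)
      ultimately show ?thesis by simp
    qed
    from gr_dim_from_steps[OF filF this] show ?thesis
      by (intro multiset_eqI) (simp only: count_gr_mset[OF typeF subX subH X(2)])
  qed
  have slopeH: "slope F (H i) (H (i - 1)) = lam i" if i: "i \<in> {1..n}" for i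
  proof -
    obtain U' where U': "decomp (H i) (H (i - 1)) (I i) r s U'" using H_layer[OF i] by blast
    have "gr_mset F (H i) (H (i - 1)) = mset (hs i)"
      using gr_layer[OF i H_sub[of i]] H_le[OF i] i by simp
    then have "slope F (H i) (H (i - 1)) = (sum_list (hs i) - sum_list (ns i)) / of_nat (ds i)"
      using slope_eq(1)[OF typeF U' dim] dsI[OF i] by (simp add: decreasing_tuple sum_mset_sum_list ns_def)
    also have "\<dots> = lam i" using lam_eq[OF i] ds[OF i] by (simp add: hs_def ns_def flip: lam_eq[OF i])
    finally show ?thesis .
  qed
  have ss: "semistable F (H i) (H (i - 1))" if i: "i \<in> {1..n}" for i
    unfolding semistable_def
  proof (intro allI impI)
    fix X assume X': "subisocrystal X \<and> H (i - 1) \<subset> X \<and> X \<subseteq> H i"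
    then have X: "subisocrystal X" "H (i - 1) \<subseteq> X" "X \<subseteq> H i" by auto
    note subX = subisocrystal_subspace[OF X(1)]
    obtain U' where U': "decomp (H i) (H (i - 1)) (I i) r s U'" using H_layer[OF i] by blast
    \<comment> \<open>The slopes of \<open>X\<close> modulo \<open>H (i - 1)\<close> are those of
      \<open>I i - T\<close>, a part of the slopes of the layer; so their sum is at least that of
      the last \<open>e\<close> entries of \<open>ns i\<close>.\<close>
    obtain T U1 U2 where T: "T \<subseteq> I i" "decomp (H i) X T r s U1" "decomp X (H (i - 1)) (I i - T) r s U2"
      using decomp_split[OF U' X] by blast
    define q where "q = dim (H i) - dim X"
    define e where "e = dim X - dim (H (i - 1))"
    have "span (H (i - 1)) \<subset> span X"
      using X' unfolding span_eq_iff[THEN iffD2, OF subH[of "i - 1"]] span_eq_iff[THEN iffD2, OF subX]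
      by blast
    then have "dim (H (i - 1)) < dim X" by (rule dim_psubset)
    moreover have "dim X \<le> dim (H i)" using X(3) by (rule dim_subset)
    ultimately have e: "0 < e" "q + e = ds i" "q < ds i" using dimH[OF i] by (auto simp: e_def q_def)
    have eT: "e = (\<Sum>k\<in>I i - T. s k)" using decomp_dim[OF T(3)] by (simp add: e_def)
    have lenns: "length (ns i) = ds i"
      by (simp add: ns_def newton_part_eq decreasing_tuple size_slope_mset dsI[OF i])
    have finI: "finite (I i)" by (rule decompD(1)[OF U'])
    have "slope_mset r s (I i) = slope_mset r s (I i - T) + slope_mset r s T"
    proof -
      have "(I i - T) \<inter> T = {}" "I i - T \<union> T = I i" using T(1) by auto
      then show ?thesis
        using slope_mset_Un[of "I i - T" T r s] finI finite_subset[OF T(1) finI] by simp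
    qed
    then have "slope_mset r s (I i - T) \<subseteq># mset (ns i)"
      by (simp add: ns_def newton_part_eq decreasing_tuple)
    from sum_list_drop_le_sum_mset[OF _ this]
    have "sum_list (drop (length (ns i) - size (slope_mset r s (I i - T))) (ns i))
        \<le> sum_mset (slope_mset r s (I i - T))"
      by (simp add: ns_def newton_part_eq decreasing_tuple)
    moreover have "length (ns i) - size (slope_mset r s (I i - T)) = q"
      using e eT lenns by (simp add: size_slope_mset)
    moreover have "sum_mset (slope_mset r s (I i - T)) = sum_list (newton_part r s (I i - T))"
      by (simp add: newton_part_eq decreasing_tuple)
    ultimately have tN: "sum_list (drop q (ns i)) \<le> sum_list (newton_part r s (I i - T))" by simp
    have "slope F X (H (i - 1)) = (sum_list (drop q (hs i)) - sum_list (newton_part r s (I i - T))) / of_nat e"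
      using slope_eq(1)[OF typeF T(3) dim] gr_layer[OF i X] eT
      by (simp add: decreasing_tuple sum_mset_sum_list q_def)
    also have "\<dots> \<le> (sum_list (drop q (hs i)) - sum_list (drop q (ns i))) / of_nat e"
      using tN by (intro divide_right_mono) auto
    \<comment> \<open>Tail form of domination at \<open>q\<close>; by \<open>lam_eq\<close> the mean
      difference of the two tuples is \<open>lam i\<close>.\<close>
    also have "\<dots> \<le> (of_nat e * lam i) / of_nat e"
    proof (intro divide_right_mono)
      have "sum_list (drop q (hs i)) - sum_list (drop q (ns i))
          \<le> of_nat (length (hs i) - q) * ((sum_list (hs i) - sum_list (ns i)) / of_nat (length (hs i)))"
        unfolding hs_def ns_def using e(3) len_hs[OF i, unfolded hs_def] by (intro dominates_drop dom[OF i]) simp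
      also have "length (hs i) - q = e" using len_hs[OF i] e by simp
      also have "(sum_list (hs i) - sum_list (ns i)) / of_nat (length (hs i)) = lam i"
        using lam_eq[OF i] ds[OF i] len_hs[OF i] by (simp add: hs_def ns_def flip: lam_eq[OF i])
      finally show "sum_list (drop q (hs i)) - sum_list (drop q (ns i)) \<le> of_nat e * lam i" .
    qed simp
    also have "\<dots> = lam i" using e(1) by simp
    finally show "slope F X (H (i - 1)) \<le> slope F (H i) (H (i - 1))" unfolding slopeH[OF i] .
  qed
  have "is_HN_filtration F n H"
    unfolding is_HN_filtration_def
  proof (intro conjI ballI allI impI)
    show "H 0 = {0}" "H n = UNIV" by (rule H0, rule Hn)
    show "subisocrystal (H i)" if "i \<le> n" for i by (rule H_sub[OF that])
    show "H (i - 1) \<subset> H i" "semistable F (H i) (H (i - 1))" if i: "i \<in> {1..n}" for i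
      using H_le[OF i] dimH[OF i] ds[OF i] ss[OF i] by auto
    show "strict_antimono_on {1..n} (\<lambda>i. slope F (H i) (H (i - 1)))"
      using lam slopeH by (simp add: monotone_on_def)
  qed
  moreover have "map (\<lambda>i. replicate (ds i) (lam i)) [1..<Suc n] =
      map (\<lambda>i. replicate (dim (H i) - dim (H (i - 1))) (slope F (H i) (H (i - 1)))) [1..<Suc n]"
  proof (rule map_cong[OF refl])
    fix i assume "i \<in> set [1..<Suc n]"
    then have i: "i \<in> {1..n}" by auto
    show "replicate (ds i) (lam i) =
        replicate (dim (H i) - dim (H (i - 1))) (slope F (H i) (H (i - 1)))"
      unfolding slopeH[OF i] dimH[OF i] by simp
  qed
  then have "concat (map (\<lambda>i. replicate (ds i) (lam i)) [1..<Suc n]) =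
      concat (map (\<lambda>i. replicate (dim (H i) - dim (H (i - 1))) (slope F (H i) (H (i - 1)))) [1..<Suc n])"
    by (rule arg_cong)
  ultimately have "is_HN_vector F (concat (map (\<lambda>i. replicate (ds i) (lam i)) [1..<Suc n]))"
    unfolding is_HN_vector_def by (intro exI conjI)
  then show ?thesis using typeF by blast
qed

end

theorem theorem1:
  fixes p :: nat
    and W :: "'K::field_char_0 set"
    and red :: "'K \<Rightarrow> 'k::alg_closed_field"
    and \<sigma> :: "'K \<Rightarrow> 'K"
    and scale :: "'K \<Rightarrow> 'v::ab_group_add \<Rightarrow> 'v"
    and \<Phi> :: "'v \<Rightarrow> 'v"
    and d l n :: nat
    and r :: "nat \<Rightarrow> int" and s :: "nat \<Rightarrow> nat"
    and \<mu> lam :: "nat \<Rightarrow> rat" and ds :: "nat \<Rightarrow> nat"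
  assumes "isocrystal p W red \<sigma> scale \<Phi>"
    and "vector_space.dim scale (UNIV :: 'v set) = d"
    and "isocrystal.has_newton_slopes p scale \<Phi> UNIV {0} l r s"
    and "\<And>i. i \<in> {1..l} \<Longrightarrow> s i > 0 \<and> coprime (r i) (int (s i))"
    and "antimono_on {1..l} (\<lambda>i. of_int (r i) / of_nat (s i) :: rat)"
    and "antimono_on {1..d} \<mu>"
    and "strict_antimono_on {1..n} lam"
    and "\<And>i. i \<in> {1..n} \<Longrightarrow> ds i \<ge> 1"
    and "(\<Sum>i=1..n. ds i) = d"
  shows "(\<exists>F. isocrystal.filtration_of_type scale F d \<mu> \<and>
              isocrystal.is_HN_vector p scale \<Phi> F
                (concat (map (\<lambda>i. replicate (ds i) (lam i)) [1..<Suc n])))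
     \<longleftrightarrow> (\<exists>I J. is_partition {1..l} n I \<and> is_partition {1..d} n J \<and>
           (\<forall>i\<in>{1..n}.
              card (J i) = ds i \<and>
              ds i = (\<Sum>k\<in>I i. s k) \<and>
              dominates (hodge_part \<mu> (J i)) (newton_part r s (I i)) \<and>
              lam i * of_nat (ds i) = sum_list (hodge_part \<mu> (J i)) - sum_list (newton_part r s (I i))))"
proof -
  interpret isocrystal p W red \<sigma> scale \<Phi> by (rule assms(1))
  show ?thesis
  proof
    assume "\<exists>F. filtration_of_type F d \<mu> \<and>
      is_HN_vector F (concat (map (\<lambda>i. replicate (ds i) (lam i)) [1..<Suc n]))"
    then obtain F where "filtration_of_type F d \<mu>"
      "is_HN_vector F (concat (map (\<lambda>i. replicate (ds i) (lam i)) [1..<Suc n]))"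
      by (elim exE conjE)
    then show "\<exists>I J. is_partition {1..l} n I \<and> is_partition {1..d} n J \<and>
        (\<forall>i\<in>{1..n}. card (J i) = ds i \<and> ds i = (\<Sum>k\<in>I i. s k) \<and>
           dominates (hodge_part \<mu> (J i)) (newton_part r s (I i)) \<and>
           lam i * of_nat (ds i) = sum_list (hodge_part \<mu> (J i)) - sum_list (newton_part r s (I i)))"
      by (intro HN_vector_imp_partition[OF assms(2,3,7)] assms(8))
  next
    assume "\<exists>I J. is_partition {1..l} n I \<and> is_partition {1..d} n J \<and>
        (\<forall>i\<in>{1..n}. card (J i) = ds i \<and> ds i = (\<Sum>k\<in>I i. s k) \<and>
           dominates (hodge_part \<mu> (J i)) (newton_part r s (I i)) \<and>
           lam i * of_nat (ds i) = sum_list (hodge_part \<mu> (J i)) - sum_list (newton_part r s (I i)))"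
    then obtain I J where IJ: "is_partition {1..l} n I" "is_partition {1..d} n J"
      and main: "\<forall>i\<in>{1..n}. card (J i) = ds i \<and> ds i = (\<Sum>k\<in>I i. s k) \<and>
           dominates (hodge_part \<mu> (J i)) (newton_part r s (I i)) \<and>
           lam i * of_nat (ds i) = sum_list (hodge_part \<mu> (J i)) - sum_list (newton_part r s (I i))"
      by (elim exE conjE)
    show "\<exists>F. filtration_of_type F d \<mu> \<and>
        is_HN_vector F (concat (map (\<lambda>i. replicate (ds i) (lam i)) [1..<Suc n]))"
      by (rule partition_imp_HN_vector[OF assms(2,3,7) assms(8) assms(9) IJ]) (use main in blast)+
  qed
qed

end
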